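(* The theory $\mathrm{RCA}_0^{\Omega}$ proves the equivalences $$\Pi^0_1\text{-TRANS}\leftrightarrow \mathrm{WEIMAX}^{*}\leftrightarrow \mathrm{UWEIMAX}\leftrightarrow (\exists^{2}).$$
   Context: BASE THEORY. Finite types: $0$ (natural numbers), $\sigma\to\tau$, and $\sigma^{*}$ (finite sequences of objects of type $\sigma$); $1=0\to 0$, $2=1\to 0$, $3=2\to 0$. Superscripts indicate types; tuples are coded as single objects where convenient. Equality $=_0$ is primitive; for $\tau=\tau_1\to\dots\to\tau_k\to 0$, $x=_\tau y$ means $(\forall z_1\dots z_k)(xz_1\dots z_k=_0 yz_1\dots z_k)$. $\mathrm{RCA}_0^{\omega}$ is Kohlenbach's higher-order base theory: classical arithmetic in all finite types with combinators, zero, successor, the recursor $R_0$ (primitive recursion with type $0$ values), quantifier-free induction, extensionality $x=_\rho y\to\varphi(x)=_\tau\varphi(y)$ for all $\varphi^{\rho\to\tau}$, and $\mathrm{QF\text{-}AC}^{1,0}$, where $\mathrm{QF\text{-}AC}^{\sigma,\tau}$ is $(\forall x^\sigma)(\exists y^\tau)A_0(x,y)\to(\exists F^{\sigma\to\tau})(\forall x)A_0(x,F(x))$ for quantifier-free $A_0$. $\mathrm{RCA}_0^{\Omega}$ extends $\mathrm{RCA}_0^{\omega}$ (with the types $\sigma^*$) by a predicate $\mathrm{st}$ ("is standard") for each type. A formula is internal if it does not contain $\mathrm{st}$; $(\forall^{\mathrm{st}}x)A$ is $(\forall x)(\mathrm{st}(x)\to A)$, $(\exists^{\mathrm{st}}x)A$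 is $(\exists x)(\mathrm{st}(x)\wedge A)$; $N\in\Omega$ means $\neg\mathrm{st}(N^0)$; $A^{\mathrm{st}}$ is $A$ with all quantifiers (except bounded number quantifiers) relativised to $\mathrm{st}$. Axioms: (i) standardness respects equality, closed terms are standard, a standard functional applied to a standard object is standard, and numbers below a standard number are standard; (ii) Idealization: $(\forall^{\mathrm{st}}x^{\sigma^*})(\exists y^\tau)(\forall z\in x)\varphi(z,y)\to(\exists y)(\forall^{\mathrm{st}}z^{\sigma})\varphi(z,y)$ for internal $\varphi$; (iii) $\mathrm{HAC}_{\mathrm{int}}$: $(\forall^{\mathrm{st}}x^{\rho})(\exists^{\mathrm{st}}y^{\tau})\varphi(x,y)\to(\exists^{\mathrm{st}}\Phi^{\rho\to\tau^*})(\forall^{\mathrm{st}}x)(\exists y\in\Phi(x))\varphi(x,y)$ for internal $\varphi$; (iv) $\mathrm{PF\text{-}TP}_\forall$: $(\forall^{\mathrm{st}}x^\tau)\varphi(x)\to(\forall x^\tau)\varphi(x)$ for internal $\varphi(x)$ with no parameters other than $x$; (v) for certain functionals uniquely specified by a parameter-free internal formula $D$ (e.g. the one in $(\exists^2)$), a constant $\Xi_0$ with the axiom $\mathrm{st}(\Xi_0)\wedge(\forall^{\mathrm{st}}\Xi)[D^{\mathrm{st}}(\Xi)\to \Xi_0$ and $\Xi$ agree on all standard inputs$]$; these constants do not count as parameters in (iv). NOTATION. A real is a fast-converging Cauchy sequence of rationals $q_{(\cdot)}^1$, i.e. $(\forall n,i)(|q_n-q_{n+i}|<2^{-n})$ (via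 a standard trick every $f^1$ can be viewed as a real); reals $q_{(\cdot)},r_{(\cdot)}$ are equal if $(\forall n)(|q_n-r_n|\leq 2^{-n})$. Functions from reals to reals are given by functionals of type $1\to1$ mapping equal reals to equal reals. $f\in C[0,1]$ is the internal formula stating that $f$ is $\varepsilon$-$\delta$-continuous on $[0,1]$. PRINCIPLES. $(\exists^2)$: $(\exists\varphi^2)(\forall g^1)[(\exists x^0)g(x)=0\leftrightarrow\varphi(g)=0]$. $\Pi^0_1\text{-TRANS}$: $(\forall^{\mathrm{st}}f^1)[(\forall^{\mathrm{st}}n^0)f(n)=0\to(\forall n^0)f(n)=0]$. $\mathrm{WEIMAX}^*$: $(\forall^{\mathrm{st}}f\in C[0,1])(\exists^{\mathrm{st}}x^1\in[0,1])(\forall y^1\in[0,1])(f(y)\leq f(x))$. $\mathrm{UWEIMAX}$: $(\exists\Phi^{(1\to1)\to1})(\forall f\in C[0,1])(\forall y\in[0,1])(f(y)\leq f(\Phi(f)))$ (with $\Phi(f)\in[0,1]$). *)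

theory Defs
  imports Main
begin

section \<open>Syntax of the language of finite types with a standardness predicate\<close>

datatype ty = N0 | Fn ty ty (infixr \<open>\<Rrightarrow>\<close> 65) | Seq ty

abbreviation T1 :: ty where "T1 \<equiv> N0 \<Rrightarrow> N0"
abbreviation T2 :: ty where "T2 \<equiv> T1 \<Rrightarrow> N0"

text \<open>A variable carries its type; variables with equal names and different types are distinct.\<close>

type_synonym var = "nat \<times> ty"

text \<open>
  Finite sequences are handled through \<open>Init f n\<close>, denoting \<open>\<langle>f 0, \<dots>, f (n - 1)\<rangle>\<close>, the length, and the
  entries. The empty sequence, cons, and concatenation are definable from these.
  \<open>Xi x\<close> is the constant for the functional specified by a formula with sole free variable \<open>x\<close>;
  which of these constants are present is determined by a signature.
\<close>

datatype con =
    ZeroC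
  | SuccC
  | RecC
  | KC ty ty
  | SC ty ty ty
  | InitC ty
  | LenC ty
  | ProjC ty
  | Xi var

datatype tm = Var var | Con con | App tm tm (infixl \<open>\<cdot>\<close> 100)

text \<open>\<open>St t\<close> is the standardness predicate of the type of \<open>t\<close>; equality is primitive at type 0 only.\<close>

datatype fm = Eq tm tm | St tm | Fls | Imp fm fm | All var fm

primrec con_ty :: "con \<Rightarrow> ty" where
  "con_ty ZeroC = N0"
| "con_ty SuccC = N0 \<Rrightarrow> N0"
| "con_ty RecC = N0 \<Rrightarrow> N0 \<Rrightarrow> (N0 \<Rrightarrow> N0 \<Rrightarrow> N0) \<Rrightarrow> N0"
| "con_ty (KC \<rho> \<tau>) = \<rho> \<Rrightarrow> \<tau> \<Rrightarrow> \<rho>"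
| "con_ty (SC \<delta> \<rho> \<tau>) = (\<delta> \<Rrightarrow> \<rho> \<Rrightarrow> \<tau>) \<Rrightarrow> (\<delta> \<Rrightarrow> \<rho>) \<Rrightarrow> \<delta> \<Rrightarrow> \<tau>"
| "con_ty (InitC \<sigma>) = (N0 \<Rrightarrow> \<sigma>) \<Rrightarrow> N0 \<Rrightarrow> Seq \<sigma>"
| "con_ty (LenC \<sigma>) = Seq \<sigma> \<Rrightarrow> N0"
| "con_ty (ProjC \<sigma>) = Seq \<sigma> \<Rrightarrow> N0 \<Rrightarrow> \<sigma>"
| "con_ty (Xi x) = snd x"

fun cod :: "ty \<Rightarrow> ty" where
  "cod (\<sigma> \<Rrightarrow> \<tau>) = \<tau>"
| "cod \<tau> = \<tau>"

primrec ty_of :: "tm \<Rightarrow> ty" where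
  "ty_of (Var x) = snd x"
| "ty_of (Con c) = con_ty c"
| "ty_of (s \<cdot> t) = cod (ty_of s)"

text \<open>The signature \<open>C\<close> is the set of those \<open>x\<close> for which the constant \<open>Xi x\<close> is in the language.\<close>

primrec con_ok :: "var set \<Rightarrow> con \<Rightarrow> bool" where
  "con_ok C ZeroC = True"
| "con_ok C SuccC = True"
| "con_ok C RecC = True"
| "con_ok C (KC \<rho> \<tau>) = True"
| "con_ok C (SC \<delta> \<rho> \<tau>) = True"
| "con_ok C (InitC \<sigma>) = True"
| "con_ok C (LenC \<sigma>) = True"
| "con_ok C (ProjC \<sigma>) = True"
| "con_ok C (Xi x) = (x \<in> C)"

primrec wft :: "var set \<Rightarrow> tm \<Rightarrow> bool" where
  "wft C (Var x) = True"
| "wft C (Con c) = con_ok C c"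
| "wft C (s \<cdot> t) = (wft C s \<and> wft C t \<and> (\<exists>\<tau>. ty_of s = ty_of t \<Rrightarrow> \<tau>))"

primrec wff :: "var set \<Rightarrow> fm \<Rightarrow> bool" where
  "wff C (Eq s t) = (wft C s \<and> wft C t \<and> ty_of s = N0 \<and> ty_of t = N0)"
| "wff C (St t) = wft C t"
| "wff C Fls = True"
| "wff C (Imp \<phi> \<psi>) = (wff C \<phi> \<and> wff C \<psi>)"
| "wff C (All x \<phi>) = wff C \<phi>"

primrec tvars :: "tm \<Rightarrow> var set" where
  "tvars (Var x) = {x}"
| "tvars (Con c) = {}"
| "tvars (s \<cdot> t) = tvars s \<union> tvars t"

primrec fv :: "fm \<Rightarrow> var set" where
  "fv (Eq s t) = tvars s \<union> tvars t"
| "fv (St t) = tvars t"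
| "fv Fls = {}"
| "fv (Imp \<phi> \<psi>) = fv \<phi> \<union> fv \<psi>"
| "fv (All x \<phi>) = fv \<phi> - {x}"

primrec tsubst :: "var \<Rightarrow> tm \<Rightarrow> tm \<Rightarrow> tm" where
  "tsubst x u (Var y) = (if y = x then u else Var y)"
| "tsubst x u (Con c) = Con c"
| "tsubst x u (s \<cdot> t) = tsubst x u s \<cdot> tsubst x u t"

text \<open>\<open>subst x u \<phi>\<close> does not rename bound variables; it is only used when \<open>free_for u x \<phi>\<close> holds.\<close>

primrec subst :: "var \<Rightarrow> tm \<Rightarrow> fm \<Rightarrow> fm" where
  "subst x u (Eq s t) = Eq (tsubst x u s) (tsubst x u t)"
| "subst x u (St t) = St (tsubst x u t)"
| "subst x u Fls = Fls"
| "subst x u (Imp \<phi> \<psi>) = Imp (subst x u \<phi>) (subst x u \<psi>)"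
| "subst x u (All y \<phi>) = (if y = x then All y \<phi> else All y (subst x u \<phi>))"

primrec free_for :: "tm \<Rightarrow> var \<Rightarrow> fm \<Rightarrow> bool" where
  "free_for u x (Eq s t) = True"
| "free_for u x (St t) = True"
| "free_for u x Fls = True"
| "free_for u x (Imp \<phi> \<psi>) = (free_for u x \<phi> \<and> free_for u x \<psi>)"
| "free_for u x (All y \<phi>) = (x \<notin> fv (All y \<phi>) \<or> (y \<notin> tvars u \<and> free_for u x \<phi>))"

primrec internal :: "fm \<Rightarrow> bool" where
  "internal (Eq s t) = True"
| "internal (St t) = False"
| "internal Fls = True"
| "internal (Imp \<phi> \<psi>) = (internal \<phi> \<and> internal \<psi>)"
| "internal (All x \<phi>) = internal \<phi>"

primrec quantifier_free :: "fm \<Rightarrow> bool" where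
  "quantifier_free (Eq s t) = True"
| "quantifier_free (St t) = False"
| "quantifier_free Fls = True"
| "quantifier_free (Imp \<phi> \<psi>) = (quantifier_free \<phi> \<and> quantifier_free \<psi>)"
| "quantifier_free (All x \<phi>) = False"

abbreviation Neg :: "fm \<Rightarrow> fm" where "Neg \<phi> \<equiv> Imp \<phi> Fls"
abbreviation Conj :: "fm \<Rightarrow> fm \<Rightarrow> fm" where "Conj \<phi> \<psi> \<equiv> Neg (Imp \<phi> (Neg \<psi>))"
abbreviation Disj :: "fm \<Rightarrow> fm \<Rightarrow> fm" where "Disj \<phi> \<psi> \<equiv> Imp (Neg \<phi>) \<psi>"
abbreviation Iff :: "fm \<Rightarrow> fm \<Rightarrow> fm" where "Iff \<phi> \<psi> \<equiv> Conj (Imp \<phi> \<psi>) (Imp \<psi> \<phi>)"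
abbreviation Ex :: "var \<Rightarrow> fm \<Rightarrow> fm" where "Ex x \<phi> \<equiv> Neg (All x (Neg \<phi>))"
abbreviation AllSt :: "var \<Rightarrow> fm \<Rightarrow> fm" where "AllSt x \<phi> \<equiv> All x (Imp (St (Var x)) \<phi>)"
abbreviation ExSt :: "var \<Rightarrow> fm \<Rightarrow> fm" where "ExSt x \<phi> \<equiv> Ex x (Conj (St (Var x)) \<phi>)"


section \<open>Derivability in many-sorted classical logic\<close>

text \<open>
  \<open>deriv C T \<Gamma> \<phi>\<close>: natural deduction of \<open>\<phi>\<close> from the hypotheses \<open>\<Gamma>\<close> and the axioms \<open>T\<close>. Free
  variables of an axiom are read universally: the eigenvariable condition concerns \<open>\<Gamma>\<close> only.
\<close>

inductive deriv :: "var set \<Rightarrow> fm set \<Rightarrow> fm set \<Rightarrow> fm \<Rightarrow> bool" for C T where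
  Ax: "\<phi> \<in> T \<Longrightarrow> deriv C T \<Gamma> \<phi>"
| Hyp: "\<phi> \<in> \<Gamma> \<Longrightarrow> wff C \<phi> \<Longrightarrow> deriv C T \<Gamma> \<phi>"
| ImpI: "wff C \<phi> \<Longrightarrow> deriv C T (insert \<phi> \<Gamma>) \<psi> \<Longrightarrow> deriv C T \<Gamma> (Imp \<phi> \<psi>)"
| ImpE: "deriv C T \<Gamma> (Imp \<phi> \<psi>) \<Longrightarrow> deriv C T \<Gamma> \<phi> \<Longrightarrow> deriv C T \<Gamma> \<psi>"
| RAA: "wff C \<phi> \<Longrightarrow> deriv C T (insert (Neg \<phi>) \<Gamma>) Fls \<Longrightarrow> deriv C T \<Gamma> \<phi>"
| AllI: "deriv C T \<Gamma> \<phi> \<Longrightarrow> (\<forall>\<gamma>\<in>\<Gamma>. x \<notin> fv \<gamma>) \<Longrightarrow> deriv C T \<Gamma> (All x \<phi>)"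
| AllE: "deriv C T \<Gamma> (All x \<phi>) \<Longrightarrow> wft C u \<Longrightarrow> ty_of u = snd x \<Longrightarrow> free_for u x \<phi>
    \<Longrightarrow> deriv C T \<Gamma> (subst x u \<phi>)"
| EqRefl: "wft C s \<Longrightarrow> ty_of s = N0 \<Longrightarrow> deriv C T \<Gamma> (Eq s s)"
| EqSubst: "deriv C T \<Gamma> (Eq s t) \<Longrightarrow> deriv C T \<Gamma> (subst x s \<phi>) \<Longrightarrow> wff C \<phi> \<Longrightarrow> snd x = N0
    \<Longrightarrow> free_for s x \<phi> \<Longrightarrow> free_for t x \<phi> \<Longrightarrow> deriv C T \<Gamma> (subst x t \<phi>)"

definition proves :: "var set \<Rightarrow> fm set \<Rightarrow> fm \<Rightarrow> bool" where
  "proves C T \<phi> \<longleftrightarrow> deriv C T {} \<phi>"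


section \<open>Terms for elementary arithmetic\<close>

text \<open>\<open>lam x t\<close> is \<open>\<lambda>x. t\<close>, translated into combinators by bracket abstraction.\<close>

primrec lam :: "var \<Rightarrow> tm \<Rightarrow> tm" where
  "lam x (Var y) = (if y = x
     then Con (SC (snd x) (snd x \<Rrightarrow> snd x) (snd x))
          \<cdot> Con (KC (snd x) (snd x \<Rrightarrow> snd x)) \<cdot> Con (KC (snd x) (snd x))
     else Con (KC (snd y) (snd x)) \<cdot> Var y)"
| "lam x (Con c) = Con (KC (con_ty c) (snd x)) \<cdot> Con c"
| "lam x (s \<cdot> t) = (if x \<in> tvars (s \<cdot> t)
     then Con (SC (snd x) (ty_of t) (cod (ty_of s))) \<cdot> lam x s \<cdot> lam x t
     else Con (KC (cod (ty_of s)) (snd x)) \<cdot> (s \<cdot> t))"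

abbreviation zero :: tm where "zero \<equiv> Con ZeroC"
abbreviation succ :: "tm \<Rightarrow> tm" where "succ t \<equiv> Con SuccC \<cdot> t"
abbreviation rec0 :: "tm \<Rightarrow> tm \<Rightarrow> tm \<Rightarrow> tm" where "rec0 x y z \<equiv> Con RecC \<cdot> x \<cdot> y \<cdot> z"

primrec num :: "nat \<Rightarrow> tm" where
  "num 0 = zero"
| "num (Suc n) = succ (num n)"

abbreviation lam0 :: "nat \<Rightarrow> tm \<Rightarrow> tm" where "lam0 i t \<equiv> lam (i, N0) t"
abbreviation var0 :: "nat \<Rightarrow> tm" where "var0 i \<equiv> Var (i, N0)"

text \<open>The heads are closed terms, so that no capture can occur when they are applied to arguments.\<close>

definition add_c :: tm where
  "add_c = lam0 0 (lam0 1 (rec0 (var0 1) (var0 0) (lam0 2 (lam0 3 (succ (var0 2))))))"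
definition add :: "tm \<Rightarrow> tm \<Rightarrow> tm" where "add s t = add_c \<cdot> s \<cdot> t"

definition mult_c :: tm where
  "mult_c = lam0 0 (lam0 1 (rec0 (var0 1) zero (lam0 2 (lam0 3 (add (var0 2) (var0 0))))))"
definition mult :: "tm \<Rightarrow> tm \<Rightarrow> tm" where "mult s t = mult_c \<cdot> s \<cdot> t"

definition pred_c :: tm where
  "pred_c = lam0 0 (rec0 (var0 0) zero (lam0 2 (lam0 3 (var0 3))))"

definition monus_c :: tm where
  "monus_c = lam0 0 (lam0 1 (rec0 (var0 1) (var0 0) (lam0 2 (lam0 3 (pred_c \<cdot> var0 2)))))"
definition monus :: "tm \<Rightarrow> tm \<Rightarrow> tm" where "monus s t = monus_c \<cdot> s \<cdot> t"

definition pow2_c :: tm where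
  "pow2_c = lam0 0 (rec0 (var0 0) (num 1) (lam0 2 (lam0 3 (add (var0 2) (var0 2)))))"
definition pow2 :: "tm \<Rightarrow> tm" where "pow2 t = pow2_c \<cdot> t"

text \<open>\<open>pair x y\<close> is Cantor's bijection \<open>(x + y)(x + y + 1) / 2 + y\<close>; \<open>tri\<close> computes triangular numbers.\<close>

definition tri_c :: tm where
  "tri_c = lam0 0 (rec0 (var0 0) zero (lam0 2 (lam0 3 (add (var0 2) (succ (var0 3))))))"
definition pair :: "tm \<Rightarrow> tm \<Rightarrow> tm" where "pair s t = add (tri_c \<cdot> add s t) t"

definition leq :: "tm \<Rightarrow> tm \<Rightarrow> fm" where "leq s t = Eq (monus s t) zero"
definition less :: "tm \<Rightarrow> tm \<Rightarrow> fm" where "less s t = Eq (monus (succ s) t) zero"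

definition BAll :: "var \<Rightarrow> tm \<Rightarrow> fm \<Rightarrow> fm" where "BAll x t \<phi> = All x (Imp (less (Var x) t) \<phi>)"
definition BEx :: "var \<Rightarrow> tm \<Rightarrow> fm \<Rightarrow> fm" where "BEx x t \<phi> = Neg (BAll x t (Neg \<phi>))"

text \<open>
  Every name from \<open>newvar ts\<close> onwards is unused in the terms \<open>ts\<close>; the formulas below take their
  bound variables from there, so that they may be instantiated with arbitrary terms.
\<close>

primrec name_bound :: "tm \<Rightarrow> nat" where
  "name_bound (Var x) = Suc (fst x)"
| "name_bound (Con c) = 0"
| "name_bound (s \<cdot> t) = max (name_bound s) (name_bound t)"

definition newvar :: "tm list \<Rightarrow> nat" where
  "newvar ts = foldr (\<lambda>t n. max (name_bound t) n) ts 0"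


section \<open>Equality in all types and finite sequences\<close>

abbreviation len :: "ty \<Rightarrow> tm \<Rightarrow> tm" where "len \<sigma> s \<equiv> Con (LenC \<sigma>) \<cdot> s"
abbreviation proj :: "ty \<Rightarrow> tm \<Rightarrow> tm \<Rightarrow> tm" where "proj \<sigma> s i \<equiv> Con (ProjC \<sigma>) \<cdot> s \<cdot> i"
abbreviation init :: "ty \<Rightarrow> tm \<Rightarrow> tm \<Rightarrow> tm" where "init \<sigma> f n \<equiv> Con (InitC \<sigma>) \<cdot> f \<cdot> n"

primrec eqf :: "ty \<Rightarrow> tm \<Rightarrow> tm \<Rightarrow> fm" where
  "eqf N0 s t = Eq s t"
| "eqf (\<sigma> \<Rrightarrow> \<tau>) s t =
    (let z = (newvar [s, t], \<sigma>) in All z (eqf \<tau> (s \<cdot> Var z) (t \<cdot> Var z)))"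
| "eqf (Seq \<sigma>) s t =
    (let i = (newvar [s, t], N0) in
     Conj (Eq (len \<sigma> s) (len \<sigma> t))
          (BAll i (len \<sigma> s) (eqf \<sigma> (proj \<sigma> s (Var i)) (proj \<sigma> t (Var i)))))"

definition elem :: "ty \<Rightarrow> tm \<Rightarrow> tm \<Rightarrow> fm" where
  "elem \<sigma> z s = (let i = (newvar [z, s], N0) in BEx i (len \<sigma> s) (eqf \<sigma> z (proj \<sigma> s (Var i))))"

primrec zero_of :: "ty \<Rightarrow> tm" where
  "zero_of N0 = zero"
| "zero_of (\<sigma> \<Rrightarrow> \<tau>) = Con (KC \<tau> \<sigma>) \<cdot> zero_of \<tau>"
| "zero_of (Seq \<sigma>) = init \<sigma> (Con (KC \<sigma> N0) \<cdot> zero_of \<sigma>) zero"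


section \<open>The base theory \<open>RCA\<^sub>0\<^sup>\<omega>\<close>\<close>

text \<open>
  Extensionality applies to the entry function as well, so that entries beyond the length must not
  depend on the representation of a sequence; they are set to the zero functional.
\<close>

inductive_set RCA0_omega :: "var set \<Rightarrow> fm set" for C where
  succ_nonzero: "Neg (Eq (succ (var0 0)) zero) \<in> RCA0_omega C"
| succ_inj: "Imp (Eq (succ (var0 0)) (succ (var0 1))) (Eq (var0 0) (var0 1)) \<in> RCA0_omega C"
| comb_K: "x = Var (0, \<rho>) \<Longrightarrow> y = Var (1, \<tau>)
    \<Longrightarrow> eqf \<rho> (Con (KC \<rho> \<tau>) \<cdot> x \<cdot> y) x \<in> RCA0_omega C"
| comb_S: "x = Var (0, \<delta> \<Rrightarrow> \<rho> \<Rrightarrow> \<tau>) \<Longrightarrow> y = Var (1, \<delta> \<Rrightarrow> \<rho>) \<Longrightarrow> z = Var (2, \<delta>)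
    \<Longrightarrow> eqf \<tau> (Con (SC \<delta> \<rho> \<tau>) \<cdot> x \<cdot> y \<cdot> z) (x \<cdot> z \<cdot> (y \<cdot> z)) \<in> RCA0_omega C"
| rec_zero: "y = var0 1 \<Longrightarrow> z = Var (2, N0 \<Rrightarrow> N0 \<Rrightarrow> N0)
    \<Longrightarrow> Eq (rec0 zero y z) y \<in> RCA0_omega C"
| rec_succ: "x = var0 0 \<Longrightarrow> y = var0 1 \<Longrightarrow> z = Var (2, N0 \<Rrightarrow> N0 \<Rrightarrow> N0)
    \<Longrightarrow> Eq (rec0 (succ x) y z) (z \<cdot> rec0 x y z \<cdot> x) \<in> RCA0_omega C"
| len_init: "f = Var (0, N0 \<Rrightarrow> \<sigma>) \<Longrightarrow> n = var0 1
    \<Longrightarrow> Eq (len \<sigma> (init \<sigma> f n)) n \<in> RCA0_omega C"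
| proj_init: "f = Var (0, N0 \<Rrightarrow> \<sigma>) \<Longrightarrow> n = var0 1 \<Longrightarrow> i = var0 2
    \<Longrightarrow> Imp (less i n) (eqf \<sigma> (proj \<sigma> (init \<sigma> f n) i) (f \<cdot> i)) \<in> RCA0_omega C"
| proj_beyond: "s = Var (0, Seq \<sigma>) \<Longrightarrow> i = var0 1
    \<Longrightarrow> Imp (leq (len \<sigma> s) i) (eqf \<sigma> (proj \<sigma> s i) (zero_of \<sigma>)) \<in> RCA0_omega C"
| qf_induction: "quantifier_free \<phi> \<Longrightarrow> wff C \<phi> \<Longrightarrow> snd n = N0
    \<Longrightarrow> Imp (Conj (subst n zero \<phi>) (All n (Imp \<phi> (subst n (succ (Var n)) \<phi>)))) (All n \<phi>)
        \<in> RCA0_omega C"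
| extensionality: "f = Var (0, \<rho> \<Rrightarrow> \<tau>) \<Longrightarrow> x = Var (1, \<rho>) \<Longrightarrow> y = Var (2, \<rho>)
    \<Longrightarrow> Imp (eqf \<rho> x y) (eqf \<tau> (f \<cdot> x) (f \<cdot> y)) \<in> RCA0_omega C"
| qf_ac: "quantifier_free \<phi> \<Longrightarrow> wff C \<phi> \<Longrightarrow> snd x = T1 \<Longrightarrow> snd y = N0 \<Longrightarrow> snd F = T2 \<Longrightarrow> F \<notin> fv \<phi>
    \<Longrightarrow> Imp (All x (Ex y \<phi>)) (Ex F (All x (subst y (Var F \<cdot> Var x) \<phi>))) \<in> RCA0_omega C"


section \<open>The nonstandard theory \<open>RCA\<^sub>0\<^sup>\<Omega>\<close>\<close>

text \<open>\<open>relativise \<phi>\<close> is \<open>\<phi>\<^sup>s\<^sup>t\<close>, for internal \<open>\<phi>\<close>. The existential quantifiers are covered since they are \<open>\<not>\<forall>\<not>\<close>.\<close>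

definition bounded_matrix :: "var \<Rightarrow> fm \<Rightarrow> bool" where
  "bounded_matrix x \<phi> \<longleftrightarrow>
     snd x = N0 \<and> (\<exists>t \<psi>. x \<notin> tvars t \<and> \<phi> = Imp (less (Var x) t) \<psi>)"

primrec relativise :: "fm \<Rightarrow> fm" where
  "relativise (Eq s t) = Eq s t"
| "relativise (St t) = St t"
| "relativise Fls = Fls"
| "relativise (Imp \<phi> \<psi>) = Imp (relativise \<phi>) (relativise \<psi>)"
| "relativise (All x \<phi>) =
    (if bounded_matrix x \<phi> then All x (relativise \<phi>) else AllSt x (relativise \<phi>))"

text \<open>
  A partial assignment \<open>D\<close> lists the functionals for which constants are present: \<open>D x = Some \<delta>\<close> means
  that \<open>\<delta>\<close>, with sole free variable \<open>x\<close>, specifies a functional of type \<open>snd x\<close>, named \<open>Xi x\<close>.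
  Being uniquely specified means that the base theory proves uniqueness.
\<close>

type_synonym specs = "var \<Rightarrow> fm option"

definition uniquely_specified :: "var \<Rightarrow> fm \<Rightarrow> bool" where
  "uniquely_specified x \<delta> \<longleftrightarrow>
     wff {} \<delta> \<and> internal \<delta> \<and> fv \<delta> \<subseteq> {x} \<and>
     (\<forall>y. snd y = snd x \<and> y \<noteq> x \<and> free_for (Var y) x \<delta> \<longrightarrow>
        proves {} (RCA0_omega {})
          (Imp (Conj \<delta> (subst x (Var y) \<delta>)) (eqf (snd x) (Var x) (Var y))))"

inductive_set RCA0_Omega :: "specs \<Rightarrow> fm set" for D where
  base: "\<phi> \<in> RCA0_omega (dom D) \<Longrightarrow> \<phi> \<in> RCA0_Omega D"
| st_eq: "x = Var (0, \<tau>) \<Longrightarrow> y = Var (1, \<tau>)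
    \<Longrightarrow> Imp (Conj (St x) (eqf \<tau> x y)) (St y) \<in> RCA0_Omega D"
| st_closed: "wft (dom D) t \<Longrightarrow> tvars t = {} \<Longrightarrow> St t \<in> RCA0_Omega D"
| st_app: "f = Var (0, \<sigma> \<Rrightarrow> \<tau>) \<Longrightarrow> x = Var (1, \<sigma>)
    \<Longrightarrow> Imp (Conj (St f) (St x)) (St (f \<cdot> x)) \<in> RCA0_Omega D"
| st_less: "Imp (Conj (St (var0 0)) (less (var0 1) (var0 0))) (St (var0 1)) \<in> RCA0_Omega D"
| idealization: "internal \<phi> \<Longrightarrow> wff (dom D) \<phi>
    \<Longrightarrow> snd x = Seq (snd z) \<Longrightarrow> x \<notin> fv \<phi> \<Longrightarrow> x \<noteq> y \<Longrightarrow> y \<noteq> z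
    \<Longrightarrow> Imp (AllSt x (Ex y (All z (Imp (elem (snd z) (Var z) (Var x)) \<phi>))))
            (Ex y (AllSt z \<phi>)) \<in> RCA0_Omega D"
| HAC_int: "internal \<phi> \<Longrightarrow> wff (dom D) \<phi>
    \<Longrightarrow> snd F = snd x \<Rrightarrow> Seq (snd y) \<Longrightarrow> F \<notin> fv \<phi> \<Longrightarrow> x \<noteq> y
    \<Longrightarrow> Imp (AllSt x (ExSt y \<phi>))
            (ExSt F (AllSt x (Ex y (Conj (elem (snd y) (Var y) (Var F \<cdot> Var x)) \<phi>))))
        \<in> RCA0_Omega D"
| PF_TP: "internal \<phi> \<Longrightarrow> wff (dom D) \<phi> \<Longrightarrow> fv \<phi> \<subseteq> {x}
    \<Longrightarrow> Imp (AllSt x \<phi>) (All x \<phi>) \<in> RCA0_Omega D"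
| spec_const: "D x = Some \<delta>
    \<Longrightarrow> Conj (St (Con (Xi x)))
          (AllSt x (Imp (relativise \<delta>) (relativise (eqf (snd x) (Con (Xi x)) (Var x)))))
        \<in> RCA0_Omega D"

definition RCA0_Omega_proves :: "specs \<Rightarrow> fm \<Rightarrow> bool" where
  "RCA0_Omega_proves D \<phi> \<longleftrightarrow> proves (dom D) (RCA0_Omega D) \<phi>"

text \<open>
  The matrix of \<open>(\<exists>\<^sup>2)\<close> fixes the functional only up to the choice of nonzero values; requiring
  values in \<open>{0, 1}\<close> makes it unique.
\<close>

definition exists2_spec :: "var \<Rightarrow> fm" where
  "exists2_spec \<Xi> =
     (let g = (Suc (fst \<Xi>), T1); n = (0, N0) in
      All g (Conj (Iff (Ex n (Eq (Var g \<cdot> Var n) zero)) (Eq (Var \<Xi> \<cdot> Var g) zero))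
                  (Disj (Eq (Var \<Xi> \<cdot> Var g) zero) (Eq (Var \<Xi> \<cdot> Var g) (num 1)))))"

definition admissible_specs :: "specs \<Rightarrow> bool" where
  "admissible_specs D \<longleftrightarrow>
     (\<forall>x \<delta>. D x = Some \<delta> \<longrightarrow> uniquely_specified x \<delta>) \<and>
     (\<exists>x. snd x = T2 \<and> D x = Some (exists2_spec x))"


section \<open>Real numbers\<close>

text \<open>
  A natural number \<open>pair (pair a b) c\<close> codes the rational \<open>(a - b) / (c + 1)\<close>, and every number is of
  this form. \<open>rat_cmp R q u n r v m\<close> is \<open>q + u 2\<^sup>-\<^sup>n R r + v 2\<^sup>-\<^sup>m\<close> for codes \<open>q, r\<close> and
  naturals \<open>u, n, v, m\<close>, cleared of denominators and subtractions.
\<close>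

definition rat_cmp ::
  "(tm \<Rightarrow> tm \<Rightarrow> fm) \<Rightarrow> tm \<Rightarrow> tm \<Rightarrow> tm \<Rightarrow> tm \<Rightarrow> tm \<Rightarrow> tm \<Rightarrow> fm" where
  "rat_cmp R q u n r v m =
     (let k = newvar [q, u, n, r, v, m];
          a = var0 k; b = var0 (k + 1); c = var0 (k + 2);
          a' = var0 (k + 3); b' = var0 (k + 4); c' = var0 (k + 5);
          d = succ c; d' = succ c'; P = pow2 n; Q = pow2 m; PQ = mult P Q;
          lhs = add (mult (add (mult a d') (mult b' d)) PQ) (mult u (mult (mult d d') Q));
          rhs = add (mult (add (mult a' d) (mult b d')) PQ) (mult v (mult (mult d d') P))
      in Ex (k, N0) (Ex (k + 1, N0) (Ex (k + 2, N0) (Ex (k + 3, N0) (Ex (k + 4, N0) (Ex (k + 5, N0)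
           (Conj (Eq q (pair (pair a b) c)) (Conj (Eq r (pair (pair a' b') c')) (R lhs rhs)))))))))"

definition rat_dist_less :: "tm \<Rightarrow> tm \<Rightarrow> tm \<Rightarrow> fm" where
  "rat_dist_less q r n =
     Conj (rat_cmp less q zero zero r (num 1) n) (rat_cmp less r zero zero q (num 1) n)"

definition rat_dist_leq :: "tm \<Rightarrow> tm \<Rightarrow> tm \<Rightarrow> fm" where
  "rat_dist_leq q r n =
     Conj (rat_cmp leq q zero zero r (num 1) n) (rat_cmp leq r zero zero q (num 1) n)"

definition is_real :: "tm \<Rightarrow> fm" where
  "is_real x =
     (let k = newvar [x]; n = var0 k; i = var0 (k + 1) in
      All (k, N0) (All (k + 1, N0) (rat_dist_less (x \<cdot> n) (x \<cdot> add n i) n)))"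

text \<open>
  Equality of reals with the customary bound \<open>\<bar>x\<^sub>n - y\<^sub>n\<bar> \<le> 2\<^sup>-\<^sup>n\<close>. For this rate of convergence it is slightly
  finer than equality of the limits (the bound for the latter is \<open>2 2\<^sup>-\<^sup>n\<close>). It is used only in the
  requirement that functions map equal reals to equal reals.
\<close>

definition real_eq :: "tm \<Rightarrow> tm \<Rightarrow> fm" where
  "real_eq x y =
     (let k = newvar [x, y]; n = var0 k in All (k, N0) (rat_dist_leq (x \<cdot> n) (y \<cdot> n) n))"

text \<open>
  The \<open>n\<close>-th approximation of a real has error at most \<open>2\<^sup>-\<^sup>n\<close>. Hence \<open>x \<le> y\<close> iff
  \<open>x\<^sub>n \<le> y\<^sub>n + 2 2\<^sup>-\<^sup>n\<close> for all \<open>n\<close>, and \<open>\<bar>x - y\<bar> < 2\<^sup>-\<^sup>k\<close> iff \<open>\<bar>x\<^sub>n - y\<^sub>n\<bar> + 2 2\<^sup>-\<^sup>n < 2\<^sup>-\<^sup>k\<close> for some \<open>n\<close>.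
\<close>

definition real_leq :: "tm \<Rightarrow> tm \<Rightarrow> fm" where
  "real_leq x y =
     (let k = newvar [x, y]; n = var0 k in
      All (k, N0) (rat_cmp leq (x \<cdot> n) zero zero (y \<cdot> n) (num 2) n))"

definition real_dist_less :: "tm \<Rightarrow> tm \<Rightarrow> tm \<Rightarrow> fm" where
  "real_dist_less x y k =
     (let j = newvar [x, y, k]; n = var0 j in
      Ex (j, N0) (Conj (rat_cmp less (x \<cdot> n) (num 2) n (y \<cdot> n) (num 1) k)
                       (rat_cmp less (y \<cdot> n) (num 2) n (x \<cdot> n) (num 1) k)))"

definition real_of_rat :: "tm \<Rightarrow> tm" where "real_of_rat q = Con (KC N0 N0) \<cdot> q"
definition real_zero :: tm where "real_zero = real_of_rat (pair (pair zero zero) zero)"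
definition real_one :: tm where "real_one = real_of_rat (pair (pair (num 1) zero) zero)"

definition in_unit :: "tm \<Rightarrow> fm" where
  "in_unit x = Conj (is_real x) (Conj (real_leq real_zero x) (real_leq x real_one))"

text \<open>
  \<open>continuous_unit f\<close> is \<open>f \<in> C[0,1]\<close>: \<open>f\<close> maps reals in the unit interval to reals, respects equality
  of reals there, and is \<open>\<epsilon>\<close>-\<open>\<delta>\<close>-continuous, with \<open>\<epsilon>\<close> and \<open>\<delta>\<close> ranging over the numbers \<open>2\<^sup>-\<^sup>k\<close>.
\<close>

definition continuous_unit :: "tm \<Rightarrow> fm" where
  "continuous_unit f =
     (let j = newvar [f];
          x = (j, T1); y = (j + 1, T1); k = (j + 2, N0); N = (j + 3, N0);
          fx = f \<cdot> Var x; fy = f \<cdot> Var y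
      in Conj (All x (Imp (in_unit (Var x)) (is_real fx)))
        (Conj (All x (Imp (in_unit (Var x)) (All y (Imp (in_unit (Var y))
                 (Imp (real_eq (Var x) (Var y)) (real_eq fx fy))))))
              (All x (Imp (in_unit (Var x)) (All k (Ex N (All y (Imp (in_unit (Var y))
                 (Imp (real_dist_less (Var x) (Var y) (Var N))
                      (real_dist_less fx fy (Var k)))))))))))"


section \<open>The principles\<close>

definition exists2 :: fm where
  "exists2 =
     (let \<phi> = (0, T2); g = (1, T1); x = (2, N0) in
      Ex \<phi> (All g (Iff (Ex x (Eq (Var g \<cdot> Var x) zero)) (Eq (Var \<phi> \<cdot> Var g) zero))))"

definition Pi01_TRANS :: fm where
  "Pi01_TRANS =
     (let f = (0, T1); n = (1, N0) in
      AllSt f (Imp (AllSt n (Eq (Var f \<cdot> Var n) zero)) (All n (Eq (Var f \<cdot> Var n) zero))))"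

definition WEIMAX_star :: fm where
  "WEIMAX_star =
     (let f = (0, T1 \<Rrightarrow> T1); x = (1, T1); y = (2, T1) in
      AllSt f (Imp (continuous_unit (Var f))
        (ExSt x (Conj (in_unit (Var x))
          (All y (Imp (in_unit (Var y)) (real_leq (Var f \<cdot> Var y) (Var f \<cdot> Var x))))))))"

definition UWEIMAX :: fm where
  "UWEIMAX =
     (let \<Phi> = (0, (T1 \<Rrightarrow> T1) \<Rrightarrow> T1); f = (1, T1 \<Rrightarrow> T1); y = (2, T1); x = Var \<Phi> \<cdot> Var f in
      Ex \<Phi> (All f (Imp (continuous_unit (Var f))
        (Conj (in_unit x)
          (All y (Imp (in_unit (Var y)) (real_leq (Var f \<cdot> Var y) (Var f \<cdot> x))))))))"

end

(* If the theory does not prove one of the equivalences, a Henkin construction yields an extensional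
   model in which it fails. One such countermodel is fixed once and for all and its sorts are turned
   into types, so that the usual mathematics can be done inside it. By HAC_int a standard functional
   lists finitely many candidate maxima for each standard continuous f. Applied to the bump functions
   max(0, e - |x - r|), where e > 0 iff h has a non-zero value and r is a standard real away from the
   candidates for the zero function, it gives a standard functional that separates the zero function
   from the standard non-zero h, and hence (exists^2). Conversely, (exists^2) decides the comparisons
   in the bisection search for a maximum, and transfer makes its witness standard. *)
theory Submission
  imports Defs "HOL-Library.Countable" "HOL-Computational_Algebra.Fraction_Field"
begin

text \<open>The claim is derivability in a formal calculus, while the arguments are analysis. In a
  model whose sorts are HOL types, type checking, \<open>linarith\<close> and the algebraic classes
  act on the model's own numbers. Those numbers may be nonstandard and obey only the induction of
  the theory; the closure rules for \<open>dfn\<close>, \<open>dpr\<close> and \<open>dra\<close>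
  therefore certify each functional that is introduced and each predicate used in an induction.

  \<open>HAC_int\<close> yields a list instead of a choice and says nothing at nonstandard
  arguments, which shapes the way to (exists^2). The functional only tests whether some listed
  candidate lies near r: a bump has its maximum at r alone, whereas every point is a maximum of the
  zero function, so r has to miss the candidates listed there. From standard h the test is carried
  over to the indicators of all numbers by a least-failure argument, and an arbitrary sequence is
  replaced by the indicator of its first zero. In the converse direction only rational points are
  compared, so that every quantifier that the bisection must decide ranges over numbers.\<close>

instance ty :: countable by countable_datatype
instance con :: countable by countable_datatype
instance tm :: countable by countable_datatype
instance fm :: countable by countable_datatype

section \<open>Substitution\<close>

primrec avars :: "fm \<Rightarrow> var set" where
  "avars (Eq s t) = tvars s \<union> tvars t"
| "avars (St t) = tvars t"
| "avars Fls = {}"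
| "avars (Imp \<phi> \<psi>) = avars \<phi> \<union> avars \<psi>"
| "avars (All x \<phi>) = insert x (avars \<phi>)"

lemma finite_tvars [simp]: "finite (tvars t)"
  by (induction t) auto

lemma finite_avars [simp]: "finite (avars \<phi>)"
  by (induction \<phi>) auto

lemma fv_subset_avars: "fv \<phi> \<subseteq> avars \<phi>"
  by (induction \<phi>) auto

lemma finite_fv [simp]: "finite (fv \<phi>)"
  by (rule finite_subset[OF fv_subset_avars]) simp

lemma tsubst_id [simp]: "tsubst x (Var x) t = t"
  by (induction t) auto

lemma subst_id [simp]: "subst x (Var x) \<phi> = \<phi>"
  by (induction \<phi>) auto

lemma free_for_id [simp]: "free_for (Var x) x \<phi>"
  by (induction \<phi>) auto

lemma tsubst_fresh: "x \<notin> tvars t \<Longrightarrow> tsubst x u t = t"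
  by (induction t) auto

lemma subst_fresh: "x \<notin> fv \<phi> \<Longrightarrow> subst x u \<phi> = \<phi>"
  by (induction \<phi>) (auto simp: tsubst_fresh)

lemma subst_unused: "x \<notin> avars \<phi> \<Longrightarrow> subst x u \<phi> = \<phi>"
  using subst_fresh fv_subset_avars by blast

lemma tsubst_back: "y \<notin> tvars t \<Longrightarrow> tsubst y (Var x) (tsubst x (Var y) t) = t"
  by (induction t) auto

lemma subst_back: "y \<notin> avars \<phi> \<Longrightarrow> subst y (Var x) (subst x (Var y) \<phi>) = \<phi>"
  by (induction \<phi>) (auto simp: tsubst_back subst_unused)

lemma tvars_tsubst: "tvars (tsubst x u t) \<subseteq> (tvars t - {x}) \<union> tvars u"
  by (induction t) auto

lemma fv_subst: "fv (subst x u \<phi>) \<subseteq> (fv \<phi> - {x}) \<union> tvars u"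
  using tvars_tsubst by (induction \<phi>) (simp_all, blast+)

lemma avars_subst_var: "avars (subst x (Var y) \<phi>) \<subseteq> insert y (avars \<phi>)"
proof -
  have "tvars (tsubst x (Var y) t) \<subseteq> insert y (tvars t)" for t
    by (induction t) auto
  then show ?thesis by (induction \<phi>) (simp_all, blast+)
qed

lemma free_for_fresh: "y \<notin> avars \<phi> \<Longrightarrow> free_for (Var y) x \<phi>"
  by (induction \<phi>) auto

lemma free_for_back: "y \<notin> avars \<phi> \<Longrightarrow> free_for (Var x) y (subst x (Var y) \<phi>)"
  using fv_subset_avars by (induction \<phi>) auto

lemma ty_of_tsubst: "ty_of u = snd x \<Longrightarrow> ty_of (tsubst x u t) = ty_of t"
  by (induction t) auto

lemma wft_tsubst: "wft C t \<Longrightarrow> wft C u \<Longrightarrow> ty_of u = snd x \<Longrightarrow> wft C (tsubst x u t)"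
  by (induction t) (auto simp: ty_of_tsubst)

lemma wff_subst: "wff C \<phi> \<Longrightarrow> wft C u \<Longrightarrow> ty_of u = snd x \<Longrightarrow> wff C (subst x u \<phi>)"
  by (induction \<phi>) (auto simp: ty_of_tsubst wft_tsubst)

lemma size_subst_var: "size (subst x (Var y) \<phi>) = size \<phi>"
  by (induction \<phi>) auto

primrec tsub :: "(var \<Rightarrow> tm) \<Rightarrow> tm \<Rightarrow> tm" where
  "tsub e (Var y) = e y"
| "tsub e (Con c) = Con c"
| "tsub e (s \<cdot> t) = tsub e s \<cdot> tsub e t"

text \<open>
  Simultaneous substitution that renames the bound variables to even names from \<open>2 * d\<close> onwards.
  Terms all of whose variables have odd names are therefore free for every variable of the result.
\<close>

primrec ssub :: "fm \<Rightarrow> (var \<Rightarrow> tm) \<Rightarrow> nat \<Rightarrow> fm" where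
  "ssub (Eq s t) e d = Eq (tsub e s) (tsub e t)"
| "ssub (St t) e d = St (tsub e t)"
| "ssub Fls e d = Fls"
| "ssub (Imp \<phi> \<psi>) e d = Imp (ssub \<phi> e d) (ssub \<psi> e d)"
| "ssub (All x \<phi>) e d = All (2 * d, snd x) (ssub \<phi> (e(x := Var (2 * d, snd x))) (Suc d))"

lemma tsub_cong: "(\<And>x. x \<in> tvars t \<Longrightarrow> e x = e' x) \<Longrightarrow> tsub e t = tsub e' t"
  by (induction t) auto

lemma ssub_cong: "(\<And>x. x \<in> fv \<phi> \<Longrightarrow> e x = e' x) \<Longrightarrow> ssub \<phi> e d = ssub \<phi> e' d"
proof (induction \<phi> arbitrary: e e' d)
  case (All x \<phi>)
  show ?case by (simp, rule All.IH) (use All.prems in auto)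
next
  case (Imp \<phi> \<psi>)
  have "ssub \<phi> e d = ssub \<phi> e' d" by (rule Imp.IH(1)) (use Imp.prems in auto)
  moreover have "ssub \<psi> e d = ssub \<psi> e' d" by (rule Imp.IH(2)) (use Imp.prems in auto)
  ultimately show ?case by simp
qed (auto intro!: tsub_cong)

lemma tsub_Var [simp]: "tsub Var t = t"
  by (induction t) auto

lemma tsubst_tsub: "tsubst z t (tsub e s) = tsub (\<lambda>x. tsubst z t (e x)) s"
  by (induction s) auto

text \<open>No binder of \<open>ssub \<phi> e d\<close> carries the name \<open>2 * k\<close> when
  \<open>k < d\<close>, so the substitution reaches every leaf and can be absorbed into the
  assignment.\<close>

lemma subst_ssub:
  "k < d \<Longrightarrow> subst (2 * k, \<sigma>) t (ssub \<phi> e d) = ssub \<phi> (\<lambda>x. tsubst (2 * k, \<sigma>) t (e x)) d"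
proof (induction \<phi> arbitrary: e d)
  case (All x \<phi>)
  have *: "(\<lambda>a. tsubst (2 * k, \<sigma>) t ((e(x := Var (2 * d, snd x))) a))
      = (\<lambda>a. tsubst (2 * k, \<sigma>) t (e a))(x := Var (2 * d, snd x))"
    using All.prems by (auto simp: fun_eq_iff)
  show ?case using All.IH[of "Suc d"] All.prems by (simp add: * del: fun_upd_apply)
qed (auto simp: tsubst_tsub)

lemma tsub_tsubst: "tsub e (tsubst x t s) = tsub (e(x := tsub e t)) s"
  by (induction s) auto

text \<open>By \<open>free_for\<close>, a binder above a replaced occurrence binds no variable of
  \<open>t\<close>, so updating the assignment at that binder leaves \<open>tsub e t\<close>
  unchanged.\<close>

lemma ssub_subst: "free_for t x \<phi> \<Longrightarrow> ssub (subst x t \<phi>) e d = ssub \<phi> (e(x := tsub e t)) d"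
proof (induction \<phi> arbitrary: e d)
  case (All y \<phi>)
  show ?case
  proof (cases "x \<in> fv (All y \<phi>)")
    case False
    then have "ssub (All y \<phi>) (e(x := tsub e t)) d = ssub (All y \<phi>) e d"
      by (intro ssub_cong) auto
    then show ?thesis by (simp only: subst_fresh[OF False])
  next
    case True
    with All.prems have "y \<noteq> x" "y \<notin> tvars t" "free_for t x \<phi>" by auto
    moreover from \<open>y \<notin> tvars t\<close> have "tsub (e(y := u)) t = tsub e t" for u
      by (intro tsub_cong) auto
    ultimately show ?thesis using All.IH by (simp add: fun_upd_twist del: fun_upd_apply)
  qed
qed (auto simp: tsub_tsubst)

lemma free_for_ssub: "\<forall>v\<in>tvars t. odd (fst v) \<Longrightarrow> free_for t z (ssub \<phi> e d)"
  by (induction \<phi> arbitrary: e d) auto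

definition tenv :: "var set \<Rightarrow> (var \<Rightarrow> tm) \<Rightarrow> bool" where
  "tenv C e \<longleftrightarrow> (\<forall>x. wft C (e x) \<and> ty_of (e x) = snd x)"

lemma tenv_upd: "tenv C e \<Longrightarrow> wft C u \<Longrightarrow> ty_of u = snd x \<Longrightarrow> tenv C (e(x := u))"
  by (auto simp: tenv_def)

lemma ty_of_tsub: "tenv C e \<Longrightarrow> ty_of (tsub e t) = ty_of t"
  by (induction t) (auto simp: tenv_def)

lemma wft_tsub: "tenv C e \<Longrightarrow> wft C t \<Longrightarrow> wft C (tsub e t)"
  by (induction t) (auto simp: ty_of_tsub, auto simp: tenv_def)

lemma wff_ssub: "tenv C e \<Longrightarrow> wff C \<phi> \<Longrightarrow> wff C (ssub \<phi> e d)"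
  by (induction \<phi> arbitrary: e d) (auto simp: wft_tsub ty_of_tsub tenv_upd)


section \<open>Completeness\<close>

locale calculus =
  fixes C :: "var set" and T :: "fm set"
begin

abbreviation prv :: "fm \<Rightarrow> bool" where "prv \<equiv> deriv C T {}"

lemma prv_K: "wff C \<phi> \<Longrightarrow> wff C \<psi> \<Longrightarrow> prv (Imp \<phi> (Imp \<psi> \<phi>))"
  by (intro ImpI) (auto intro: Hyp)

lemma prv_S:
  assumes "wff C \<phi>" "wff C \<psi>" "wff C \<chi>"
  shows "prv (Imp (Imp \<phi> (Imp \<psi> \<chi>)) (Imp (Imp \<phi> \<psi>) (Imp \<phi> \<chi>)))"
proof (intro ImpI)
  let ?\<Gamma> = "{\<phi>, Imp \<phi> \<psi>, Imp \<phi> (Imp \<psi> \<chi>)}"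
  have 1: "deriv C T ?\<Gamma> \<phi>" and 2: "deriv C T ?\<Gamma> (Imp \<phi> \<psi>)"
    and 3: "deriv C T ?\<Gamma> (Imp \<phi> (Imp \<psi> \<chi>))"
    using assms by (auto intro!: Hyp)
  show "deriv C T ?\<Gamma> \<chi>" by (rule ImpE[OF ImpE[OF 3 1] ImpE[OF 2 1]])
qed (use assms in auto)

lemma prv_DN: assumes "wff C \<phi>" shows "prv (Imp (Neg (Neg \<phi>)) \<phi>)"
proof (rule ImpI[OF _ RAA])
  show "deriv C T {Neg \<phi>, Neg (Neg \<phi>)} Fls"
    by (rule ImpE[of _ _ _ "Neg \<phi>"]; rule Hyp) (use assms in auto)
qed (use assms in auto)

lemma prv_exfalso: assumes "wff C \<phi>" "wff C \<psi>" shows "prv (Imp (Neg \<phi>) (Imp \<phi> \<psi>))"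
proof (rule ImpI[OF _ ImpI[OF _ RAA]])
  show "deriv C T {Neg \<psi>, \<phi>, Neg \<phi>} Fls"
    by (rule ImpE[of _ _ _ \<phi>]; rule Hyp) (use assms in auto)
qed (use assms in auto)

lemma prv_MP: "prv (Imp \<phi> \<psi>) \<Longrightarrow> prv \<phi> \<Longrightarrow> prv \<psi>"
  by (rule ImpE)

lemma prv_Gen: "prv \<phi> \<Longrightarrow> prv (All x \<phi>)"
  by (rule AllI) auto

lemma prv_inst:
  assumes "wff C \<phi>" "wft C u" "ty_of u = snd x" "free_for u x \<phi>"
  shows "prv (Imp (All x \<phi>) (subst x u \<phi>))"
  by (intro ImpI AllE) (use assms in \<open>auto intro!: Hyp\<close>)

lemma prv_All_Imp:
  assumes "wff C \<phi>" "wff C \<psi>" "x \<notin> fv \<phi>"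
  shows "prv (Imp (All x (Imp \<phi> \<psi>)) (Imp \<phi> (All x \<psi>)))"
proof (intro ImpI AllI)
  let ?\<Gamma> = "{\<phi>, All x (Imp \<phi> \<psi>)}"
  have "deriv C T ?\<Gamma> (subst x (Var x) (Imp \<phi> \<psi>))"
    by (rule AllE) (use assms in \<open>auto intro!: Hyp\<close>)
  then have "deriv C T ?\<Gamma> (Imp \<phi> \<psi>)" by simp
  moreover have "deriv C T ?\<Gamma> \<phi>" using assms by (auto intro!: Hyp)
  ultimately show "deriv C T ?\<Gamma> \<psi>" by (rule ImpE)
qed (use assms in auto)

text \<open>As \<open>y\<close> occurs nowhere in \<open>\<phi>\<close>, instantiating
  \<open>y\<close> by \<open>x\<close> restores \<open>\<phi>\<close> literally.\<close>

lemma prv_rename: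
  assumes "wff C \<phi>" "y \<notin> avars \<phi>" "snd y = snd x" "x \<noteq> y"
  shows "prv (Imp (All y (subst x (Var y) \<phi>)) (All x \<phi>))"
proof (intro ImpI AllI)
  let ?\<psi> = "subst x (Var y) \<phi>"
  have "wff C ?\<psi>" using assms by (simp add: wff_subst)
  then have "deriv C T {All y ?\<psi>} (subst y (Var x) ?\<psi>)"
    by (intro AllE) (use assms free_for_back in \<open>auto intro!: Hyp\<close>)
  then show "deriv C T {All y ?\<psi>} \<phi>" using assms by (simp add: subst_back)
  show "wff C (All y ?\<psi>)" using \<open>wff C ?\<psi>\<close> by simp
  show "\<forall>\<gamma>\<in>{All y ?\<psi>}. x \<notin> fv \<gamma>" using fv_subst[of x "Var y" \<phi>] assms by auto
qed

text \<open>Hypotheses are coded as an iterated implication over the empty context. The deduction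
  theorem then holds by definition, and weakening and generalisation follow from a few implication
  laws, without an induction over \<open>deriv\<close> and its eigenvariable condition.\<close>

primrec ded :: "fm list \<Rightarrow> fm \<Rightarrow> bool" where
  "ded [] \<phi> = prv \<phi>"
| "ded (\<psi> # L) \<phi> = ded L (Imp \<psi> \<phi>)"

abbreviation "wfl L \<equiv> \<forall>\<phi>\<in>set L. wff C \<phi>"

lemma ded_prv: "wfl L \<Longrightarrow> wff C \<phi> \<Longrightarrow> prv \<phi> \<Longrightarrow> ded L \<phi>"
proof (induction L arbitrary: \<phi>)
  case (Cons \<psi> L)
  then have "prv (Imp \<psi> \<phi>)" using prv_K[of \<phi> \<psi>] prv_MP by auto
  then show ?case using Cons by simp
qed simp

lemma ded_MP:
  "wfl L \<Longrightarrow> wff C \<phi> \<Longrightarrow> wff C \<chi> \<Longrightarrow> ded L (Imp \<phi> \<chi>) \<Longrightarrow> ded L \<phi> \<Longrightarrow> ded L \<chi>"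
proof (induction L arbitrary: \<phi> \<chi>)
  case Nil
  then show ?case using prv_MP by auto
next
  case (Cons \<psi> L)
  let ?a = "Imp \<psi> (Imp \<phi> \<chi>)" and ?b = "Imp \<psi> \<phi>" and ?c = "Imp \<psi> \<chi>"
  have "ded L (Imp ?a (Imp ?b ?c))" using Cons.prems by (intro ded_prv prv_S) auto
  then have "ded L (Imp ?b ?c)" using Cons.IH[of ?a "Imp ?b ?c"] Cons.prems by simp
  then have "ded L ?c" using Cons.IH[of ?b ?c] Cons.prems by simp
  then show ?case by simp
qed

lemma ded_step:
  "wfl L \<Longrightarrow> wff C \<phi> \<Longrightarrow> wff C \<chi> \<Longrightarrow> prv (Imp \<phi> \<chi>) \<Longrightarrow> ded L \<phi> \<Longrightarrow> ded L \<chi>"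
  using ded_MP[of L \<phi> \<chi>] ded_prv[of L "Imp \<phi> \<chi>"] by simp

lemma ded_weaken: "wfl L \<Longrightarrow> wff C \<psi> \<Longrightarrow> wff C \<phi> \<Longrightarrow> ded L \<phi> \<Longrightarrow> ded (\<psi> # L) \<phi>"
  using ded_MP[of L \<phi> "Imp \<psi> \<phi>"] ded_prv[of L "Imp \<phi> (Imp \<psi> \<phi>)"] prv_K by simp

lemma ded_hyp: "wfl L \<Longrightarrow> \<psi> \<in> set L \<Longrightarrow> ded L \<psi>"
proof (induction L)
  case (Cons \<phi> L)
  show ?case
  proof (cases "\<psi> = \<phi>")
    case True
    have "prv (Imp \<phi> \<phi>)" using Cons.prems by (intro ImpI) (auto intro: Hyp)
    then show ?thesis using True Cons.prems ded_prv[of L "Imp \<phi> \<phi>"] by simp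
  next
    case False
    then show ?thesis using Cons ded_weaken[of L \<phi> \<psi>] by auto
  qed
qed simp

lemma ded_Gen:
  "wfl L \<Longrightarrow> wff C \<phi> \<Longrightarrow> \<forall>\<psi>\<in>set L. x \<notin> fv \<psi> \<Longrightarrow> ded L \<phi> \<Longrightarrow> ded L (All x \<phi>)"
proof (induction L arbitrary: \<phi>)
  case Nil
  then show ?case using prv_Gen by simp
next
  case (Cons \<psi> L)
  then have "ded L (All x (Imp \<psi> \<phi>))" using Cons.IH[of "Imp \<psi> \<phi>"] by simp
  moreover have "ded L (Imp (All x (Imp \<psi> \<phi>)) (Imp \<psi> (All x \<phi>)))"
    using Cons.prems by (intro ded_prv prv_All_Imp) auto
  ultimately have "ded L (Imp \<psi> (All x \<phi>))"
    using ded_MP[of L "All x (Imp \<psi> \<phi>)" "Imp \<psi> (All x \<phi>)"] Cons.prems by simp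
  then show ?case by simp
qed

text \<open>The truth lemma speaks only of renamed formulas; this links a formula to its renamed
  form inside the calculus. The induction is on size, because the hypothesis is applied to
  \<open>subst x (Var ?z) \<psi>\<close>, which is not a subformula.\<close>

lemma prv_ssub_iff:
  assumes "wff C \<phi>" "\<forall>v\<in>avars \<phi>. fst v < 2 * d"
  shows "prv (Imp \<phi> (ssub \<phi> Var d)) \<and> prv (Imp (ssub \<phi> Var d) \<phi>)"
  using assms
proof (induction "size \<phi>" arbitrary: \<phi> d rule: less_induct)
  case less
  have id: "prv (Imp \<psi> \<psi>)" if "wff C \<psi>" for \<psi> using that by (intro ImpI) (auto intro: Hyp)
  have tenv: "tenv C Var" by (simp add: tenv_def)
  show ?case
  proof (cases \<phi>)
    case (Imp \<psi> \<chi>)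
    let ?\<psi> = "ssub \<psi> Var d" and ?\<chi> = "ssub \<chi> Var d"
    have w: "wff C \<psi>" "wff C \<chi>" "wff C ?\<psi>" "wff C ?\<chi>"
      using less.prems Imp tenv wff_ssub by auto
    have IH: "prv (Imp \<psi> ?\<psi>)" "prv (Imp ?\<psi> \<psi>)" "prv (Imp \<chi> ?\<chi>)" "prv (Imp ?\<chi> \<chi>)"
      using less.hyps[of \<psi> d] less.hyps[of \<chi> d] less.prems Imp by auto
    have mono: "prv (Imp (Imp \<alpha> \<beta>) (Imp \<alpha>' \<beta>'))"
      if w: "wff C \<alpha>" "wff C \<beta>" "wff C \<alpha>'" "wff C \<beta>'"
        and p: "prv (Imp \<alpha>' \<alpha>)" "prv (Imp \<beta> \<beta>')" for \<alpha> \<beta> \<alpha>' \<beta>'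
    proof -
      let ?L = "[\<alpha>', Imp \<alpha> \<beta>]"
      have wl: "wfl ?L" using w by simp
      have "ded ?L \<alpha>"
        using ded_MP[OF wl, of \<alpha>' \<alpha>] ded_prv[OF wl _ p(1)] ded_hyp[OF wl, of \<alpha>'] w by simp
      then have "ded ?L \<beta>"
        using ded_MP[OF wl, of \<alpha> \<beta>] ded_hyp[OF wl, of "Imp \<alpha> \<beta>"] w by simp
      then have "ded ?L \<beta>'"
        using ded_MP[OF wl, of \<beta> \<beta>'] ded_prv[OF wl _ p(2)] w by simp
      then show ?thesis by simp
    qed
    show ?thesis unfolding Imp using mono w IH by simp
  next
    case (All x \<psi>)
    let ?z = "(2 * d, snd x)"
    let ?\<psi> = "subst x (Var ?z) \<psi>"
    have z: "?z \<notin> avars \<psi>" "x \<noteq> ?z"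
      using less.prems All by (fastforce, metis avars.simps(5) fst_conv insertI1 less_irrefl)
    then have z3: "?z \<notin> fv (All x \<psi>)" using fv_subset_avars by auto
    have w: "wff C \<psi>" "wff C ?\<psi>" using less.prems All by (auto simp: wff_subst)
    have "size ?\<psi> < size \<phi>" using All by (simp add: size_subst_var)
    moreover have "\<forall>v\<in>avars ?\<psi>. fst v < 2 * Suc d"
      using avars_subst_var[of x ?z \<psi>] less.prems All by fastforce
    ultimately have IH: "prv (Imp ?\<psi> (ssub ?\<psi> Var (Suc d)))" "prv (Imp (ssub ?\<psi> Var (Suc d)) ?\<psi>)"
      using less.hyps w by blast+
    have s: "ssub \<phi> Var d = All ?z (ssub ?\<psi> Var (Suc d))"
      using All ssub_subst[OF free_for_fresh[OF z(1)]] by simp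
    have ws: "wff C (ssub ?\<psi> Var (Suc d))" using w tenv wff_ssub by auto
    have "ded [\<phi>] ?\<psi>"
      using prv_inst[of \<psi> "Var ?z" x] w All free_for_fresh[OF z(1)] by simp
    then have "ded [\<phi>] (ssub ?\<psi> Var (Suc d))"
      using ded_step[OF _ _ _ IH(1), of "[\<phi>]"] ws w less.prems by simp
    then have 1: "ded [\<phi>] (ssub \<phi> Var d)"
      unfolding s by (intro ded_Gen) (use ws less.prems z3 All in auto)
    let ?\<chi> = "ssub \<phi> Var d"
    have "ded [?\<chi>] (ssub ?\<psi> Var (Suc d))"
      using prv_inst[of "ssub ?\<psi> Var (Suc d)" "Var ?z" ?z] ws unfolding s by simp
    then have "ded [?\<chi>] ?\<psi>"
      using ded_step[OF _ _ _ IH(2), of "[?\<chi>]"] ws w s by simp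
    then have "ded [?\<chi>] (All ?z ?\<psi>)"
      by (intro ded_Gen) (use ws w s in auto)
    then have "ded [?\<chi>] \<phi>"
      using ded_step[OF _ _ _ prv_rename[of \<psi> ?z x], of "[?\<chi>]"] ws w s z All by simp
    then show ?thesis using 1 by simp
  qed (use less.prems id in auto)
qed

section \<open>Consistency and witnessing variables\<close>

definition consis :: "fm list \<Rightarrow> bool" where "consis L \<longleftrightarrow> \<not> ded L Fls"

text \<open>Variables serve as Henkin constants. Their odd names keep them apart from the even names
  that \<open>ssub\<close> gives to bound variables.\<close>

definition fresh_var :: "var set \<Rightarrow> ty \<Rightarrow> var" where
  "fresh_var S \<sigma> = (SOME y. odd (fst y) \<and> snd y = \<sigma> \<and> y \<notin> S)"

lemma fresh_var:
  assumes "finite S"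
  shows "odd (fst (fresh_var S \<sigma>)) \<and> snd (fresh_var S \<sigma>) = \<sigma> \<and> fresh_var S \<sigma> \<notin> S"
proof -
  obtain n where "\<forall>y\<in>S. fst y \<le> n" using assms finite_nat_set_iff_bounded_le[of "fst ` S"] by auto
  then have "odd (fst (2 * n + 1, \<sigma>)) \<and> snd (2 * n + 1, \<sigma>) = \<sigma> \<and> (2 * n + 1, \<sigma>) \<notin> S" by fastforce
  then show ?thesis unfolding fresh_var_def by (rule someI)
qed

fun witness :: "fm \<Rightarrow> fm list \<Rightarrow> fm list" where
  "witness (Imp (All x \<phi>) Fls) L =
     [Neg (subst x (Var (fresh_var (insert x (avars \<phi> \<union> \<Union>(avars ` set L))) (snd x))) \<phi>)]"
| "witness _ L = []"

lemma ded_DN: "wfl L \<Longrightarrow> wff C \<phi> \<Longrightarrow> ded L (Neg (Neg \<phi>)) \<Longrightarrow> ded L \<phi>"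
  using ded_MP[of L "Neg (Neg \<phi>)" \<phi>] ded_prv[of L "Imp (Neg (Neg \<phi>)) \<phi>"] prv_DN by simp

text \<open>If the witness caused an inconsistency, the negated universal would derive the instance
  at the fresh variable, hence by generalisation and renaming the universal itself.\<close>

lemma witness_consis:
  assumes "wfl L" "wff C \<phi>" "consis (\<phi> # L)"
  shows "consis (witness \<phi> L @ \<phi> # L) \<and> wfl (witness \<phi> L @ \<phi> # L)"
  using assms
proof (induction \<phi> L rule: witness.induct)
  case (1 x \<phi> L)
  let ?S = "insert x (avars \<phi> \<union> \<Union>(avars ` set L))"
  define y where "y = fresh_var ?S (snd x)"
  let ?\<psi> = "subst x (Var y) \<phi>" and ?M = "Neg (All x \<phi>) # L"
  have y: "snd y = snd x" "y \<notin> ?S" using fresh_var[of ?S "snd x"] by (auto simp: y_def)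
  have w: "wff C ?\<psi>" "wfl ?M" using 1 y by (auto simp: wff_subst)
  have yM: "\<forall>\<gamma>\<in>set ?M. y \<notin> fv \<gamma>" using y fv_subset_avars by fastforce
  have "\<not> ded (Neg ?\<psi> # ?M) Fls"
  proof
    assume "ded (Neg ?\<psi> # ?M) Fls"
    then have "ded ?M ?\<psi>" using ded_DN[OF w(2) w(1)] by simp
    then have "ded ?M (All y ?\<psi>)" using ded_Gen[OF w(2) w(1) yM] by simp
    moreover have "prv (Imp (All y ?\<psi>) (All x \<phi>))" using prv_rename[of \<phi> y x] 1 y by auto
    ultimately have "ded ?M (All x \<phi>)"
      using ded_MP[OF w(2), of "All y ?\<psi>" "All x \<phi>"] ded_prv[OF w(2)] w 1 by simp
    then have "ded ?M Fls"
      using ded_MP[OF w(2), of "All x \<phi>" Fls] ded_hyp[OF w(2), of "Neg (All x \<phi>)"] w 1 by simp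
    then show False using 1 by (simp add: consis_def)
  qed
  then show ?case using w by (simp add: consis_def flip: y_def)
qed auto

end

section \<open>A maximal consistent set containing the negated goal\<close>

locale refutation = calculus +
  fixes \<chi> :: fm
  assumes wff_goal: "wff C \<chi>" and closed_goal: "fv \<chi> = {}" and unprovable: "\<not> prv \<chi>"
begin

text \<open>Stage \<open>n\<close> treats the formula with code \<open>n\<close>. A witness is added
  in the same stage as its negated universal, so freshness is only ever required with respect to a
  finite list.\<close>

primrec chain :: "nat \<Rightarrow> fm list" where
  "chain 0 = [Neg \<chi>]"
| "chain (Suc n) = (let \<phi> = from_nat n in
     if wff C \<phi> \<and> consis (\<phi> # chain n) then witness \<phi> (chain n) @ \<phi> # chain n else chain n)"

lemma chain_ok: "consis (chain n) \<and> wfl (chain n)"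
proof (induction n)
  case 0
  have "\<not> ded [Neg \<chi>] Fls"
    using unprovable prv_MP[OF prv_DN[OF wff_goal]] by auto
  then show ?case using wff_goal by (simp add: consis_def)
next
  case (Suc n)
  then show ?case using witness_consis[of "chain n" "from_nat n"] by (simp add: Let_def)
qed

lemma chain_wf: "wfl (chain n)" using chain_ok by blast

lemma ded_append: "wfl (L' @ L) \<Longrightarrow> wff C \<phi> \<Longrightarrow> ded L \<phi> \<Longrightarrow> ded (L' @ L) \<phi>"
proof (induction L')
  case (Cons \<psi> L')
  then show ?case using ded_weaken[of "L' @ L" \<psi> \<phi>] by simp
qed simp

lemma chain_mono: "n \<le> m \<Longrightarrow> wff C \<phi> \<Longrightarrow> ded (chain n) \<phi> \<Longrightarrow> ded (chain m) \<phi>"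
proof (induction m)
  case (Suc m)
  show ?case
  proof (cases "n = Suc m")
    case False
    then have "ded (chain m) \<phi>" using Suc by auto
    moreover have "\<exists>L'. chain (Suc m) = L' @ chain m"
      by (auto simp: Let_def intro: exI[of _ "[]"] exI[of _ "witness _ _ @ [_]"])
    ultimately show ?thesis using ded_append Suc.prems chain_wf[of "Suc m"] by metis
  qed (use Suc in simp)
qed simp

definition H :: "fm set" where "H = {\<phi>. wff C \<phi> \<and> (\<exists>n. ded (chain n) \<phi>)}"

lemma H_prv: "wff C \<phi> \<Longrightarrow> prv \<phi> \<Longrightarrow> \<phi> \<in> H"
  using ded_prv chain_wf by (auto simp: H_def)

lemma H_MP:
  assumes "Imp \<phi> \<psi> \<in> H" "\<phi> \<in> H" shows "\<psi> \<in> H"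
proof -
  obtain n m where "ded (chain n) (Imp \<phi> \<psi>)" "ded (chain m) \<phi>" "wff C \<phi>" "wff C \<psi>"
    using assms by (auto simp: H_def)
  then have "ded (chain (max n m)) (Imp \<phi> \<psi>)" "ded (chain (max n m)) \<phi>"
    using chain_mono[of n "max n m" "Imp \<phi> \<psi>"] chain_mono[of m "max n m" \<phi>] by auto
  then have "ded (chain (max n m)) \<psi>" using ded_MP chain_wf \<open>wff C \<phi>\<close> \<open>wff C \<psi>\<close> by blast
  then show ?thesis using \<open>wff C \<psi>\<close> by (auto simp: H_def)
qed

lemma H_Fls: "Fls \<notin> H"
  using chain_ok by (auto simp: H_def consis_def)

text \<open>A formula is treated at the stage given by its own code: it is either refuted by the
  list at that stage or added together with its witness.\<close>

lemma chain_complete: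
  assumes "wff C \<phi>"
  shows "Neg \<phi> \<in> H \<or> set (witness \<phi> (chain (to_nat \<phi>)) @ [\<phi>]) \<subseteq> H"
proof (cases "consis (\<phi> # chain (to_nat \<phi>))")
  case True
  then have c: "chain (Suc (to_nat \<phi>)) = witness \<phi> (chain (to_nat \<phi>)) @ \<phi> # chain (to_nat \<phi>)"
    using assms by simp
  then have "\<psi> \<in> H" if "\<psi> \<in> set (witness \<phi> (chain (to_nat \<phi>)) @ [\<phi>])" for \<psi>
    using ded_hyp[OF chain_wf[of "Suc (to_nat \<phi>)"], of \<psi>] chain_wf[of "Suc (to_nat \<phi>)"] that
    unfolding c H_def by (auto intro!: exI[of _ "Suc (to_nat \<phi>)"] simp del: chain.simps simp: c)
  then show ?thesis by blast
next
  case False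
  then have "Neg \<phi> \<in> H" using assms by (auto simp: consis_def H_def)
  then show ?thesis ..
qed

lemma H_complete: "wff C \<phi> \<Longrightarrow> \<phi> \<in> H \<or> Neg \<phi> \<in> H"
  using chain_complete by fastforce

lemma H_Imp:
  assumes "wff C \<phi>" "wff C \<psi>"
  shows "Imp \<phi> \<psi> \<in> H \<longleftrightarrow> (\<phi> \<in> H \<longrightarrow> \<psi> \<in> H)"
proof
  assume imp: "\<phi> \<in> H \<longrightarrow> \<psi> \<in> H"
  show "Imp \<phi> \<psi> \<in> H"
  proof (cases "\<phi> \<in> H")
    case True
    then have "\<psi> \<in> H" using imp by simp
    then show ?thesis using H_MP H_prv[OF _ prv_K[of \<psi> \<phi>]] assms by auto
  next
    case False
    then have "Neg \<phi> \<in> H" using H_complete assms by auto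
    then show ?thesis using H_MP H_prv[OF _ prv_exfalso[of \<phi> \<psi>]] assms by auto
  qed
qed (use H_MP in blast)

text \<open>The restriction to odd names means that no term of the universe can be captured by a
  renamed binder.\<close>

definition tdom :: "ty \<Rightarrow> tm set" where
  "tdom \<sigma> = {t. wft C t \<and> ty_of t = \<sigma> \<and> (\<forall>v\<in>tvars t. odd (fst v))}"

text \<open>From right to left: the witnessing variable of the negated universal is itself a term of
  \<open>tdom\<close>, so one of the instances is refuted.\<close>

lemma H_All:
  assumes w: "wff C \<phi>" and ff: "\<And>t. t \<in> tdom (snd x) \<Longrightarrow> free_for t x \<phi>"
  shows "All x \<phi> \<in> H \<longleftrightarrow> (\<forall>t\<in>tdom (snd x). subst x t \<phi> \<in> H)"
proof
  assume "All x \<phi> \<in> H"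
  moreover have "Imp (All x \<phi>) (subst x t \<phi>) \<in> H" if "t \<in> tdom (snd x)" for t
    by (rule H_prv[OF _ prv_inst]) (use that w ff in \<open>auto simp: tdom_def wff_subst\<close>)
  ultimately show "\<forall>t\<in>tdom (snd x). subst x t \<phi> \<in> H" using H_MP by blast
next
  assume all: "\<forall>t\<in>tdom (snd x). subst x t \<phi> \<in> H"
  show "All x \<phi> \<in> H"
  proof (rule ccontr)
    assume "All x \<phi> \<notin> H"
    then have neg: "Neg (All x \<phi>) \<in> H" using H_complete[of "All x \<phi>"] w by simp
    let ?n = "to_nat (Neg (All x \<phi>))"
    let ?S = "insert x (avars \<phi> \<union> \<Union>(avars ` set (chain ?n)))"
    let ?y = "fresh_var ?S (snd x)"
    have "Neg (Neg (All x \<phi>)) \<notin> H" using neg H_MP H_Fls by blast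
    then have "Neg (subst x (Var ?y) \<phi>) \<in> H" using chain_complete[of "Neg (All x \<phi>)"] w by simp
    moreover have "Var ?y \<in> tdom (snd x)" using fresh_var[of ?S "snd x"] by (simp add: tdom_def)
    ultimately show False using all H_MP H_Fls by blast
  qed
qed

end

section \<open>Structures\<close>

record 'u strc =
  sdom :: "ty \<Rightarrow> 'u set"
  sap :: "'u \<Rightarrow> 'u \<Rightarrow> 'u"
  scon :: "con \<Rightarrow> 'u"
  seq :: "'u \<Rightarrow> 'u \<Rightarrow> bool"
  sst :: "'u \<Rightarrow> bool"

primrec val :: "'u strc \<Rightarrow> (var \<Rightarrow> 'u) \<Rightarrow> tm \<Rightarrow> 'u" where
  "val M e (Var x) = e x"
| "val M e (Con c) = scon M c"
| "val M e (s \<cdot> t) = sap M (val M e s) (val M e t)"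

primrec sat :: "'u strc \<Rightarrow> fm \<Rightarrow> (var \<Rightarrow> 'u) \<Rightarrow> bool" where
  "sat M (Eq s t) e = seq M (val M e s) (val M e t)"
| "sat M (St t) e = sst M (val M e t)"
| "sat M Fls e = False"
| "sat M (Imp \<phi> \<psi>) e = (sat M \<phi> e \<longrightarrow> sat M \<psi> e)"
| "sat M (All x \<phi>) e = (\<forall>u\<in>sdom M (snd x). sat M \<phi> (e(x := u)))"

definition typed_env :: "'u strc \<Rightarrow> (var \<Rightarrow> 'u) \<Rightarrow> bool" where
  "typed_env M e \<longleftrightarrow> (\<forall>x. e x \<in> sdom M (snd x))"

definition typed_strc :: "var set \<Rightarrow> 'u strc \<Rightarrow> bool" where
  "typed_strc C M \<longleftrightarrow> (\<forall>\<sigma>. sdom M \<sigma> \<noteq> {}) \<and> (\<forall>c. con_ok C c \<longrightarrow> scon M c \<in> sdom M (con_ty c)) \<and>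
     (\<forall>\<sigma> \<tau>. \<forall>f\<in>sdom M (\<sigma> \<Rrightarrow> \<tau>). \<forall>x\<in>sdom M \<sigma>. sap M f x \<in> sdom M \<tau>)"

lemma typed_env_upd: "typed_env M e \<Longrightarrow> u \<in> sdom M (snd x) \<Longrightarrow> typed_env M (e(x := u))"
  by (auto simp: typed_env_def)

lemma typed_envD: "typed_env M e \<Longrightarrow> e x \<in> sdom M (snd x)"
  by (simp only: typed_env_def)

lemma val_cong: "(\<And>x. x \<in> tvars t \<Longrightarrow> e x = e' x) \<Longrightarrow> val M e t = val M e' t"
  by (induction t) auto

lemma sat_cong: "(\<And>x. x \<in> fv \<phi> \<Longrightarrow> e x = e' x) \<Longrightarrow> sat M \<phi> e = sat M \<phi> e'"
proof (induction \<phi> arbitrary: e e')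
  case (Eq s t)
  then show ?case using val_cong[of s e e'] val_cong[of t e e'] by simp
next
  case (St t)
  then show ?case using val_cong[of t e e'] by simp
next
  case (Imp \<phi> \<psi>)
  have "sat M \<phi> e = sat M \<phi> e'" by (rule Imp.IH(1)) (use Imp.prems in auto)
  moreover have "sat M \<psi> e = sat M \<psi> e'" by (rule Imp.IH(2)) (use Imp.prems in auto)
  ultimately show ?case by simp
next
  case (All x \<phi>)
  have "sat M \<phi> (e(x := u)) = sat M \<phi> (e'(x := u))" for u
    by (rule All.IH) (use All.prems in auto)
  then show ?case by simp
qed simp

lemma val_typed:
  "typed_strc C M \<Longrightarrow> typed_env M e \<Longrightarrow> wft C t \<Longrightarrow> val M e t \<in> sdom M (ty_of t)"
proof (induction t)
  case (App s t)
  then show ?case unfolding typed_strc_def by fastforce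
qed (auto simp: typed_env_def typed_strc_def)

lemma name_bound: "x \<in> tvars t \<Longrightarrow> fst x < name_bound t"
  by (induction t) auto

lemma newvar_bound: "t \<in> set ts \<Longrightarrow> name_bound t \<le> newvar ts"
  by (induction ts) (auto simp: newvar_def)

lemma val_fresh [simp]: "t \<in> set ts \<Longrightarrow> val M (e((newvar ts + i, \<sigma>) := u)) t = val M e t"
  using name_bound[of _ t] newvar_bound[of t ts] by (intro val_cong) fastforce

lemma val_fresh_0 [simp]: "t \<in> set ts \<Longrightarrow> val M (e((newvar ts, \<sigma>) := u)) t = val M e t"
  using val_fresh[of t ts M e 0] by simp

lemma val_fresh_Suc [simp]: "t \<in> set ts \<Longrightarrow> val M (e((Suc (newvar ts), \<sigma>) := u)) t = val M e t"
  using val_fresh[of t ts M e 1] by simp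

definition cval :: "'u strc \<Rightarrow> tm \<Rightarrow> 'u" where
  "cval M t = val M (\<lambda>_. undefined) t"

lemma val_closed: "tvars t = {} \<Longrightarrow> val M e t = cval M t"
  unfolding cval_def by (rule val_cong) simp

lemma tvars_lam [simp]: "tvars (lam x t) = tvars t - {x}"
  by (induction t) auto

lemma closed_arith [simp]: "tvars add_c = {}" "tvars mult_c = {}" "tvars pred_c = {}"
  "tvars monus_c = {}" "tvars pow2_c = {}" "tvars tri_c = {}"
  by (auto simp: add_c_def mult_c_def pred_c_def monus_c_def pow2_c_def tri_c_def add_def)

lemma ty_of_lam [simp]: "ty_of (lam x t) = snd x \<Rrightarrow> ty_of t"
  by (induction t) auto

lemma wft_lam: "wft C t \<Longrightarrow> wft C (lam x t)"
  by (induction t) auto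

lemma ty_arith [simp]: "ty_of add_c = N0 \<Rrightarrow> N0 \<Rrightarrow> N0" "ty_of mult_c = N0 \<Rrightarrow> N0 \<Rrightarrow> N0"
  "ty_of pred_c = T1" "ty_of monus_c = N0 \<Rrightarrow> N0 \<Rrightarrow> N0" "ty_of pow2_c = T1" "ty_of tri_c = T1"
  by (auto simp: add_c_def mult_c_def pred_c_def monus_c_def pow2_c_def tri_c_def add_def)

lemma wft_arith [simp]: "wft C add_c" "wft C mult_c" "wft C pred_c" "wft C monus_c"
  "wft C pow2_c" "wft C tri_c"
proof -
  show "wft C add_c" by (auto simp: add_c_def intro!: wft_lam)
  then show "wft C mult_c" "wft C tri_c" by (auto simp: mult_c_def tri_c_def add_def intro!: wft_lam)
  show "wft C pred_c" by (auto simp: pred_c_def intro!: wft_lam)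
  then show "wft C monus_c" by (auto simp: monus_c_def intro!: wft_lam)
  show "wft C pow2_c"
    using \<open>wft C add_c\<close> by (auto simp: pow2_c_def add_def intro!: wft_lam)
qed

text \<open>The order relation of a structure, as it is expressed by \<^const>\<open>less\<close>.\<close>

definition slt :: "'u strc \<Rightarrow> 'u \<Rightarrow> 'u \<Rightarrow> bool" where
  "slt M a b = seq M (sap M (sap M (cval M monus_c) (sap M (scon M SuccC) a)) b) (scon M ZeroC)"

lemma sat_less [simp]: "sat M (less s t) e = slt M (val M e s) (val M e t)"
  by (simp add: less_def slt_def monus_def val_closed)

primrec EQ :: "'u strc \<Rightarrow> ty \<Rightarrow> 'u \<Rightarrow> 'u \<Rightarrow> bool" where
  "EQ M N0 a b = seq M a b"
| "EQ M (\<sigma> \<Rrightarrow> \<tau>) f g = (\<forall>x\<in>sdom M \<sigma>. EQ M \<tau> (sap M f x) (sap M g x))"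
| "EQ M (Seq \<sigma>) s t =
     (seq M (sap M (scon M (LenC \<sigma>)) s) (sap M (scon M (LenC \<sigma>)) t) \<and>
      (\<forall>i\<in>sdom M N0. slt M i (sap M (scon M (LenC \<sigma>)) s) \<longrightarrow>
         EQ M \<sigma> (sap M (sap M (scon M (ProjC \<sigma>)) s) i) (sap M (sap M (scon M (ProjC \<sigma>)) t) i)))"

lemma sat_eqf [simp]: "sat M (eqf \<sigma> s t) e = EQ M \<sigma> (val M e s) (val M e t)"
  by (induction \<sigma> arbitrary: s t e) (simp_all add: Let_def BAll_def)

lemma sat_elem [simp]:
  "sat M (elem \<sigma> z s) e = (\<exists>i\<in>sdom M N0. slt M i (sap M (scon M (LenC \<sigma>)) (val M e s)) \<and>
     EQ M \<sigma> (val M e z) (sap M (sap M (scon M (ProjC \<sigma>)) (val M e s)) i))"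
  by (auto simp add: elem_def BEx_def BAll_def Let_def)

lemma wft_monus: "wft C s \<Longrightarrow> wft C t \<Longrightarrow> ty_of s = N0 \<Longrightarrow> ty_of t = N0
    \<Longrightarrow> wft C (monus s t) \<and> ty_of (monus s t) = N0"
  by (simp add: monus_def)

lemma wff_less [simp]:
  "wft C s \<Longrightarrow> wft C t \<Longrightarrow> ty_of s = N0 \<Longrightarrow> ty_of t = N0 \<Longrightarrow> wff C (less s t)"
  by (simp add: less_def wft_monus)

lemma wff_eqf [simp]:
  "wft C s \<Longrightarrow> wft C t \<Longrightarrow> ty_of s = \<sigma> \<Longrightarrow> ty_of t = \<sigma> \<Longrightarrow> wff C (eqf \<sigma> s t)"
  by (induction \<sigma> arbitrary: s t) (auto simp: Let_def BAll_def)

lemma wff_elem [simp]: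
  "wft C z \<Longrightarrow> wft C s \<Longrightarrow> ty_of z = \<sigma> \<Longrightarrow> ty_of s = Seq \<sigma> \<Longrightarrow> wff C (elem \<sigma> z s)"
  by (auto simp: elem_def BEx_def BAll_def Let_def)

text \<open>Only well-formed axioms are demanded, since the truth lemma speaks of well-formed
  formulas. Equality is genuine identity in every type, so that the carriers can become HOL
  types.\<close>

definition omega_model :: "specs \<Rightarrow> 'u strc \<Rightarrow> bool" where
  "omega_model D M \<longleftrightarrow> typed_strc (dom D) M \<and> seq M = (=) \<and>
     (\<forall>\<sigma>. \<forall>a\<in>sdom M \<sigma>. \<forall>b\<in>sdom M \<sigma>. EQ M \<sigma> a b \<longrightarrow> a = b) \<and>
     (\<forall>\<phi> e. \<phi> \<in> RCA0_Omega D \<longrightarrow> wff (dom D) \<phi> \<longrightarrow> typed_env M e \<longrightarrow> sat M \<phi> e)"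


section \<open>The term model\<close>

context refutation
begin

definition TM :: "tm strc" where
  "TM = \<lparr>sdom = tdom, sap = App, scon = Con, seq = (\<lambda>s t. Eq s t \<in> H), sst = (\<lambda>t. St t \<in> H)\<rparr>"

lemma TM_simps [simp]: "sdom TM = tdom" "sap TM = App" "scon TM = Con"
  "seq TM = (\<lambda>s t. Eq s t \<in> H)" "sst TM = (\<lambda>t. St t \<in> H)"
  by (simp_all add: TM_def)

lemma val_TM: "val TM e t = tsub e t"
  by (induction t) auto

lemma typed_env_TM: "typed_env TM e \<Longrightarrow> tenv C e"
  by (auto simp: typed_env_def tenv_def tdom_def)

lemma typed_TM: "typed_strc C TM"
proof -
  have "Var (1, \<sigma>) \<in> tdom \<sigma>" for \<sigma> by (simp add: tdom_def)
  then have "tdom \<sigma> \<noteq> {}" for \<sigma> by blast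
  then show ?thesis by (auto simp: typed_strc_def) (auto simp: tdom_def)
qed

text \<open>In the quantifier case the bound name is even while all values of the assignment have
  odd names. Substituting a term for the bound variable therefore changes the assignment at that one
  place and nowhere else.\<close>

lemma truth: "wff C \<phi> \<Longrightarrow> typed_env TM e \<Longrightarrow> ssub \<phi> e d \<in> H \<longleftrightarrow> sat TM \<phi> e"
proof (induction \<phi> arbitrary: e d)
  case (Imp \<phi> \<psi>)
  then have "wff C (ssub \<phi> e d)" "wff C (ssub \<psi> e d)" by (auto intro: wff_ssub typed_env_TM)
  then show ?case using Imp by (simp add: H_Imp)
next
  case (All x \<phi>)
  let ?z = "(2 * d, snd x)"
  let ?\<phi> = "ssub \<phi> (e(x := Var ?z)) (Suc d)"
  have "wff C ?\<phi>"
    by (rule wff_ssub) (use All.prems in \<open>auto intro: tenv_upd typed_env_TM\<close>)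
  moreover have "free_for t ?z ?\<phi>" if "t \<in> tdom (snd ?z)" for t
    using that by (intro free_for_ssub) (simp add: tdom_def)
  ultimately have 1: "All ?z ?\<phi> \<in> H \<longleftrightarrow> (\<forall>t\<in>tdom (snd x). subst ?z t ?\<phi> \<in> H)"
    by (subst H_All) auto
  have 2: "subst ?z t ?\<phi> = ssub \<phi> (e(x := t)) (Suc d)" for t
  proof -
    have "tsubst ?z t (e y) = e y" for y
    proof (rule tsubst_fresh)
      have "e y \<in> tdom (snd y)" using typed_envD[OF All.prems(2)] by simp
      then show "?z \<notin> tvars (e y)" by (auto simp: tdom_def)
    qed
    then have "(\<lambda>y. tsubst ?z t ((e(x := Var ?z)) y)) = e(x := t)" by (auto simp: fun_eq_iff)
    then show ?thesis by (subst subst_ssub) auto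
  qed
  show ?case using All by (auto simp: 1 2 typed_env_upd)
next
  case Fls
  then show ?case using H_Fls by simp
qed (simp_all add: val_TM)

lemma typed_env_ex: "\<exists>e. typed_env TM e"
proof
  show "typed_env TM (\<lambda>x. Var (1, snd x))" by (simp add: typed_env_def tdom_def)
qed

lemma sat_TM_closed:
  assumes "wff C \<phi>" "fv \<phi> = {}" "typed_env TM e"
  shows "sat TM \<phi> e \<longleftrightarrow> \<phi> \<in> H"
proof -
  obtain n where "\<forall>v\<in>avars \<phi>. fst v \<le> n"
    using finite_nat_set_iff_bounded_le[of "fst ` avars \<phi>"] by auto
  then have d: "\<forall>v\<in>avars \<phi>. fst v < 2 * Suc n" by fastforce
  let ?\<phi> = "ssub \<phi> Var (Suc n)"
  have w: "wff C ?\<phi>" using assms by (intro wff_ssub) (auto simp: tenv_def)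
  have "Imp \<phi> ?\<phi> \<in> H" "Imp ?\<phi> \<phi> \<in> H"
    using prv_ssub_iff[OF assms(1) d] assms(1) w by (auto intro!: H_prv)
  then have "\<phi> \<in> H \<longleftrightarrow> ?\<phi> \<in> H" using H_MP by blast
  moreover have "?\<phi> = ssub \<phi> e (Suc n)" using assms by (intro ssub_cong) auto
  ultimately show ?thesis using truth[OF assms(1,3)] by simp
qed

text \<open>Free variables of a provable formula are read universally: the universal closure is
  provable by generalisation and closed, and any assignment instantiates it.\<close>

lemma sat_TM_prv:
  assumes "wff C \<phi>" "prv \<phi>" "typed_env TM e"
  shows "sat TM \<phi> e"
proof -
  obtain xs where xs: "set xs = fv \<phi>" using finite_list[OF finite_fv] by blast
  let ?\<psi> = "foldr All xs \<phi>"
  have "prv ?\<psi> \<and> wff C ?\<psi> \<and> fv ?\<psi> = fv \<phi> - set xs"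
    using assms prv_Gen by (induction xs) auto
  then have "sat TM ?\<psi> e" using sat_TM_closed H_prv assms xs by auto
  moreover have "sat TM (foldr All ys \<phi>) e \<Longrightarrow> sat TM \<phi> e" for ys
  proof (induction ys)
    case (Cons y ys)
    have "e y \<in> tdom (snd y)" using typed_envD[OF assms(3)] by simp
    then have "sat TM (foldr All ys \<phi>) (e(y := e y))" using Cons.prems by auto
    then show ?case using Cons.IH by simp
  qed simp
  ultimately show ?thesis by blast
qed

text \<open>Reflexivity is a rule of the calculus. For symmetry and transitivity a fresh variable
  marks the position at which the replacement rule acts.\<close>

lemma Eq_H:
  shows Eq_refl: "s \<in> tdom N0 \<Longrightarrow> Eq s s \<in> H"
    and Eq_sym: "s \<in> tdom N0 \<Longrightarrow> t \<in> tdom N0 \<Longrightarrow> Eq s t \<in> H \<Longrightarrow> Eq t s \<in> H"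
    and Eq_trans: "s \<in> tdom N0 \<Longrightarrow> t \<in> tdom N0 \<Longrightarrow> u \<in> tdom N0
      \<Longrightarrow> Eq s t \<in> H \<Longrightarrow> Eq t u \<in> H \<Longrightarrow> Eq s u \<in> H"
proof -
  show refl: "Eq s s \<in> H" if "s \<in> tdom N0" for s
    using that by (auto intro!: H_prv EqRefl simp: tdom_def)
  have repl: "subst x t \<phi> \<in> H"
    if "Eq s t \<in> H" "subst x s \<phi> \<in> H" "wff C \<phi>" "snd x = N0" "free_for s x \<phi>" "free_for t x \<phi>"
      "s \<in> tdom N0" "t \<in> tdom N0" for s t x \<phi>
  proof -
    have w: "wff C (Eq s t)" "wff C (subst x s \<phi>)" "wff C (subst x t \<phi>)"
      using that by (auto simp: wff_subst tdom_def)
    let ?\<Gamma> = "{subst x s \<phi>, Eq s t}"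
    have "deriv C T ?\<Gamma> (subst x t \<phi>)"
      by (rule EqSubst[of _ _ _ s]; (rule Hyp)?) (use that w in auto)
    then have "prv (Imp (Eq s t) (Imp (subst x s \<phi>) (subst x t \<phi>)))"
      using w by (intro ImpI) auto
    then have "Imp (Eq s t) (Imp (subst x s \<phi>) (subst x t \<phi>)) \<in> H"
      using w by (intro H_prv) auto
    then show ?thesis using that H_MP by blast
  qed
  show sym: "Eq t s \<in> H" if st: "s \<in> tdom N0" "t \<in> tdom N0" "Eq s t \<in> H" for s t
    using repl[of s t "fresh_var (tvars s) N0" "Eq (Var (fresh_var (tvars s) N0)) s"]
      fresh_var[OF finite_tvars, of s N0] refl st by (auto simp: tsubst_fresh tdom_def)
  show "Eq s u \<in> H" if st: "s \<in> tdom N0" "t \<in> tdom N0" "u \<in> tdom N0" "Eq s t \<in> H" "Eq t u \<in> H"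
    for s t u
    using repl[of t u "fresh_var (tvars s) N0" "Eq s (Var (fresh_var (tvars s) N0))"]
      fresh_var[OF finite_tvars, of s N0] refl st by (auto simp: tsubst_fresh tdom_def)
qed

end

section \<open>The extensional quotient of the term model\<close>

locale omega_refutation = refutation "dom D" "RCA0_Omega D" \<chi> for D :: specs and \<chi> :: fm
begin

lemma sat_axiom: "\<phi> \<in> RCA0_Omega D \<Longrightarrow> wff (dom D) \<phi> \<Longrightarrow> typed_env TM e \<Longrightarrow> sat TM \<phi> e"
  by (rule sat_TM_prv) (auto intro: Ax)

lemma EQ_ap:
  assumes "f \<in> tdom (\<rho> \<Rrightarrow> \<tau>)" "x \<in> tdom \<rho>" "y \<in> tdom \<rho>" "EQ TM \<rho> x y"
  shows "EQ TM \<tau> (f \<cdot> x) (f \<cdot> y)"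
proof -
  obtain e where "typed_env TM e" using typed_env_ex ..
  then have e: "typed_env TM (e((0, \<rho> \<Rrightarrow> \<tau>) := f, (1, \<rho>) := x, (2, \<rho>) := y))"
    using assms by (simp add: typed_env_upd)
  show ?thesis
    using sat_axiom[OF base[OF extensionality[OF refl refl refl, of \<rho> \<tau>]] _ e] assms by simp
qed

lemma EQ_st:
  assumes "x \<in> tdom \<rho>" "y \<in> tdom \<rho>" "EQ TM \<rho> x y" "St x \<in> H"
  shows "St y \<in> H"
proof -
  obtain e where "typed_env TM e" using typed_env_ex ..
  then have e: "typed_env TM (e((0, \<rho>) := x, (1, \<rho>) := y))"
    using assms by (simp add: typed_env_upd)
  show ?thesis
    using sat_axiom[OF st_eq[OF refl refl, of \<rho>] _ e] assms by simp
qed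

lemma tdom_App: "f \<in> tdom (\<sigma> \<Rrightarrow> \<tau>) \<Longrightarrow> x \<in> tdom \<sigma> \<Longrightarrow> f \<cdot> x \<in> tdom \<tau>"
  by (auto simp: tdom_def)

lemma tdom_Con: "con_ok (dom D) c \<Longrightarrow> Con c \<in> tdom (con_ty c)"
  by (auto simp: tdom_def)

lemma tdom_len: "s \<in> tdom (Seq \<sigma>) \<Longrightarrow> len \<sigma> s \<in> tdom N0"
  by (auto simp: tdom_def)

lemma tdom_proj: "s \<in> tdom (Seq \<sigma>) \<Longrightarrow> i \<in> tdom N0 \<Longrightarrow> proj \<sigma> s i \<in> tdom \<sigma>"
  by (auto simp: tdom_def)

text \<open>For fixed \<open>i\<close> the relation is an equation about one functional applied to
  the bound, so extensionality moves it along equal bounds. \<open>EQ\<close> at sequence types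
  needs this, because its index range mentions only the left length.\<close>

lemma slt_cong:
  assumes "i \<in> tdom N0" "a \<in> tdom N0" "b \<in> tdom N0" "Eq a b \<in> H" "slt TM i a"
  shows "slt TM i b"
proof -
  let ?f = "monus_c \<cdot> (succ i)"
  have f: "?f \<in> tdom (N0 \<Rrightarrow> N0)" using assms by (simp add: tdom_def)
  have "cval TM monus_c = monus_c"
    using tsub_cong[of monus_c "\<lambda>_. undefined" Var] by (simp add: cval_def val_TM)
  then have s: "slt TM i c = (Eq (?f \<cdot> c) zero \<in> H)" for c by (simp add: slt_def)
  have "Eq (?f \<cdot> a) (?f \<cdot> b) \<in> H" using EQ_ap[OF f] assms by simp
  moreover have "?f \<cdot> a \<in> tdom N0" "?f \<cdot> b \<in> tdom N0" using f assms tdom_App by blast+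
  moreover have "zero \<in> tdom N0" by (simp add: tdom_def)
  ultimately show ?thesis using assms(5) Eq_sym Eq_trans unfolding s by meson
qed

lemma EQ_refl: "s \<in> tdom \<sigma> \<Longrightarrow> EQ TM \<sigma> s s"
  by (induction \<sigma> arbitrary: s) (auto intro: Eq_refl tdom_App tdom_len tdom_proj)

lemma EQ_sym: "s \<in> tdom \<sigma> \<Longrightarrow> t \<in> tdom \<sigma> \<Longrightarrow> EQ TM \<sigma> s t \<Longrightarrow> EQ TM \<sigma> t s"
proof (induction \<sigma> arbitrary: s t)
  case (Seq \<sigma>)
  have l: "len \<sigma> s \<in> tdom N0" "len \<sigma> t \<in> tdom N0" using Seq.prems tdom_len by auto
  have e: "Eq (len \<sigma> t) (len \<sigma> s) \<in> H" using Eq_sym[OF l] Seq.prems by simp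
  have "EQ TM \<sigma> (proj \<sigma> t i) (proj \<sigma> s i)" if i: "i \<in> tdom N0" "slt TM i (len \<sigma> t)" for i
    using Seq.IH[of "proj \<sigma> s i" "proj \<sigma> t i"] Seq.prems i l e tdom_proj
      slt_cong[of i "len \<sigma> t" "len \<sigma> s"] by simp
  then show ?case using e by simp
next
  case (Fn \<sigma> \<tau>)
  have "EQ TM \<tau> (t \<cdot> x) (s \<cdot> x)" if "x \<in> tdom \<sigma>" for x
    using Fn.IH(2)[of "s \<cdot> x" "t \<cdot> x"] Fn.prems that tdom_App by simp
  then show ?case by simp
qed (auto intro: Eq_sym)

lemma EQ_trans:
  "s \<in> tdom \<sigma> \<Longrightarrow> t \<in> tdom \<sigma> \<Longrightarrow> u \<in> tdom \<sigma> \<Longrightarrow> EQ TM \<sigma> s t \<Longrightarrow> EQ TM \<sigma> t u \<Longrightarrow> EQ TM \<sigma> s u"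
proof (induction \<sigma> arbitrary: s t u)
  case N0
  from Eq_trans[OF N0(1-3)] N0(4,5) show ?case by simp
next
  case (Fn \<sigma> \<tau>)
  have "EQ TM \<tau> (s \<cdot> x) (u \<cdot> x)" if "x \<in> tdom \<sigma>" for x
    using Fn.IH(2)[of "s \<cdot> x" "t \<cdot> x" "u \<cdot> x"] Fn.prems that tdom_App by simp
  then show ?case by simp
next
  case (Seq \<sigma>)
  have l: "len \<sigma> s \<in> tdom N0" "len \<sigma> t \<in> tdom N0" "len \<sigma> u \<in> tdom N0"
    using Seq.prems tdom_len by auto
  have "EQ TM \<sigma> (proj \<sigma> s i) (proj \<sigma> u i)" if i: "i \<in> tdom N0" "slt TM i (len \<sigma> s)" for i
    using Seq.IH[of "proj \<sigma> s i" "proj \<sigma> t i" "proj \<sigma> u i"] Seq.prems i l tdom_proj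
      slt_cong[of i "len \<sigma> s" "len \<sigma> t"] by simp
  moreover have "Eq (len \<sigma> s) (len \<sigma> u) \<in> H"
    using Eq_trans[of "len \<sigma> s" "len \<sigma> t" "len \<sigma> u"] l Seq.prems by simp
  ultimately show ?case by simp
qed

text \<open>The quotient by extensional equality is formed with chosen representatives, so that its
  elements are again terms.\<close>

definition cn :: "tm \<Rightarrow> tm" where
  "cn t = (SOME s. s \<in> tdom (ty_of t) \<and> EQ TM (ty_of t) t s)"

lemma cn: assumes "t \<in> tdom \<sigma>" shows "cn t \<in> tdom \<sigma> \<and> EQ TM \<sigma> t (cn t)"
proof -
  have "ty_of t = \<sigma>" using assms by (simp add: tdom_def)
  then show ?thesis
    using someI[of "\<lambda>s. s \<in> tdom \<sigma> \<and> EQ TM \<sigma> t s" t] assms EQ_refl by (simp add: cn_def)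
qed

lemma cn_eq_iff:
  assumes "s \<in> tdom \<sigma>" "t \<in> tdom \<sigma>"
  shows "cn s = cn t \<longleftrightarrow> EQ TM \<sigma> s t"
proof
  assume "EQ TM \<sigma> s t"
  then have "(u \<in> tdom \<sigma> \<and> EQ TM \<sigma> s u) = (u \<in> tdom \<sigma> \<and> EQ TM \<sigma> t u)" for u
    using assms EQ_sym EQ_trans by meson
  moreover have "ty_of s = \<sigma>" "ty_of t = \<sigma>" using assms by (auto simp: tdom_def)
  ultimately show "cn s = cn t" by (simp add: cn_def)
next
  assume "cn s = cn t"
  then show "EQ TM \<sigma> s t" using cn[of s \<sigma>] cn[of t \<sigma>] assms EQ_sym EQ_trans by metis
qed

lemma cn_cn: "t \<in> tdom \<sigma> \<Longrightarrow> cn (cn t) = cn t"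
  using cn[of t \<sigma>] cn_eq_iff[of t \<sigma> "cn t"] by simp

definition QM :: "tm strc" where
  "QM = \<lparr>sdom = (\<lambda>\<sigma>. cn ` tdom \<sigma>), sap = (\<lambda>f x. cn (f \<cdot> x)), scon = (\<lambda>c. cn (Con c)),
     seq = (=), sst = (\<lambda>t. St t \<in> H)\<rparr>"

lemma QM_simps [simp]: "sdom QM = (\<lambda>\<sigma>. cn ` tdom \<sigma>)" "sap QM = (\<lambda>f x. cn (f \<cdot> x))"
  "scon QM = (\<lambda>c. cn (Con c))" "seq QM = (=)" "sst QM = (\<lambda>t. St t \<in> H)"
  by (simp_all add: QM_def)

lemma cn_App:
  assumes "f \<in> tdom (\<sigma> \<Rrightarrow> \<tau>)" "x \<in> tdom \<sigma>"
  shows "cn (cn f \<cdot> cn x) = cn (f \<cdot> x)"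
proof -
  note f = cn[OF assms(1)] and x = cn[OF assms(2)]
  have "EQ TM \<tau> (f \<cdot> x) (cn f \<cdot> x)" using f assms by simp
  moreover have "EQ TM \<tau> (cn f \<cdot> x) (cn f \<cdot> cn x)" using EQ_ap f x assms by blast
  ultimately have "EQ TM \<tau> (f \<cdot> x) (cn f \<cdot> cn x)"
    using EQ_trans[of "f \<cdot> x" \<tau> "cn f \<cdot> x"] f x assms tdom_App by blast
  then show ?thesis using cn_eq_iff[of "f \<cdot> x" \<tau> "cn f \<cdot> cn x"] f x assms tdom_App by auto
qed

lemma val_TM_dom: "typed_env TM e \<Longrightarrow> wft (dom D) t \<Longrightarrow> val TM e t \<in> tdom (ty_of t)"
  using val_typed[OF typed_TM] by simp

lemma val_QM: "typed_env TM e \<Longrightarrow> wft (dom D) t \<Longrightarrow> val QM (cn \<circ> e) t = cn (val TM e t)"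
proof (induction t)
  case (App s t)
  then obtain \<tau> where "ty_of s = ty_of t \<Rrightarrow> \<tau>" by auto
  then have "cn (cn (val TM e s) \<cdot> cn (val TM e t)) = cn (val TM e s \<cdot> val TM e t)"
    using val_TM_dom[of e s] val_TM_dom[of e t] App.prems by (intro cn_App) auto
  then show ?case using App by simp
qed auto

lemma St_cn: "t \<in> tdom \<sigma> \<Longrightarrow> St (cn t) \<in> H \<longleftrightarrow> St t \<in> H"
  using cn EQ_sym EQ_st by meson

lemma sat_QM: "typed_env TM e \<Longrightarrow> wff (dom D) \<phi> \<Longrightarrow> sat QM \<phi> (cn \<circ> e) = sat TM \<phi> e"
proof (induction \<phi> arbitrary: e)
  case (Eq s t)
  then show ?case
    using cn_eq_iff[of "val TM e s" N0 "val TM e t"] val_TM_dom[of e s] val_TM_dom[of e t]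
    by (simp add: val_QM del: comp_apply)
next
  case (St t)
  then show ?case using St_cn[OF val_TM_dom[of e t]] by (simp add: val_QM del: comp_apply)
next
  case (All x \<phi>)
  have "sat QM \<phi> ((cn \<circ> e)(x := cn t)) = sat TM \<phi> (e(x := t))" if "t \<in> tdom (snd x)" for t
  proof -
    have "(cn \<circ> e)(x := cn t) = cn \<circ> (e(x := t))" by auto
    then show ?thesis using All.IH[of "e(x := t)"] All.prems that by (simp only: typed_env_upd TM_simps wff.simps)
  qed
  then show ?case by (simp del: comp_apply)
qed auto

lemma QM_dom: assumes "a \<in> sdom QM \<sigma>" shows "a \<in> tdom \<sigma>" "cn a = a"
proof -
  obtain t where "a = cn t" "t \<in> tdom \<sigma>" using assms by auto
  then show "a \<in> tdom \<sigma>" "cn a = a" using cn[of t \<sigma>] cn_cn[of t \<sigma>] by auto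
qed

lemma typed_env_QM: "typed_env QM e \<Longrightarrow> typed_env TM e \<and> cn \<circ> e = e"
proof -
  assume e: "typed_env QM e"
  have "e x \<in> tdom (snd x) \<and> cn (e x) = e x" for x
    using QM_dom[OF typed_envD[OF e]] by blast
  then show ?thesis by (auto simp: typed_env_def)
qed

lemma QM_model: "omega_model D QM \<and> (\<forall>e. typed_env QM e \<longrightarrow> \<not> sat QM \<chi> e)"
proof (intro conjI allI impI)
  have typed: "typed_strc (dom D) QM"
    unfolding typed_strc_def
  proof (intro conjI allI impI ballI)
    show "sdom QM \<sigma> \<noteq> {}" for \<sigma> using typed_TM by (simp add: typed_strc_def)
    show "scon QM c \<in> sdom QM (con_ty c)" if "con_ok (dom D) c" for c
      using that tdom_Con by simp
    show "sap QM f x \<in> sdom QM \<tau>" if "f \<in> sdom QM (\<sigma> \<Rrightarrow> \<tau>)" "x \<in> sdom QM \<sigma>" for f x \<sigma> \<tau>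
      using tdom_App[OF QM_dom(1)[OF that(1)] QM_dom(1)[OF that(2)]] by simp
  qed
  have ext: "a = b" if ab: "a \<in> sdom QM \<sigma>" "b \<in> sdom QM \<sigma>" "EQ QM \<sigma> a b" for \<sigma> a b
  proof -
    have "a \<in> tdom \<sigma>" "b \<in> tdom \<sigma>" "cn a = a" "cn b = b"
      using QM_dom[OF ab(1)] QM_dom[OF ab(2)] by auto
    moreover obtain e where "typed_env TM e" using typed_env_ex ..
    ultimately have e: "typed_env TM (e((0, \<sigma>) := a, (1, \<sigma>) := b))"
      by (simp add: typed_env_upd)
    have "EQ TM \<sigma> a b"
      using sat_QM[OF e, of "eqf \<sigma> (Var (0, \<sigma>)) (Var (1, \<sigma>))"] ab \<open>cn a = a\<close> \<open>cn b = b\<close> by simp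
    then show ?thesis
      using cn_eq_iff \<open>a \<in> tdom \<sigma>\<close> \<open>b \<in> tdom \<sigma>\<close> \<open>cn a = a\<close> \<open>cn b = b\<close> by metis
  qed
  have "sat QM \<phi> e" if "\<phi> \<in> RCA0_Omega D" "wff (dom D) \<phi>" "typed_env QM e" for \<phi> e
    using sat_axiom[OF that(1,2), of e] sat_QM[of e \<phi>] typed_env_QM[OF that(3)] that(2) by simp
  then show "omega_model D QM" using typed ext by (auto simp: omega_model_def)
  show "\<not> sat QM \<chi> e" if "typed_env QM e" for e
  proof -
    have "ded (chain 0) (Neg \<chi>)" using ded_hyp[OF chain_wf, of "Neg \<chi>" 0] by simp
    then have "Neg \<chi> \<in> H" using wff_goal unfolding H_def by (intro CollectI conjI exI[of _ 0]) auto
    then have "\<chi> \<notin> H" using H_MP H_Fls by blast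
    then show ?thesis
      using typed_env_QM[OF that] sat_QM[of e \<chi>] sat_TM_closed[of \<chi> e] wff_goal closed_goal by simp
  qed
qed

end

text \<open>The universe is always the type \<open>tm\<close>, which makes it possible to pick one
  counter-model as a global constant.\<close>

theorem model_existence:
  assumes "wff (dom D) \<chi>" "fv \<chi> = {}" "\<not> RCA0_Omega_proves D \<chi>"
  shows "\<exists>M :: tm strc. omega_model D M \<and> (\<forall>e. typed_env M e \<longrightarrow> \<not> sat M \<chi> e)"
proof -
  interpret omega_refutation D \<chi>
    by unfold_locales (use assms in \<open>auto simp: RCA0_Omega_proves_def proves_def\<close>)
  show ?thesis using QM_model by blast
qed

section \<open>A fixed counter-model\<close>

definition equivalences :: "tm strc \<Rightarrow> bool" where
  "equivalences M \<longleftrightarrow> (\<forall>e. typed_env M e \<longrightarrow>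
     sat M Pi01_TRANS e = sat M WEIMAX_star e \<and> sat M WEIMAX_star e = sat M UWEIMAX e \<and>
     sat M UWEIMAX e = sat M exists2 e)"

text \<open>
  The model is a global constant, so that its sorts can be made into HOL types and its arithmetic
  into instances of type classes. When there is no model to choose, the type of numbers is a
  copy of the natural numbers, and the other types are of no interest.
\<close>

definition GM :: "tm strc" where
  "GM = (SOME M. \<exists>D. omega_model D M \<and> \<not> equivalences M)"

definition carr :: "ty \<Rightarrow> tm set" where
  "carr \<sigma> = (if \<exists>D. omega_model D GM then sdom GM \<sigma> else range num)"

lemma carr_ex: "\<exists>t. t \<in> carr \<sigma>"
  by (auto simp: carr_def omega_model_def typed_strc_def)

text \<open>An instance is a copy of the carrier of one finite type, so that HOL type checking
  replaces the carrier side conditions.\<close>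

class srt =
  fixes srt :: "'a itself \<Rightarrow> ty" and rp :: "'a \<Rightarrow> tm" and cl :: "tm \<Rightarrow> 'a"
  assumes srt_type: "type_definition rp cl (carr (srt TYPE('a)))"
begin

lemma cl_rp [simp]: "cl (rp x) = x"
  using srt_type by (rule type_definition.Rep_inverse)

lemma rp_carr [simp]: "rp x \<in> carr (srt TYPE('a))"
  using srt_type by (rule type_definition.Rep)

lemma rp_cl: "t \<in> carr (srt TYPE('a)) \<Longrightarrow> rp (cl t) = t"
  using srt_type by (rule type_definition.Abs_inverse)

lemma rp_inject [simp]: "rp x = rp y \<longleftrightarrow> x = y"
  using srt_type by (rule type_definition.Rep_inject)

lemma carr_cases: "t \<in> carr (srt TYPE('a)) \<Longrightarrow> \<exists>x. t = rp x"
  using rp_cl by metis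

end

typedef nn = "carr N0" using carr_ex .

instantiation nn :: srt
begin
definition srt_nn :: "nn itself \<Rightarrow> ty" where "srt_nn _ = N0"
definition rp_nn :: "nn \<Rightarrow> tm" where "rp_nn = Rep_nn"
definition cl_nn :: "tm \<Rightarrow> nn" where "cl_nn = Abs_nn"
instance by standard (simp add: srt_nn_def rp_nn_def cl_nn_def type_definition_nn)
end

typedef (overloaded) ('a::srt, 'b::srt) fn (infixr "\<leadsto>" 20) =
  "carr (srt TYPE('a) \<Rrightarrow> srt TYPE('b))" using carr_ex .

instantiation fn :: (srt, srt) srt
begin
definition srt_fn :: "('a \<leadsto> 'b) itself \<Rightarrow> ty" where "srt_fn _ = srt TYPE('a) \<Rrightarrow> srt TYPE('b)"
definition rp_fn :: "('a \<leadsto> 'b) \<Rightarrow> tm" where "rp_fn = Rep_fn"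
definition cl_fn :: "tm \<Rightarrow> 'a \<leadsto> 'b" where "cl_fn = Abs_fn"
instance by standard (simp add: srt_fn_def rp_fn_def cl_fn_def type_definition_fn)
end

typedef (overloaded) ('a::srt) sq = "carr (Seq (srt TYPE('a)))" using carr_ex .

instantiation sq :: (srt) srt
begin
definition srt_sq :: "'a sq itself \<Rightarrow> ty" where "srt_sq _ = Seq (srt TYPE('a))"
definition rp_sq :: "'a sq \<Rightarrow> tm" where "rp_sq = Rep_sq"
definition cl_sq :: "tm \<Rightarrow> 'a sq" where "cl_sq = Abs_sq"
instance by standard (simp add: srt_sq_def rp_sq_def cl_sq_def type_definition_sq)
end

lemmas srt_simps [simp] = srt_nn_def srt_fn_def srt_sq_def

definition app :: "('a::srt \<leadsto> 'b::srt) \<Rightarrow> 'a \<Rightarrow> 'b" (infixl "$" 95) where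
  "f $ x = cl (sap GM (rp f) (rp x))"

definition std :: "'a::srt \<Rightarrow> bool" where "std x \<longleftrightarrow> sst GM (rp x)"

text \<open>A description, so that it can be written before the body is known to be definable:
  extensionality gives uniqueness, the \<open>dfn\<close> rules give existence.\<close>

definition LAM :: "('a::srt \<Rightarrow> 'b::srt) \<Rightarrow> 'a \<leadsto> 'b" (binder "\<Lambda>" 10) where
  "LAM F = (THE f. \<forall>x. f $ x = F x)"

lemma EQ_refl: "seq M = (=) \<Longrightarrow> EQ M \<sigma> a a"
  by (induction \<sigma> arbitrary: a) auto

locale gmodel =
  fixes D :: specs
  assumes model: "omega_model D GM"
begin

lemma carr [simp]: "carr \<sigma> = sdom GM \<sigma>"
  using model by (auto simp: carr_def)

lemma seq [simp]: "seq GM = (=)"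
  using model by (simp add: omega_model_def)

lemma typed: "typed_strc (dom D) GM"
  using model by (simp add: omega_model_def)

lemma EQ_iff: "a \<in> sdom GM \<sigma> \<Longrightarrow> b \<in> sdom GM \<sigma> \<Longrightarrow> EQ GM \<sigma> a b \<longleftrightarrow> a = b"
  using model EQ_refl[of GM] by (auto simp: omega_model_def)

lemma sap_carr: "f \<in> sdom GM (\<sigma> \<Rrightarrow> \<tau>) \<Longrightarrow> x \<in> sdom GM \<sigma> \<Longrightarrow> sap GM f x \<in> sdom GM \<tau>"
  using typed unfolding typed_strc_def by blast

lemma scon_carr: "con_ok (dom D) c \<Longrightarrow> con_ty c = \<sigma> \<Longrightarrow> scon GM c \<in> sdom GM \<sigma>"
  using typed unfolding typed_strc_def by blast

lemma ax: "\<phi> \<in> RCA0_Omega D \<Longrightarrow> wff (dom D) \<phi> \<Longrightarrow> typed_env GM e \<Longrightarrow> sat GM \<phi> e"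
  using model by (simp add: omega_model_def)

lemma env_ex: "\<exists>e. typed_env GM e"
proof -
  have "sdom GM \<sigma> \<noteq> {}" for \<sigma> using typed by (simp add: typed_strc_def)
  then have "typed_env GM (\<lambda>x. SOME u. u \<in> sdom GM (snd x))" by (simp add: typed_env_def some_in_eq)
  then show ?thesis by blast
qed

lemma comb_K_eq:
  assumes "a \<in> sdom GM \<rho>" "b \<in> sdom GM \<tau>"
  shows "sap GM (sap GM (scon GM (KC \<rho> \<tau>)) a) b = a"
proof -
  obtain e where "typed_env GM e" using env_ex ..
  then have e: "typed_env GM (e((0, \<rho>) := a, (1, \<tau>) := b))" using assms by (simp add: typed_env_upd)
  have "EQ GM \<rho> (sap GM (sap GM (scon GM (KC \<rho> \<tau>)) a) b) a"
    using ax[OF base[OF comb_K[OF refl refl, of \<rho> \<tau>]] _ e] by simp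
  moreover have "scon GM (KC \<rho> \<tau>) \<in> sdom GM (\<rho> \<Rrightarrow> \<tau> \<Rrightarrow> \<rho>)" by (rule scon_carr) auto
  ultimately show ?thesis using EQ_iff assms sap_carr by meson
qed

lemma comb_S_eq:
  assumes "a \<in> sdom GM (\<delta> \<Rrightarrow> \<rho> \<Rrightarrow> \<tau>)" "b \<in> sdom GM (\<delta> \<Rrightarrow> \<rho>)" "c \<in> sdom GM \<delta>"
  shows "sap GM (sap GM (sap GM (scon GM (SC \<delta> \<rho> \<tau>)) a) b) c = sap GM (sap GM a c) (sap GM b c)"
proof -
  obtain e where "typed_env GM e" using env_ex ..
  then have e: "typed_env GM (e((0, \<delta> \<Rrightarrow> \<rho> \<Rrightarrow> \<tau>) := a, (1, \<delta> \<Rrightarrow> \<rho>) := b, (2, \<delta>) := c))"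
    using assms by (simp add: typed_env_upd)
  have "EQ GM \<tau> (sap GM (sap GM (sap GM (scon GM (SC \<delta> \<rho> \<tau>)) a) b) c) (sap GM (sap GM a c) (sap GM b c))"
    using ax[OF base[OF comb_S[OF refl refl refl, of \<tau> \<delta> \<rho>]] _ e] by simp
  moreover have "scon GM (SC \<delta> \<rho> \<tau>) \<in> sdom GM (con_ty (SC \<delta> \<rho> \<tau>))" by (rule scon_carr) auto
  then have "sap GM (sap GM (sap GM (scon GM (SC \<delta> \<rho> \<tau>)) a) b) c \<in> sdom GM \<tau>"
    using assms sap_carr by (simp, meson)
  moreover have "sap GM (sap GM a c) (sap GM b c) \<in> sdom GM \<tau>" using assms sap_carr by meson
  ultimately show ?thesis using EQ_iff by blast
qed

lemma val_lam:
  "typed_env GM e \<Longrightarrow> wft (dom D) t \<Longrightarrow> u \<in> sdom GM (snd x)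
    \<Longrightarrow> sap GM (val GM e (lam x t)) u = val GM (e(x := u)) t"
proof (induction t)
  case (Var y)
  let ?\<sigma> = "snd x"
  have "scon GM (KC ?\<sigma> (?\<sigma> \<Rrightarrow> ?\<sigma>)) \<in> sdom GM (?\<sigma> \<Rrightarrow> (?\<sigma> \<Rrightarrow> ?\<sigma>) \<Rrightarrow> ?\<sigma>)"
    "scon GM (KC ?\<sigma> ?\<sigma>) \<in> sdom GM (?\<sigma> \<Rrightarrow> ?\<sigma> \<Rrightarrow> ?\<sigma>)" by (auto intro: scon_carr)
  moreover then have "sap GM (scon GM (KC ?\<sigma> ?\<sigma>)) u \<in> sdom GM (?\<sigma> \<Rrightarrow> ?\<sigma>)"
    using Var sap_carr by blast
  ultimately show ?case
    using Var typed_envD[of GM e y] by (auto simp: comb_S_eq comb_K_eq)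
next
  case (Con c)
  have "scon GM c \<in> sdom GM (con_ty c)" using Con by (auto intro: scon_carr)
  then show ?case using Con by (simp add: comb_K_eq)
next
  case (App s t)
  then obtain \<tau> where ty: "ty_of s = ty_of t \<Rrightarrow> \<tau>" by auto
  have v: "val GM e' s \<in> sdom GM (ty_of t \<Rrightarrow> \<tau>)" "val GM e' t \<in> sdom GM (ty_of t)"
    if "typed_env GM e'" for e' using val_typed[OF typed that, of s] val_typed[OF typed that, of t] App.prems ty by auto
  show ?case
  proof (cases "x \<in> tvars (s \<cdot> t)")
    case True
    have "val GM e (lam x s) \<in> sdom GM (snd x \<Rrightarrow> ty_of t \<Rrightarrow> \<tau>)"
      "val GM e (lam x t) \<in> sdom GM (snd x \<Rrightarrow> ty_of t)"
      using val_typed[OF typed App.prems(1) wft_lam, of s x] val_typed[OF typed App.prems(1) wft_lam, of t x]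
        App.prems ty by auto
    then show ?thesis using True App ty by (auto simp: comb_S_eq)
  next
    case False
    then have "val GM (e(x := u)) s = val GM e s" "val GM (e(x := u)) t = val GM e t"
      by (auto intro!: val_cong)
    then show ?thesis using False App.prems v[OF App.prems(1)] ty sap_carr
      by (simp add: comb_K_eq del: fun_upd_apply)
  qed
qed

end

text \<open>
  A context is an iterated product of sorts; \<open>dfu \<tau> F\<close> says that \<open>F\<close> is given by a standard functional
  applied to the components of the context.
\<close>

class ctx =
  fixes dfu :: "ty \<Rightarrow> ('a \<Rightarrow> tm) \<Rightarrow> bool"
  assumes dfu_const: "omega_model D GM \<Longrightarrow> t \<in> carr \<tau> \<Longrightarrow> sst GM t \<Longrightarrow> dfu \<tau> (\<lambda>_. t)"
    and dfu_app: "omega_model D GM \<Longrightarrow> dfu (\<sigma> \<Rrightarrow> \<tau>) F \<Longrightarrow> dfu \<sigma> G \<Longrightarrow> dfu \<tau> (\<lambda>c. sap GM (F c) (G c))"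
    and dfu_carr: "omega_model D GM \<Longrightarrow> dfu \<tau> F \<Longrightarrow> F c \<in> carr \<tau>"

context gmodel
begin

lemma sst_ap:
  assumes "f \<in> sdom GM (\<sigma> \<Rrightarrow> \<tau>)" "x \<in> sdom GM \<sigma>" "sst GM f" "sst GM x"
  shows "sst GM (sap GM f x)"
proof -
  obtain e where "typed_env GM e" using env_ex ..
  then have e: "typed_env GM (e((0, \<sigma> \<Rrightarrow> \<tau>) := f, (1, \<sigma>) := x))" using assms by (simp add: typed_env_upd)
  show ?thesis using ax[OF st_app[OF refl refl, of \<sigma> \<tau>] _ e] assms by simp
qed

lemma sst_closed:
  assumes "wft (dom D) t" "tvars t = {}"
  shows "sst GM (cval GM t)"
proof -
  obtain e where "typed_env GM e" using env_ex ..
  then show ?thesis using ax[OF st_closed[OF assms], of e] assms by (simp add: val_closed)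
qed

lemma sst_con: "con_ok (dom D) c \<Longrightarrow> sst GM (scon GM c)"
  using sst_closed[of "Con c"] by (simp add: cval_def)

end

instantiation unit :: ctx
begin
definition dfu_unit :: "ty \<Rightarrow> (unit \<Rightarrow> tm) \<Rightarrow> bool" where
  "dfu_unit \<tau> F \<longleftrightarrow> F () \<in> carr \<tau> \<and> sst GM (F ())"
instance
proof
  fix D :: specs and \<sigma> \<tau> and F G :: "unit \<Rightarrow> tm" and c :: unit
  assume m: "omega_model D GM"
  then interpret gmodel D by unfold_locales
  show "t \<in> carr \<tau> \<Longrightarrow> sst GM t \<Longrightarrow> dfu \<tau> (\<lambda>_::unit. t)" for t by (simp add: dfu_unit_def)
  show "dfu (\<sigma> \<Rrightarrow> \<tau>) F \<Longrightarrow> dfu \<sigma> G \<Longrightarrow> dfu \<tau> (\<lambda>c. sap GM (F c) (G c))"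
    using sap_carr sst_ap by (auto simp: dfu_unit_def)
  show "dfu \<tau> F \<Longrightarrow> F c \<in> carr \<tau>" by (simp add: dfu_unit_def)
qed
end

instantiation prod :: (ctx, srt) ctx
begin
text \<open>The last component of the context is abstracted. Closure under constants is then the
  combinator K, closure under application the combinator S.\<close>

definition dfu_prod :: "ty \<Rightarrow> ('a \<times> 'b \<Rightarrow> tm) \<Rightarrow> bool" where
  "dfu_prod \<tau> F \<longleftrightarrow> (\<exists>G. dfu (srt TYPE('b) \<Rrightarrow> \<tau>) G \<and> (\<forall>c x. F (c, x) = sap GM (G c) (rp x)))"
instance
proof
  fix D :: specs and \<sigma> \<tau> and F G :: "'a \<times> 'b \<Rightarrow> tm" and c :: "'a \<times> 'b"
  assume m: "omega_model D GM"
  then interpret gmodel D by unfold_locales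
  let ?\<beta> = "srt TYPE('b)"
  have rp: "rp x \<in> sdom GM ?\<beta>" for x :: 'b using rp_carr[of x] by simp
  show "dfu \<tau> (\<lambda>_::'a \<times> 'b. t)" if t: "t \<in> carr \<tau>" "sst GM t" for t
    unfolding dfu_prod_def
  proof (intro exI conjI)
    have k: "scon GM (KC \<tau> ?\<beta>) \<in> sdom GM (\<tau> \<Rrightarrow> ?\<beta> \<Rrightarrow> \<tau>)" by (rule scon_carr) auto
    show "dfu (?\<beta> \<Rrightarrow> \<tau>) (\<lambda>_::'a. sap GM (scon GM (KC \<tau> ?\<beta>)) t)"
      using t k sap_carr sst_ap[OF k _ sst_con] by (intro dfu_const[OF m]) auto
    show "\<forall>c x. t = sap GM (sap GM (scon GM (KC \<tau> ?\<beta>)) t) (rp (x::'b))"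
      using t rp by (simp add: comb_K_eq)
  qed
  show "dfu \<tau> (\<lambda>c. sap GM (F c) (G c))" if FG: "dfu (\<sigma> \<Rrightarrow> \<tau>) F" "dfu \<sigma> G"
  proof -
    obtain F' G' where 1: "dfu (?\<beta> \<Rrightarrow> \<sigma> \<Rrightarrow> \<tau>) F'" "\<And>c x. F (c, x) = sap GM (F' c) (rp x)"
      and 2: "dfu (?\<beta> \<Rrightarrow> \<sigma>) G'" "\<And>c x. G (c, x) = sap GM (G' c) (rp x)"
      using FG unfolding dfu_prod_def by blast
    let ?S = "scon GM (SC ?\<beta> \<sigma> \<tau>)"
    have "?S \<in> sdom GM (con_ty (SC ?\<beta> \<sigma> \<tau>))" by (rule scon_carr) auto
    then have S: "dfu ((?\<beta> \<Rrightarrow> \<sigma> \<Rrightarrow> \<tau>) \<Rrightarrow> (?\<beta> \<Rrightarrow> \<sigma>) \<Rrightarrow> ?\<beta> \<Rrightarrow> \<tau>) (\<lambda>_::'a. ?S)"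
      by (intro dfu_const[OF m]) (auto intro: sst_con)
    show ?thesis unfolding dfu_prod_def
    proof (intro exI conjI allI)
      show "dfu (?\<beta> \<Rrightarrow> \<tau>) (\<lambda>c. sap GM (sap GM ?S (F' c)) (G' c))"
        using dfu_app[OF m dfu_app[OF m S 1(1)] 2(1)] .
      show "sap GM (F (c, x)) (G (c, x)) = sap GM (sap GM (sap GM ?S (F' c)) (G' c)) (rp x)" for c x
        using dfu_carr[OF m 1(1), of c] dfu_carr[OF m 2(1), of c] rp[of x]
        by (simp add: 1 2 comb_S_eq)
    qed
  qed
  show "dfu \<tau> F \<Longrightarrow> F c \<in> carr \<tau>"
    using dfu_carr[OF m, of "?\<beta> \<Rrightarrow> \<tau>"] rp sap_carr by (cases c) (fastforce simp: dfu_prod_def)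
qed
end

definition dfn :: "('c::ctx \<Rightarrow> 'a::srt) \<Rightarrow> bool" where
  "dfn F \<longleftrightarrow> dfu (srt TYPE('a)) (\<lambda>c. rp (F c))"

definition comb_I :: "'a::srt \<leadsto> 'a" where
  "comb_I = cl (cval GM (lam (0, srt TYPE('a)) (Var (0, srt TYPE('a)))))"

definition comb_K :: "'a::srt \<leadsto> 'b::srt \<leadsto> 'a" where
  "comb_K = cl (scon GM (KC (srt TYPE('a)) (srt TYPE('b))))"

named_theorems dfn_intros

context gmodel
begin

lemma rp_sdom [simp]: "rp (x::'a::srt) \<in> sdom GM (srt TYPE('a))"
  using rp_carr[of x] by simp

lemma rp_app: "rp (f $ x) = sap GM (rp f) (rp x)" for f :: "'a::srt \<leadsto> 'b::srt"
proof -
  have "sap GM (rp f) (rp x) \<in> sdom GM (srt TYPE('b))"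
    using sap_carr[OF _ rp_sdom[of x], of "rp f"] rp_sdom[of f] by simp
  then show ?thesis by (simp add: app_def rp_cl)
qed

lemma ext:
  fixes f g :: "'a::srt \<leadsto> 'b::srt"
  assumes "\<And>x. f $ x = g $ x"
  shows "f = g"
proof -
  have fg: "rp f \<in> sdom GM (srt TYPE('a) \<Rrightarrow> srt TYPE('b))" "rp g \<in> sdom GM (srt TYPE('a) \<Rrightarrow> srt TYPE('b))"
    using rp_sdom[of f] rp_sdom[of g] by auto
  have "sap GM (rp f) u = sap GM (rp g) u" if "u \<in> sdom GM (srt TYPE('a))" for u
    using that carr_cases[of u] assms rp_app by (metis carr)
  then have "EQ GM (srt TYPE('a) \<Rrightarrow> srt TYPE('b)) (rp f) (rp g)" by (simp add: EQ_refl)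
  then show ?thesis using EQ_iff[OF fg] by (simp del: EQ.simps)
qed

lemma std_app: "std f \<Longrightarrow> std x \<Longrightarrow> std (f $ x)"
  using sst_ap[of "rp f" _ _ "rp x"] rp_sdom[of f] rp_sdom[of x] by (simp add: std_def rp_app)

lemma closed_const:
  fixes k :: "'a::srt"
  assumes "k = cl (cval GM t)" "wft (dom D) t" "tvars t = {}" "ty_of t = srt TYPE('a)"
  shows "rp k = cval GM t" "std k"
proof -
  obtain e where "typed_env GM e" using env_ex ..
  then have "cval GM t \<in> sdom GM (srt TYPE('a))"
    using val_typed[OF typed, of e t] assms by (simp add: val_closed)
  then show "rp k = cval GM t" using assms by (simp add: rp_cl)
  then show "std k" using sst_closed assms by (simp add: std_def)
qed

lemma comb_I [simp]: "comb_I $ x = x" and std_I: "std (comb_I :: 'a \<leadsto> 'a)" for x :: "'a::srt"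
proof -
  let ?x = "(0, srt TYPE('a))"
  obtain e where e: "typed_env GM e" using env_ex ..
  note c = closed_const[OF comb_I_def[where 'a='a]]
  have "rp (comb_I $ x) = sap GM (cval GM (lam ?x (Var ?x))) (rp x)"
    using c by (simp add: rp_app)
  also have "\<dots> = rp x"
    using val_lam[OF e, of "Var ?x" "rp x" ?x] val_closed[of "lam ?x (Var ?x)" GM e] by simp
  finally show "comb_I $ x = x" by simp
  show "std (comb_I :: 'a \<leadsto> 'a)" using c by simp
qed

lemma comb_K [simp]: "comb_K $ x $ y = x" and std_K: "std (comb_K :: 'a \<leadsto> 'b \<leadsto> 'a)"
  for x :: "'a::srt" and y :: "'b::srt"
proof -
  have d: "(comb_K :: 'a \<leadsto> 'b \<leadsto> 'a) = cl (cval GM (Con (KC (srt TYPE('a)) (srt TYPE('b)))))"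
    by (simp add: comb_K_def cval_def)
  note c = closed_const[OF d]
  have "rp (comb_K $ x $ y) = rp x"
    using c rp_sdom[of x] rp_sdom[of y] by (simp add: rp_app cval_def comb_K_eq)
  then show "comb_K $ x $ y = x" by simp
  show "std (comb_K :: 'a \<leadsto> 'b \<leadsto> 'a)" using c by simp
qed

lemma dfn_const: "std k \<Longrightarrow> dfn (\<lambda>_. k)"
  unfolding dfn_def by (rule dfu_const[OF model]) (auto simp: std_def)

lemma dfn_app [dfn_intros]: "dfn F \<Longrightarrow> dfn G \<Longrightarrow> dfn (\<lambda>c. F c $ G c)"
  using dfu_app[OF model] by (simp add: dfn_def rp_app)

lemma dfn_prod:
  "dfn F \<longleftrightarrow> (\<exists>G. dfn G \<and> (\<forall>c x. F (c, x) = G c $ x))" for F :: "'c::ctx \<times> 'a::srt \<Rightarrow> 'b::srt"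
proof
  assume "dfn F"
  then obtain G where G: "dfu (srt TYPE('a) \<Rrightarrow> srt TYPE('b)) G" "\<And>c x. rp (F (c, x)) = sap GM (G c) (rp x)"
    unfolding dfn_def dfu_prod_def by blast
  have "rp (cl (G c) :: 'a \<leadsto> 'b) = G c" for c
    using dfu_carr[OF model G(1)] rp_cl[where 'a="'a \<leadsto> 'b", of "G c"] by simp
  then have "dfn (\<lambda>c. cl (G c) :: 'a \<leadsto> 'b)" "F (c, x) = cl (G c) $ x" for c x
    using G by (simp_all add: dfn_def app_def flip: G(2))
  then show "\<exists>G. dfn G \<and> (\<forall>c x. F (c, x) = G c $ x)" by blast
next
  assume "\<exists>G. dfn G \<and> (\<forall>c x. F (c, x) = G c $ x)"
  then show "dfn F" unfolding dfn_def dfu_prod_def by (auto simp: rp_app)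
qed

lemma dfn_weaken: "dfn F \<Longrightarrow> dfn (\<lambda>c. F (fst c))"
  unfolding dfn_prod by (auto intro!: exI[of _ "\<lambda>c. comb_K $ F c"] dfn_app dfn_const std_K)

lemma dfn_snd: "dfn (\<lambda>c. snd c)"
  unfolding dfn_prod by (auto intro!: exI[of _ "\<lambda>c. comb_I"] dfn_const std_I)

text \<open>Projections play the part of de Bruijn indices; each depth has its own rule because the
  rules are applied by syntactic matching.\<close>

lemma dfn_var [dfn_intros]:
  "dfn (\<lambda>c. snd c)" "dfn (\<lambda>c. snd (fst c))" "dfn (\<lambda>c. snd (fst (fst c)))"
  "dfn (\<lambda>c. snd (fst (fst (fst c))))" "dfn (\<lambda>c. snd (fst (fst (fst (fst c)))))"
  "dfn (\<lambda>c. snd (fst (fst (fst (fst (fst c))))))"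
  "dfn (\<lambda>c. snd (fst (fst (fst (fst (fst (fst c)))))))"
  "dfn (\<lambda>c. snd (fst (fst (fst (fst (fst (fst (fst c))))))))"
  "dfn (\<lambda>c. snd (fst (fst (fst (fst (fst (fst (fst (fst c)))))))))"
  by (intro dfn_weaken dfn_snd)+

lemma LAM_eq: assumes "\<And>x. f $ x = F x" shows "(\<Lambda> x. F x) = f"
  unfolding LAM_def using assms by (intro the_equality ext) auto

lemma dfn_LAM [dfn_intros]:
  assumes "dfn (\<lambda>d. F (fst d) (snd d))"
  shows "dfn (\<lambda>c. \<Lambda> x. F c x)"
proof -
  obtain G where "dfn G" "\<And>c x. F c x = G c $ x" using assms unfolding dfn_prod by auto
  moreover from this have "(\<Lambda> x. F c x) = G c" for c by (intro LAM_eq) simp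
  ultimately show ?thesis by simp
qed

lemma beta:
  assumes "dfn (\<lambda>d. F (fst d) (snd d))"
  shows "(\<Lambda> x. F c x) $ a = F c a"
proof -
  obtain G where "dfn G" "\<And>c x. F c x = G c $ x" using assms unfolding dfn_prod by auto
  moreover from this have "(\<Lambda> x. F c x) = G c" by (intro LAM_eq) simp
  ultimately show ?thesis by simp
qed

text \<open>Over the empty context definability is standardness. This is how explicit definitions
  yield standard objects in \<open>rep0\<close> to \<open>rep3\<close>.\<close>

lemma dfn_unit: "dfn F \<longleftrightarrow> std (F ())"
  by (simp add: dfn_def dfu_unit_def std_def)

lemma rep0: "dfn (\<lambda>_::unit. k) \<Longrightarrow> std k"
  by (simp add: dfn_unit)

lemma rep1: "dfn (\<lambda>c::unit \<times> _. F (snd c)) \<Longrightarrow> \<exists>f. std f \<and> (\<forall>x. f $ x = F x)"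
  unfolding dfn_prod dfn_unit by auto

lemma dfn_curry: "dfn F \<Longrightarrow> \<exists>G. dfn G \<and> (\<forall>c x. F (c, x) = G c $ x)" for F :: "'c::ctx \<times> 'a::srt \<Rightarrow> 'b::srt"
  by (simp add: dfn_prod)

lemma rep2:
  fixes F :: "'a::srt \<Rightarrow> 'b::srt \<Rightarrow> 'r::srt"
  assumes "dfn (\<lambda>c::(unit \<times> _) \<times> _. F (snd (fst c)) (snd c))"
  shows "\<exists>f. std f \<and> (\<forall>x y. f $ x $ y = F x y)"
proof -
  obtain G :: "unit \<times> 'a \<Rightarrow> 'b \<leadsto> 'r"
    where G: "dfn G" "\<And>c y. F (snd c) y = G c $ y" using dfn_curry[OF assms] by auto
  obtain g where "dfn g" "\<And>c x. G (c, x) = g c $ x" using dfn_curry[OF G(1)] by auto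
  then have "std (g ())" "\<And>x y. g () $ x $ y = F x y"
    using G(2)[of "((), _)"] by (simp_all add: dfn_unit)
  then show ?thesis by blast
qed

lemma rep3:
  fixes F :: "'a::srt \<Rightarrow> 'b::srt \<Rightarrow> 'd::srt \<Rightarrow> 'r::srt"
  assumes "dfn (\<lambda>c::((unit \<times> _) \<times> _) \<times> _. F (snd (fst (fst c))) (snd (fst c)) (snd c))"
  shows "\<exists>f. std f \<and> (\<forall>x y z. f $ x $ y $ z = F x y z)"
proof -
  obtain G :: "(unit \<times> 'a) \<times> 'b \<Rightarrow> 'd \<leadsto> 'r"
    where G: "dfn G" "\<And>c z. F (snd (fst c)) (snd c) z = G c $ z" using dfn_curry[OF assms] by auto
  have "dfn (\<lambda>c::(unit \<times> _) \<times> _. (\<lambda>x y. G (((), x), y)) (snd (fst c)) (snd c))"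
  proof -
    have "(\<lambda>c. G (((), snd (fst c)), snd c)) = G" by (simp add: fun_eq_iff)
    then show ?thesis using G(1) by simp
  qed
  from rep2[OF this] obtain f where "std f" "\<And>x y. f $ x $ y = G (((), x), y)" by auto
  then show ?thesis using G(2)[of "(((), _), _)"] by auto
qed

end

section \<open>Arithmetic\<close>

definition zN :: nn where "zN = cl (scon GM ZeroC)"
definition sN :: "nn \<leadsto> nn" where "sN = cl (scon GM SuccC)"
definition recN :: "nn \<leadsto> nn \<leadsto> (nn \<leadsto> nn \<leadsto> nn) \<leadsto> nn" where "recN = cl (scon GM RecC)"
definition addN :: "nn \<leadsto> nn \<leadsto> nn" where "addN = cl (cval GM add_c)"
definition mulN :: "nn \<leadsto> nn \<leadsto> nn" where "mulN = cl (cval GM mult_c)"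
definition predN :: "nn \<leadsto> nn" where "predN = cl (cval GM pred_c)"
definition subN :: "nn \<leadsto> nn \<leadsto> nn" where "subN = cl (cval GM monus_c)"
definition powN :: "nn \<leadsto> nn" where "powN = cl (cval GM pow2_c)"
definition triN :: "nn \<leadsto> nn" where "triN = cl (cval GM tri_c)"
definition lenS :: "'a::srt sq \<leadsto> nn" where "lenS = cl (scon GM (LenC (srt TYPE('a))))"
definition projS :: "'a::srt sq \<leadsto> nn \<leadsto> 'a" where "projS = cl (scon GM (ProjC (srt TYPE('a))))"

context gmodel
begin

lemma rp_sdom_simps [simp]:
  "rp (n::nn) \<in> sdom GM N0"
  "srt TYPE('a) = \<sigma> \<Longrightarrow> srt TYPE('b) = \<tau> \<Longrightarrow> rp (f::'a::srt \<leadsto> 'b::srt) \<in> sdom GM (\<sigma> \<Rrightarrow> \<tau>)"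
  "srt TYPE('a) = \<sigma> \<Longrightarrow> rp (s::'a::srt sq) \<in> sdom GM (Seq \<sigma>)"
  using rp_sdom[of n] rp_sdom[of f] rp_sdom[of s] by auto

lemma sdom_range: "srt TYPE('a::srt) = \<sigma> \<Longrightarrow> sdom GM \<sigma> = range (rp :: 'a \<Rightarrow> tm)"
  using carr_cases[where 'a='a] rp_sdom[where 'a='a] by (auto simp: image_iff)

lemma con_const:
  assumes "k = cl (scon GM c)" "con_ok (dom D) c" "con_ty c = srt TYPE('a)"
  shows "rp (k::'a::srt) = scon GM c" "std k"
  using closed_const[of k "Con c"] assms by (auto simp: cval_def)

lemma rp_consts:
  "scon GM ZeroC = rp zN" "scon GM SuccC = rp sN" "scon GM RecC = rp recN"
  "cval GM add_c = rp addN" "cval GM mult_c = rp mulN" "cval GM pred_c = rp predN"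
  "cval GM monus_c = rp subN" "cval GM pow2_c = rp powN" "cval GM tri_c = rp triN"
  "scon GM (LenC (srt TYPE('a))) = rp (lenS :: 'a::srt sq \<leadsto> nn)"
  "scon GM (ProjC (srt TYPE('a))) = rp (projS :: 'a::srt sq \<leadsto> nn \<leadsto> 'a)"
  using con_const(1)[OF zN_def] con_const(1)[OF sN_def] con_const(1)[OF recN_def]
    closed_const(1)[OF addN_def] closed_const(1)[OF mulN_def] closed_const(1)[OF predN_def]
    closed_const(1)[OF subN_def] closed_const(1)[OF powN_def] closed_const(1)[OF triN_def]
    con_const(1)[OF lenS_def[where 'a='a]] con_const(1)[OF projS_def[where 'a='a]] by auto

lemma std_consts:
  "std zN" "std sN" "std recN" "std addN" "std mulN" "std predN" "std subN" "std powN" "std triN"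
  "std (lenS :: 'a::srt sq \<leadsto> nn)" "std (projS :: 'a::srt sq \<leadsto> nn \<leadsto> 'a)"
  using con_const(2)[OF zN_def] con_const(2)[OF sN_def] con_const(2)[OF recN_def]
    closed_const(2)[OF addN_def] closed_const(2)[OF mulN_def] closed_const(2)[OF predN_def]
    closed_const(2)[OF subN_def] closed_const(2)[OF powN_def] closed_const(2)[OF triN_def]
    con_const(2)[OF lenS_def[where 'a='a]] con_const(2)[OF projS_def[where 'a='a]] by auto

lemmas dfn_consts [dfn_intros] = std_consts[THEN dfn_const]

lemmas sem = rp_consts rp_app[symmetric]

abbreviation (input) nS :: "nn \<Rightarrow> nn" where "nS n \<equiv> sN $ n"

lemma S_nonzero: "nS n \<noteq> zN"
proof -
  obtain e where "typed_env GM e" using env_ex ..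
  then have e: "typed_env GM (e((0, N0) := rp n))" by (simp add: typed_env_upd)
  show ?thesis using ax[OF base[OF succ_nonzero] _ e] by (simp add: sem)
qed

lemma rec_eqs: "recN $ zN $ a $ f = a" "recN $ (nS n) $ a $ f = f $ (recN $ n $ a $ f) $ n"
proof -
  obtain e where "typed_env GM e" using env_ex ..
  then have e: "typed_env GM (e((0, N0) := rp n, (1, N0) := rp a, (2, N0 \<Rrightarrow> N0 \<Rrightarrow> N0) := rp f))"
    by (simp add: typed_env_upd)
  show "recN $ zN $ a $ f = a" using ax[OF base[OF rec_zero[OF refl refl]] _ e] by (simp add: sem)
  show "recN $ (nS n) $ a $ f = f $ (recN $ n $ a $ f) $ n"
    using ax[OF base[OF rec_succ[OF refl refl refl]] _ e] by (simp add: sem)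
qed

text \<open>A disjunction of two equations suffices until characteristic functions are available:
  the predecessor dichotomy and the totality of the order have this shape.\<close>

lemma induct_raw:
  fixes f g h k :: "nn \<leadsto> nn"
  assumes "f $ zN = g $ zN \<or> h $ zN = k $ zN"
    and "\<And>n. f $ n = g $ n \<or> h $ n = k $ n \<Longrightarrow> f $ (nS n) = g $ (nS n) \<or> h $ (nS n) = k $ (nS n)"
  shows "f $ n = g $ n \<or> h $ n = k $ n"
proof -
  let ?\<phi> = "Disj (Eq (Var (1, T1) \<cdot> var0 0) (Var (2, T1) \<cdot> var0 0)) (Eq (Var (3, T1) \<cdot> var0 0) (Var (4, T1) \<cdot> var0 0))"
  define P where "P n \<longleftrightarrow> f $ n = g $ n \<or> h $ n = k $ n" for n
  obtain e0 where "typed_env GM e0" using env_ex ..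
  define e where "e = e0((1, T1) := rp f, (2, T1) := rp g, (3, T1) := rp h, (4, T1) := rp k)"
  have e: "typed_env GM e" unfolding e_def using \<open>typed_env GM e0\<close> by (simp add: typed_env_upd)
  have P: "sat GM (subst (0, N0) zero ?\<phi>) e = P zN"
    "sat GM ?\<phi> (e((0, N0) := rp n)) = P n"
    "sat GM (subst (0, N0) (succ (var0 0)) ?\<phi>) (e((0, N0) := rp n)) = P (nS n)" for n
    by (simp_all add: sem P_def e_def disj_imp)
  have unfold: "sat GM (Imp (Conj \<alpha> (All (0, N0) (Imp \<phi> \<beta>))) (All (0, N0) \<phi>)) e \<longleftrightarrow>
    sat GM \<alpha> e \<and> (\<forall>n::nn. sat GM \<phi> (e((0, N0) := rp n)) \<longrightarrow> sat GM \<beta> (e((0, N0) := rp n))) \<longrightarrow>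
    (\<forall>n::nn. sat GM \<phi> (e((0, N0) := rp n)))" for \<alpha> \<beta> \<phi>
    by (auto simp: sdom_range[where 'a=nn])
  have "sat GM (Imp (Conj (subst (0, N0) zero ?\<phi>)
      (All (0, N0) (Imp ?\<phi> (subst (0, N0) (succ (var0 0)) ?\<phi>)))) (All (0, N0) ?\<phi>)) e"
    by (rule ax[OF base[OF qf_induction] _ e]) auto
  then have "P zN \<and> (\<forall>n. P n \<longrightarrow> P (nS n)) \<longrightarrow> (\<forall>n. P n)"
    unfolding unfold P .
  then show ?thesis using assms unfolding P_def by blast
qed

lemma induct_disj:
  fixes F G H K :: "'c::ctx \<Rightarrow> nn \<Rightarrow> nn"
  assumes "dfn (\<lambda>d. F (fst d) (snd d))" "dfn (\<lambda>d. G (fst d) (snd d))"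
    "dfn (\<lambda>d. H (fst d) (snd d))" "dfn (\<lambda>d. K (fst d) (snd d))"
    and "F c zN = G c zN \<or> H c zN = K c zN"
    and "\<And>n. F c n = G c n \<or> H c n = K c n \<Longrightarrow> F c (nS n) = G c (nS n) \<or> H c (nS n) = K c (nS n)"
  shows "F c n = G c n \<or> H c n = K c n"
  using induct_raw[of "\<Lambda> n. F c n" "\<Lambda> n. G c n" "\<Lambda> n. H c n" "\<Lambda> n. K c n"] assms
  by (simp add: beta)

lemma induct_eq:
  fixes F G :: "'c::ctx \<Rightarrow> nn \<Rightarrow> nn"
  assumes "dfn (\<lambda>d. F (fst d) (snd d))" "dfn (\<lambda>d. G (fst d) (snd d))"
    and "F c zN = G c zN" and "\<And>n. F c n = G c n \<Longrightarrow> F c (nS n) = G c (nS n)"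
  shows "F c n = G c n"
  using induct_disj[OF assms(1,2,1,2)] assms(3,4) by blast

lemma lam_rec:
  assumes "typed_env GM e" "wft (dom D) t" "ty_of t = N0"
  shows "\<exists>g::nn \<leadsto> nn \<leadsto> nn. val GM e (lam0 2 (lam0 3 t)) = rp g \<and>
    (\<forall>m k. rp (g $ m $ k) = val GM (e((2, N0) := rp m, (3, N0) := rp k)) t)"
proof -
  have w: "wft (dom D) (lam0 2 (lam0 3 t))" using assms wft_lam by blast
  have "val GM e (lam0 2 (lam0 3 t)) \<in> carr (srt TYPE(nn \<leadsto> nn \<leadsto> nn))"
    using val_typed[OF typed assms(1) w] assms by simp
  then obtain g :: "nn \<leadsto> nn \<leadsto> nn" where g: "val GM e (lam0 2 (lam0 3 t)) = rp g"
    using carr_cases by blast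
  have "rp (g $ m $ k) = val GM (e((2, N0) := rp m, (3, N0) := rp k)) t" for m k
    using assms wft_lam by (simp add: rp_app g[symmetric] val_lam typed_env_upd del: lam.simps)
  then show ?thesis using g by blast
qed

lemma lam_rec':
  assumes "typed_env GM e" "wft (dom D) t" "ty_of t = N0" "tvars t \<subseteq> {(0, N0), (2, N0), (3, N0)}"
    and "e (0, N0) = rp (a::nn)"
  shows "\<exists>g::nn \<leadsto> nn \<leadsto> nn. val GM e (lam0 2 (lam0 3 t)) = rp g \<and>
    (\<forall>m k. rp (g $ m $ k) = val GM (\<lambda>x. if x = (2, N0) then rp m else if x = (3, N0) then rp k else rp a) t)"
proof -
  have "val GM (e((2, N0) := rp m, (3, N0) := rp k)) t =
    val GM (\<lambda>x. if x = (2, N0) then rp m else if x = (3, N0) then rp k else rp a) t" for m k :: nn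
    by (rule val_cong) (use assms in auto)
  then show ?thesis using lam_rec[OF assms(1-3)] by simp
qed

text \<open>The value of a closed arithmetical head is read off as a call of the recursor, with a
  step functional that is known through its values only.\<close>

lemma unary_rec:
  fixes A n :: nn
  assumes F: "rp F = cval GM (lam0 0 (rec0 (var0 0) r (lam0 2 (lam0 3 t))))"
    and r: "tvars r = {}" "wft (dom D) r" "ty_of r = N0" "cval GM r = rp A"
    and t: "wft (dom D) t" "ty_of t = N0" "tvars t \<subseteq> {(0, N0), (2, N0), (3, N0)}"
  shows "\<exists>g :: nn \<leadsto> nn \<leadsto> nn. F $ n = recN $ n $ A $ g \<and>
    (\<forall>m k. rp (g $ m $ k) = val GM (\<lambda>x. if x = (2, N0) then rp m else if x = (3, N0) then rp k else rp n) t)"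
proof -
  obtain e where e: "typed_env GM e" using env_ex ..
  let ?T = "lam0 2 (lam0 3 t)"
  have en: "typed_env GM (e((0, N0) := rp n))" using e by (simp add: typed_env_upd)
  obtain g :: "nn \<leadsto> nn \<leadsto> nn" where g: "val GM (e((0, N0) := rp n)) ?T = rp g"
    "\<forall>m k. rp (g $ m $ k) = val GM (\<lambda>x. if x = (2, N0) then rp m else if x = (3, N0) then rp k else rp n) t"
    using lam_rec'[OF en t, of n] by auto
  have w: "wft (dom D) (rec0 (var0 0) r ?T)" using r t wft_lam by (auto simp del: lam.simps)
  have "rp F = val GM e (lam0 0 (rec0 (var0 0) r ?T))"
    unfolding F by (rule val_closed[symmetric]) (use r t in \<open>auto simp del: lam.simps\<close>)
  then have "rp (F $ n) = val GM (e((0, N0) := rp n)) (rec0 (var0 0) r ?T)"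
    using val_lam[OF e w, of "rp n" "(0, N0)"] by (simp add: rp_app del: lam.simps)
  then have "rp (F $ n) = rp (recN $ n $ A $ g)" using g r by (simp add: sem val_closed del: lam.simps)
  then show ?thesis using g by auto
qed

lemma binary_rec:
  fixes A a n :: nn
  assumes F: "rp F = cval GM (lam0 0 (lam0 1 (rec0 (var0 1) r (lam0 2 (lam0 3 t)))))"
    and r: "tvars r \<subseteq> {(0, N0)}" "wft (dom D) r" "ty_of r = N0" "val GM (\<lambda>_. rp a) r = rp A"
    and t: "wft (dom D) t" "ty_of t = N0" "tvars t \<subseteq> {(0, N0), (2, N0), (3, N0)}"
  shows "\<exists>g :: nn \<leadsto> nn \<leadsto> nn. F $ a $ n = recN $ n $ A $ g \<and>
    (\<forall>m k. rp (g $ m $ k) = val GM (\<lambda>x. if x = (2, N0) then rp m else if x = (3, N0) then rp k else rp a) t)"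
proof -
  obtain e where e: "typed_env GM e" using env_ex ..
  let ?T = "lam0 2 (lam0 3 t)" and ?e = "e((0, N0) := rp a, (1, N0) := rp n)"
  have ea: "typed_env GM (e((0, N0) := rp a))" and en: "typed_env GM ?e"
    using e by (simp_all add: typed_env_upd)
  obtain g :: "nn \<leadsto> nn \<leadsto> nn" where g: "val GM ?e ?T = rp g"
    "\<forall>m k. rp (g $ m $ k) = val GM (\<lambda>x. if x = (2, N0) then rp m else if x = (3, N0) then rp k else rp a) t"
    using lam_rec'[OF en t, of a] by auto
  have w: "wft (dom D) (rec0 (var0 1) r ?T)" using r t wft_lam by (auto simp del: lam.simps)
  then have w1: "wft (dom D) (lam0 1 (rec0 (var0 1) r ?T))" by (rule wft_lam)
  have "rp F = val GM e (lam0 0 (lam0 1 (rec0 (var0 1) r ?T)))"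
    unfolding F by (rule val_closed[symmetric]) (use r t in \<open>auto simp del: lam.simps\<close>)
  then have "rp (F $ a $ n) = val GM ?e (rec0 (var0 1) r ?T)"
    using val_lam[OF e w1, of "rp a" "(0, N0)"] val_lam[OF ea w, of "rp n" "(1, N0)"]
    by (simp add: rp_app del: lam.simps)
  moreover have "val GM ?e r = rp A" unfolding r(4)[symmetric] by (rule val_cong) (use r in auto)
  ultimately have "rp (F $ a $ n) = rp (recN $ n $ A $ g)" using g by (simp add: sem del: lam.simps)
  then show ?thesis using g by auto
qed

text \<open>The step functional was obtained separately for each argument; extensionality identifies
  the ones belonging to \<open>n\<close> and to its successor.\<close>

lemma rec_unique:
  fixes F :: "nn \<Rightarrow> nn" and G :: "nn \<Rightarrow> nn \<Rightarrow> nn"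
  assumes "\<And>n. \<exists>g. F n = recN $ n $ A $ g \<and> (\<forall>m k. g $ m $ k = G m k)"
  shows "F zN = A" "F (nS n) = G (F n) n"
proof -
  show "F zN = A" using assms[of zN] by (auto simp: rec_eqs)
  obtain g g' where g: "F n = recN $ n $ A $ g" "\<And>m k. g $ m $ k = G m k"
    and g': "F (nS n) = recN $ (nS n) $ A $ g'" "\<And>m k. g' $ m $ k = G m k"
    using assms[of n] assms[of "nS n"] by auto
  have "g = g'" using g g' by (intro ext) simp
  then show "F (nS n) = G (F n) n" using g g' by (simp add: rec_eqs)
qed

section \<open>Recursion equations of the arithmetical functions\<close>

lemma add_eqs: "addN $ a $ zN = a" "addN $ a $ (nS b) = nS (addN $ a $ b)"
proof -
  have "\<exists>g. addN $ a $ n = recN $ n $ a $ g \<and> (\<forall>m k. g $ m $ k = nS m)" for n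
    using binary_rec[OF rp_consts(4)[unfolded add_c_def, symmetric], where a=a and A=a and n=n]
    by (simp add: sem del: lam.simps)
  then show "addN $ a $ zN = a" "addN $ a $ (nS b) = nS (addN $ a $ b)"
    using rec_unique[where F="\<lambda>n. addN $ a $ n" and A=a and G="\<lambda>m k. nS m"] by auto
qed

lemma mul_eqs: "mulN $ a $ zN = zN" "mulN $ a $ (nS b) = addN $ (mulN $ a $ b) $ a"
proof -
  have "\<exists>g. mulN $ a $ n = recN $ n $ zN $ g \<and> (\<forall>m k. g $ m $ k = addN $ m $ a)" for n
    using binary_rec[OF rp_consts(5)[unfolded mult_c_def, symmetric], where a=a and A=zN and n=n]
    by (simp add: add_def val_closed sem del: lam.simps)
  then show "mulN $ a $ zN = zN" "mulN $ a $ (nS b) = addN $ (mulN $ a $ b) $ a"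
    using rec_unique[where F="\<lambda>n. mulN $ a $ n" and A=zN and G="\<lambda>m k. addN $ m $ a"] by auto
qed

lemma pred_eqs: "predN $ zN = zN" "predN $ (nS b) = b"
proof -
  have "\<exists>g. predN $ n = recN $ n $ zN $ g \<and> (\<forall>m k. g $ m $ k = k)" for n
    using unary_rec[OF rp_consts(6)[unfolded pred_c_def, symmetric], where A=zN and n=n]
    by (simp add: cval_def[of _ zero] sem del: lam.simps)
  then show "predN $ zN = zN" "predN $ (nS b) = b"
    using rec_unique[where F="\<lambda>n. predN $ n" and A=zN and G="\<lambda>m k. k"] by auto
qed

lemma sub_eqs: "subN $ a $ zN = a" "subN $ a $ (nS b) = predN $ (subN $ a $ b)"
proof -
  have "\<exists>g. subN $ a $ n = recN $ n $ a $ g \<and> (\<forall>m k. g $ m $ k = predN $ m)" for n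
    using binary_rec[OF rp_consts(7)[unfolded monus_c_def, symmetric], where a=a and A=a and n=n]
    by (simp add: val_closed sem del: lam.simps)
  then show "subN $ a $ zN = a" "subN $ a $ (nS b) = predN $ (subN $ a $ b)"
    using rec_unique[where F="\<lambda>n. subN $ a $ n" and A=a and G="\<lambda>m k. predN $ m"] by auto
qed

lemma pow_eqs: "powN $ zN = nS zN" "powN $ (nS b) = addN $ (powN $ b) $ (powN $ b)"
proof -
  have "\<exists>g. powN $ n = recN $ n $ (nS zN) $ g \<and> (\<forall>m k. g $ m $ k = addN $ m $ m)" for n
    using unary_rec[OF rp_consts(8)[unfolded pow2_c_def, symmetric], where A="nS zN" and n=n]
    by (simp add: cval_def[of _ "succ zero"] add_def val_closed sem del: lam.simps)
  then show "powN $ zN = nS zN" "powN $ (nS b) = addN $ (powN $ b) $ (powN $ b)"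
    using rec_unique[where F="\<lambda>n. powN $ n" and A="nS zN" and G="\<lambda>m k. addN $ m $ m"] by auto
qed

lemma tri_eqs: "triN $ zN = zN" "triN $ (nS b) = addN $ (triN $ b) $ (nS b)"
proof -
  have "\<exists>g. triN $ n = recN $ n $ zN $ g \<and> (\<forall>m k. g $ m $ k = addN $ m $ (nS k))" for n
    using unary_rec[OF rp_consts(9)[unfolded tri_c_def, symmetric], where A=zN and n=n]
    by (simp add: cval_def[of _ zero] add_def val_closed sem del: lam.simps)
  then show "triN $ zN = zN" "triN $ (nS b) = addN $ (triN $ b) $ (nS b)"
    using rec_unique[where F="\<lambda>n. triN $ n" and A=zN and G="\<lambda>m k. addN $ m $ (nS k)"] by auto
qed

lemma dfn_induct_eq:
  fixes F G :: "nn \<Rightarrow> nn"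
  assumes "dfn (\<lambda>c::unit \<times> nn. F (snd c))" "dfn (\<lambda>c::unit \<times> nn. G (snd c))"
    and "F zN = G zN" and "\<And>n. F n = G n \<Longrightarrow> F (nS n) = G (nS n)"
  shows "F n = G n"
  using induct_eq[of "\<lambda>_. F" "\<lambda>_. G" "()" n] assms by simp

section \<open>Algebra of the numbers, by induction on equations\<close>

lemma zero_add: "addN $ zN $ b = b"
  by (rule dfn_induct_eq[of "\<lambda>b. addN $ zN $ b"]; (intro dfn_intros)?) (simp_all add: add_eqs)

lemma S_add: "addN $ (nS a) $ b = nS (addN $ a $ b)"
  by (rule induct_eq[of "\<lambda>c b. addN $ (nS (snd c)) $ b" "\<lambda>c b. nS (addN $ (snd c) $ b)" "((), a)", simplified];
      (intro dfn_intros)?) (simp_all add: add_eqs)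

lemma add_comm: "addN $ a $ b = addN $ b $ a"
  by (rule induct_eq[of "\<lambda>c b. addN $ (snd c) $ b" "\<lambda>c b. addN $ b $ (snd c)" "((), a)", simplified];
      (intro dfn_intros)?) (simp_all add: add_eqs zero_add S_add)

lemma add_assoc: "addN $ (addN $ a $ b) $ c = addN $ a $ (addN $ b $ c)"
  by (rule induct_eq[of "\<lambda>c x. addN $ (addN $ (snd (fst c)) $ (snd c)) $ x"
        "\<lambda>c x. addN $ (snd (fst c)) $ (addN $ (snd c) $ x)" "(((), a), b)", simplified];
      (intro dfn_intros)?) (simp_all add: add_eqs)

lemma add_left_comm: "addN $ a $ (addN $ b $ c) = addN $ b $ (addN $ a $ c)"
  using add_assoc add_comm by metis

lemmas add_ac = add_assoc add_comm add_left_comm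

lemma zero_mul: "mulN $ zN $ b = zN"
  by (rule dfn_induct_eq[of "\<lambda>b. mulN $ zN $ b"]; (intro dfn_intros)?) (simp_all add: add_eqs mul_eqs)

lemma S_mul: "mulN $ (nS a) $ b = addN $ (mulN $ a $ b) $ b"
  by (rule induct_eq[of "\<lambda>c b. mulN $ (nS (snd c)) $ b" "\<lambda>c b. addN $ (mulN $ (snd c) $ b) $ b" "((), a)", simplified];
      (intro dfn_intros)?) (simp_all add: add_eqs mul_eqs add_ac S_add)

lemma mul_comm: "mulN $ a $ b = mulN $ b $ a"
  by (rule induct_eq[of "\<lambda>c b. mulN $ (snd c) $ b" "\<lambda>c b. mulN $ b $ (snd c)" "((), a)", simplified];
      (intro dfn_intros)?) (simp_all add: mul_eqs zero_mul S_mul)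

lemma mul_add: "mulN $ (addN $ a $ b) $ c = addN $ (mulN $ a $ c) $ (mulN $ b $ c)"
  by (rule induct_eq[of "\<lambda>c x. mulN $ (addN $ (snd (fst c)) $ (snd c)) $ x"
        "\<lambda>c x. addN $ (mulN $ (snd (fst c)) $ x) $ (mulN $ (snd c) $ x)" "(((), a), b)", simplified];
      (intro dfn_intros)?) (simp_all add: add_eqs mul_eqs add_ac)

lemma mul_add_left: "mulN $ c $ (addN $ a $ b) = addN $ (mulN $ c $ a) $ (mulN $ c $ b)"
  using mul_add mul_comm by metis

lemma mul_assoc: "mulN $ (mulN $ a $ b) $ c = mulN $ a $ (mulN $ b $ c)"
  by (rule induct_eq[of "\<lambda>c x. mulN $ (mulN $ (snd (fst c)) $ (snd c)) $ x"
        "\<lambda>c x. mulN $ (snd (fst c)) $ (mulN $ (snd c) $ x)" "(((), a), b)", simplified];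
      (intro dfn_intros)?) (simp_all add: mul_eqs mul_add_left)

lemma sub_S_S: "subN $ (nS a) $ (nS b) = subN $ a $ b"
  by (rule induct_eq[of "\<lambda>c b. subN $ (nS (snd c)) $ (nS b)" "\<lambda>c b. subN $ (snd c) $ b" "((), a)", simplified];
      (intro dfn_intros)?) (simp_all add: sub_eqs pred_eqs)

lemma zero_sub: "subN $ zN $ b = zN"
  by (rule dfn_induct_eq[of "\<lambda>b. subN $ zN $ b"]; (intro dfn_intros)?) (simp_all add: sub_eqs pred_eqs)

text \<open>The truncated difference inverts addition; cancellation comes from here.\<close>

lemma add_sub: "subN $ (addN $ a $ b) $ b = a"
  by (rule induct_eq[of "\<lambda>c b. subN $ (addN $ (snd c) $ b) $ b" "\<lambda>c b. snd c" "((), a)", simplified];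
      (intro dfn_intros)?) (simp_all add: add_eqs sub_eqs(1) sub_S_S)

lemma sub_add: "subN $ a $ (addN $ b $ c) = subN $ (subN $ a $ b) $ c"
  by (rule induct_eq[of "\<lambda>c x. subN $ (snd (fst c)) $ (addN $ (snd c) $ x)"
        "\<lambda>c x. subN $ (subN $ (snd (fst c)) $ (snd c)) $ x" "(((), a), b)", simplified];
      (intro dfn_intros)?) (simp_all add: add_eqs sub_eqs)

lemma zero_or_S: "n = zN \<or> n = nS (predN $ n)"
  by (rule induct_disj[of "\<lambda>c n. n" "\<lambda>c n. zN" "\<lambda>c n. n" "\<lambda>c n. nS (predN $ n)" "()"]; (intro dfn_intros)?)
    (simp_all add: pred_eqs)

lemma add_sub_total: "addN $ a $ (subN $ b $ a) = b \<or> addN $ b $ (subN $ a $ b) = a"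
proof (rule induct_disj[of "\<lambda>c b. addN $ (snd c) $ (subN $ b $ (snd c))" "\<lambda>c b. b"
      "\<lambda>c b. addN $ b $ (subN $ (snd c) $ b)" "\<lambda>c b. snd c" "((), a)", simplified]; (intro dfn_intros)?)
  show "addN $ a $ (subN $ zN $ a) = zN \<or> addN $ zN $ (subN $ a $ zN) = a" by (simp add: zero_add sub_eqs)
  fix b assume "addN $ a $ (subN $ b $ a) = b \<or> addN $ b $ (subN $ a $ b) = a"
  then show "addN $ a $ (subN $ (nS b) $ a) = nS b \<or> addN $ (nS b) $ (subN $ a $ (nS b)) = a"
  proof
    assume 1: "addN $ a $ (subN $ b $ a) = b"
    then have 2: "nS b = addN $ a $ (nS (subN $ b $ a))" by (simp add: add_eqs)
    then have "subN $ (nS b) $ a = nS (subN $ b $ a)" using add_sub[of "nS (subN $ b $ a)" a] by (simp add: add_comm)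
    then show ?thesis using 2 by simp
  next
    assume 1: "addN $ b $ (subN $ a $ b) = a"
    show ?thesis
    proof (cases "subN $ a $ b = zN")
      \<comment> \<open>This is where the inequality changes sides: the difference has run out, so
        \<open>a = b\<close>, and the first disjunct takes over for the successor.\<close>
      case True
      then have "a = b" using 1 by (simp add: add_eqs)
      moreover have "subN $ (nS b) $ b = nS zN" using add_sub[of "nS zN" b] by (simp add: add_eqs S_add zero_add)
      ultimately show ?thesis by (simp add: add_eqs)
    next
      case False
      then have "subN $ a $ b = nS (predN $ (subN $ a $ b))" using zero_or_S by blast
      then have "addN $ (nS b) $ (predN $ (subN $ a $ b)) = a"
        using 1 by (metis S_add add_eqs(2))
      then show ?thesis by (simp add: sub_eqs)
    qed
  qed
qed

lemma sub_zero_iff: "subN $ a $ b = zN \<longleftrightarrow> (\<exists>d. addN $ a $ d = b)"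
proof
  assume z: "subN $ a $ b = zN"
  then have "addN $ b $ (subN $ a $ b) = b" by (simp add: add_eqs)
  then show "\<exists>d. addN $ a $ d = b" using add_sub_total[of a b] by (metis add_comm z add_eqs(1))
next
  assume "\<exists>d. addN $ a $ d = b"
  then obtain d where "b = addN $ a $ d" by auto
  moreover have "subN $ a $ a = zN" using add_sub[of zN a] by (simp add: zero_add)
  ultimately show "subN $ a $ b = zN" by (simp add: sub_add zero_sub)
qed

end

section \<open>The ordered field of fractions of the numbers of the model\<close>

definition genuine :: bool where "genuine \<longleftrightarrow> (\<exists>D. omega_model D GM)"

text \<open>The non-negative part of a discretely ordered integral domain, stated for an arbitrary
  tuple of operations. Class instances cannot be conditional, so such a tuple must exist even when
  \<open>GM\<close> is no model.\<close>

definition nn_laws :: "nn \<times> nn \<times> (nn \<Rightarrow> nn \<Rightarrow> nn) \<times> (nn \<Rightarrow> nn \<Rightarrow> nn) \<Rightarrow> bool" where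
  "nn_laws = (\<lambda>(z, u, p, t).
     (\<forall>a. p z a = a) \<and> (\<forall>a b. p a b = p b a) \<and> (\<forall>a b c. p (p a b) c = p a (p b c)) \<and>
     (\<forall>a b c. p a c = p b c \<longrightarrow> a = b) \<and> (\<forall>a b. p a b = z \<longrightarrow> a = z) \<and>
     (\<forall>a b. \<exists>d. p a d = b \<or> p b d = a) \<and> (\<forall>a. a = z \<or> (\<exists>b. a = p b u)) \<and>
     (\<forall>a b. t a b = t b a) \<and> (\<forall>a b c. t (t a b) c = t a (t b c)) \<and> (\<forall>a. t u a = a) \<and>
     (\<forall>a b c. t (p a b) c = p (t a c) (t b c)) \<and> (\<forall>a. t z a = z) \<and>
     (\<forall>a b. t a b = z \<longrightarrow> a = z \<or> b = z) \<and> z \<noteq> u)"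

lemma (in gmodel) nn_laws:
  "nn_laws (zN, nS zN, \<lambda>a b. addN $ a $ b, \<lambda>a b. mulN $ a $ b)"
proof -
  have cancel: "a = b" if "addN $ a $ c = addN $ b $ c" for a b c using that add_sub by metis
  have zero: "a = zN" if "addN $ a $ b = zN" for a b
    using that zero_or_S[of a] S_add S_nonzero by metis
  have total: "\<exists>d. addN $ a $ d = b \<or> addN $ b $ d = a" for a b using add_sub_total by blast
  have S: "a = zN \<or> (\<exists>b. a = addN $ b $ (nS zN))" for a
    using zero_or_S[of a] by (auto simp: add_eqs)
  have one: "mulN $ (nS zN) $ a = a" for a by (simp add: S_mul zero_mul zero_add)
  have dom: "a = zN \<or> b = zN" if "mulN $ a $ b = zN" for a b
    using that zero_or_S[of a] zero_or_S[of b] mul_eqs(2)[of a "predN $ b"] add_eqs(2) S_nonzero by metis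
  show ?thesis unfolding nn_laws_def prod.case
  proof (intro conjI allI impI)
    show "addN $ zN $ a = a" "mulN $ (nS zN) $ a = a" "mulN $ zN $ a = zN" for a
      by (rule zero_add one zero_mul)+
    show "addN $ a $ b = addN $ b $ a" "mulN $ a $ b = mulN $ b $ a" for a b
      by (rule add_comm mul_comm)+
    show "addN $ (addN $ a $ b) $ c = addN $ a $ (addN $ b $ c)"
      "mulN $ (mulN $ a $ b) $ c = mulN $ a $ (mulN $ b $ c)"
      "mulN $ (addN $ a $ b) $ c = addN $ (mulN $ a $ c) $ (mulN $ b $ c)" for a b c
      by (rule add_assoc mul_assoc mul_add)+
    show "a = zN \<or> (\<exists>b. a = addN $ b $ (nS zN))" for a by (rule S)
    show "\<exists>d. addN $ a $ d = b \<or> addN $ b $ d = a" for a b by (rule total)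
    show "addN $ a $ c = addN $ b $ c \<Longrightarrow> a = b" for a b c by (rule cancel)
    show "addN $ a $ b = zN \<Longrightarrow> a = zN" "mulN $ a $ b = zN \<Longrightarrow> a = zN \<or> b = zN" for a b
      by (rule zero dom, assumption)+
    show "zN \<noteq> nS zN" by (rule S_nonzero[symmetric])
  qed
qed

lemma nn_laws_nat:
  assumes "\<not> genuine"
  shows "\<exists>x. nn_laws x"
proof -
  define h :: "nat \<Rightarrow> nn" where "h n = Abs_nn (num n)" for n
  have carr: "carr N0 = range num" using assms by (auto simp: genuine_def carr_def)
  have num: "num m = num n \<longleftrightarrow> m = n" for m n
  proof (induction m arbitrary: n)
    case 0
    then show ?case by (cases n) auto
  next
    case (Suc m)
    then show ?case by (cases n) auto
  qed
  have inj: "h m = h n \<longleftrightarrow> m = n" for m n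
    using Abs_nn_inject[of "num m" "num n"] num by (auto simp: h_def carr)
  have surj: "\<exists>n. x = h n" for x
    using Abs_nn_cases[of x] by (auto simp: h_def carr)
  define g where "g = inv h"
  have gh: "g (h n) = n" for n using inj by (simp add: g_def inj_def)
  have all: "(\<forall>x. P x) \<longleftrightarrow> (\<forall>n. P (h n))" "(\<exists>x. P x) \<longleftrightarrow> (\<exists>n. P (h n))" for P
    using surj by metis+
  have "nn_laws (h 0, h 1, \<lambda>a b. h (g a + g b), \<lambda>a b. h (g a * g b))"
    unfolding nn_laws_def prod.case
    by (simp add: all gh inj algebra_simps) (metis Suc_eq_plus1 le_add_diff_inverse nat_le_linear not0_implies_Suc)
  then show ?thesis by blast
qed

definition nn_ops :: "nn \<times> nn \<times> (nn \<Rightarrow> nn \<Rightarrow> nn) \<times> (nn \<Rightarrow> nn \<Rightarrow> nn)" where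
  "nn_ops = (if genuine then (zN, sN $ zN, \<lambda>a b. addN $ a $ b, \<lambda>a b. mulN $ a $ b) else (SOME x. nn_laws x))"

lemma nn_laws_ops: "nn_laws nn_ops"
proof (cases genuine)
  case True
  then obtain D where "gmodel D" by (auto simp: genuine_def gmodel_def)
  then show ?thesis using True gmodel.nn_laws by (simp add: nn_ops_def)
next
  case False
  then show ?thesis using someI_ex[OF nn_laws_nat] by (simp add: nn_ops_def)
qed

instantiation nn :: "{zero, one, plus, times, minus, ord}"
begin
definition zero_nn :: nn where "(0::nn) = fst nn_ops"
definition one_nn :: nn where "(1::nn) = fst (snd nn_ops)"
definition plus_nn :: "nn \<Rightarrow> nn \<Rightarrow> nn" where "((+) :: nn \<Rightarrow> nn \<Rightarrow> nn) = fst (snd (snd nn_ops))"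
definition times_nn :: "nn \<Rightarrow> nn \<Rightarrow> nn" where "((*) :: nn \<Rightarrow> nn \<Rightarrow> nn) = snd (snd (snd nn_ops))"
definition less_eq_nn :: "nn \<Rightarrow> nn \<Rightarrow> bool" where "(a::nn) \<le> b \<longleftrightarrow> (\<exists>d. a + d = b)"
definition less_nn :: "nn \<Rightarrow> nn \<Rightarrow> bool" where "(a::nn) < b \<longleftrightarrow> \<not> b \<le> a"
definition minus_nn :: "nn \<Rightarrow> nn \<Rightarrow> nn" where "(a::nn) - b = (if b \<le> a then THE d. b + d = a else 0)"
instance ..
end

lemma nn_base:
  fixes a b c :: nn
  shows "0 + a = a" "a + b = b + a" "a + b + c = a + (b + c)" "a + c = b + c \<Longrightarrow> a = b"
    "a + b = 0 \<Longrightarrow> a = 0" "\<exists>d. a + d = b \<or> b + d = a" "a = 0 \<or> (\<exists>b. a = b + 1)"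
    "a * b = b * a" "a * b * c = a * (b * c)" "1 * a = a" "(a + b) * c = a * c + b * c" "0 * a = 0"
    "a * b = 0 \<Longrightarrow> a = 0 \<or> b = 0" "(0::nn) \<noteq> 1"
proof -
  obtain z u p t where ops: "nn_ops = (z, u, p, t)" by (cases nn_ops)
  note defs = zero_nn_def one_nn_def plus_nn_def times_nn_def ops fst_conv snd_conv
  note laws = nn_laws_ops[unfolded ops nn_laws_def prod.case]
  show "0 + a = a" unfolding defs
    by (rule laws[THEN conjunct1, rule_format])
  show "a + b = b + a" unfolding defs
    by (rule laws[THEN conjunct2, THEN conjunct1, rule_format])
  show "a + b + c = a + (b + c)" unfolding defs
    by (rule laws[THEN conjunct2, THEN conjunct2, THEN conjunct1, rule_format])
  show "a + c = b + c \<Longrightarrow> a = b" unfolding defs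
    by (rule laws[THEN conjunct2, THEN conjunct2, THEN conjunct2, THEN conjunct1, rule_format])
  show "a + b = 0 \<Longrightarrow> a = 0" unfolding defs
    by (rule laws[THEN conjunct2, THEN conjunct2, THEN conjunct2, THEN conjunct2, THEN conjunct1, rule_format])
  show "\<exists>d. a + d = b \<or> b + d = a" unfolding defs
    by (rule laws[THEN conjunct2, THEN conjunct2, THEN conjunct2, THEN conjunct2, THEN conjunct2, THEN conjunct1, rule_format])
  show "a = 0 \<or> (\<exists>b. a = b + 1)" unfolding defs
    by (rule laws[THEN conjunct2, THEN conjunct2, THEN conjunct2, THEN conjunct2, THEN conjunct2, THEN conjunct2, THEN conjunct1, rule_format])
  show "a * b = b * a" unfolding defs
    by (rule laws[THEN conjunct2, THEN conjunct2, THEN conjunct2, THEN conjunct2, THEN conjunct2, THEN conjunct2, THEN conjunct2, THEN conjunct1, rule_format])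
  show "a * b * c = a * (b * c)" unfolding defs
    by (rule laws[THEN conjunct2, THEN conjunct2, THEN conjunct2, THEN conjunct2, THEN conjunct2, THEN conjunct2, THEN conjunct2, THEN conjunct2, THEN conjunct1, rule_format])
  show "1 * a = a" unfolding defs
    by (rule laws[THEN conjunct2, THEN conjunct2, THEN conjunct2, THEN conjunct2, THEN conjunct2, THEN conjunct2, THEN conjunct2, THEN conjunct2, THEN conjunct2, THEN conjunct1, rule_format])
  show "(a + b) * c = a * c + b * c" unfolding defs
    by (rule laws[THEN conjunct2, THEN conjunct2, THEN conjunct2, THEN conjunct2, THEN conjunct2, THEN conjunct2, THEN conjunct2, THEN conjunct2, THEN conjunct2, THEN conjunct2, THEN conjunct1, rule_format])
  show "0 * a = 0" unfolding defs
    by (rule laws[THEN conjunct2, THEN conjunct2, THEN conjunct2, THEN conjunct2, THEN conjunct2, THEN conjunct2, THEN conjunct2, THEN conjunct2, THEN conjunct2, THEN conjunct2, THEN conjunct2, THEN conjunct1, rule_format])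
  show "a * b = 0 \<Longrightarrow> a = 0 \<or> b = 0" unfolding defs
    by (rule laws[THEN conjunct2, THEN conjunct2, THEN conjunct2, THEN conjunct2, THEN conjunct2, THEN conjunct2, THEN conjunct2, THEN conjunct2, THEN conjunct2, THEN conjunct2, THEN conjunct2, THEN conjunct2, THEN conjunct1, rule_format])
  show "(0::nn) \<noteq> 1" unfolding defs
    by (rule laws[THEN conjunct2, THEN conjunct2, THEN conjunct2, THEN conjunct2, THEN conjunct2, THEN conjunct2, THEN conjunct2, THEN conjunct2, THEN conjunct2, THEN conjunct2, THEN conjunct2, THEN conjunct2, THEN conjunct2, rule_format])
qed

instance nn :: comm_semiring_1
  by standard (rule nn_base(1-3,8-12,14) trans[OF nn_base(8) nn_base(12)])+

instance nn :: linorder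
proof
  fix a b c :: nn
  show refl: "a \<le> a" unfolding less_eq_nn_def by (metis nn_base(1,2))
  show "a \<le> b \<Longrightarrow> b \<le> c \<Longrightarrow> a \<le> c" unfolding less_eq_nn_def by (metis nn_base(3))
  show "a \<le> b \<or> b \<le> a" unfolding less_eq_nn_def using nn_base(6) by metis
  then show "a < b \<longleftrightarrow> a \<le> b \<and> \<not> b \<le> a" unfolding less_nn_def by blast
  show "a \<le> b \<Longrightarrow> b \<le> a \<Longrightarrow> a = b"
    unfolding less_eq_nn_def by (metis nn_base(1-5))
qed

lemma nn_le_iff: "a \<le> b \<longleftrightarrow> (\<exists>d. b = a + d)" for a b :: nn
  by (auto simp: less_eq_nn_def)

lemma nn_minus: "(a + b) - a = b" for a b :: nn
proof -
  have "(THE d. a + d = a + b) = b" by (rule the_equality) (use nn_base(2,4) in metis)+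
  then show ?thesis unfolding minus_nn_def using nn_le_iff[of a "a + b"] by auto
qed

instance nn :: linordered_semidom
proof
  fix a b c :: nn
  show "a + b - a = b" by (rule nn_minus)
  show "a - b - c = a - (b + c)"
  proof (cases "b + c \<le> a")
    case True
    then obtain d where "a = b + c + d" by (auto simp: nn_le_iff)
    then show ?thesis using nn_minus[of b "c + d"] nn_minus[of c d] nn_minus[of "b + c" d] by (simp add: add.assoc)
  next
    case False
    have "\<not> c \<le> a - b" if "b \<le> a" using False that by (auto simp: nn_le_iff nn_minus add.assoc)
    moreover have "c = 0" if "c \<le> 0" using that nn_base(5) by (metis nn_le_iff)
    then have "0 - c = 0" using nn_minus[of 0 0] by (auto simp: minus_nn_def)
    ultimately show ?thesis using False by (auto simp: minus_nn_def)
  qed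
  show "a \<le> b \<Longrightarrow> c + a \<le> c + b" by (auto simp: nn_le_iff add.assoc)
  show "(0::nn) < 1" using nn_base(5,14) unfolding less_nn_def nn_le_iff by metis
  show "a < b \<Longrightarrow> 0 < c \<Longrightarrow> c * a < c * b"
  proof -
    assume "a < b" "0 < c"
    then obtain d where d: "b = a + d" "d \<noteq> 0" "c \<noteq> 0"
      unfolding less_nn_def by (metis linear nn_le_iff add_0_right)
    have "\<not> c * b \<le> c * a"
    proof
      assume "c * b \<le> c * a"
      then obtain x where "c * a = c * a + (c * d + x)" using d by (auto simp: nn_le_iff distrib_left add.assoc)
      then have "c * d + x = 0" using nn_base(4)[of 0 "c * a" "c * d + x"] by (metis add.commute add_0)
      then show False using d nn_base(5,13) by metis
    qed
    then show ?thesis by (simp add: less_nn_def)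
  qed
  show "a - b + b = a" if "b \<le> a"
  proof -
    have "\<exists>d. a = b + d" using that by (simp only: nn_le_iff)
    then obtain d where d: "a = b + d" ..
    show ?thesis by (simp only: d nn_minus add.commute[of d b])
  qed
  show "a \<noteq> 0 \<Longrightarrow> b \<noteq> 0 \<Longrightarrow> a * b \<noteq> 0" using nn_base(13) by blast
  show "a * (b - c) = a * b - a * c"
  proof (cases "c \<le> b")
    case True
    then obtain d where "b = c + d" by (auto simp: nn_le_iff)
    then show ?thesis by (simp add: nn_minus distrib_left)
  next
    case False
    then obtain d where d: "c = b + d" by (metis linear nn_le_iff)
    have "a * b - a * c = 0"
    proof (cases "a * c \<le> a * b")
      case True
      then obtain x where "a * b = a * b + (a * d + x)" using d by (auto simp: nn_le_iff distrib_left add.assoc)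
      then have "a * d + x = 0" using nn_base(4)[of 0 "a * b" "a * d + x"] by (metis add.commute add_0)
      then have "a * b = a * c" using d nn_base(5) by (metis add.right_neutral distrib_left)
      then show ?thesis using nn_minus[of "a * b" 0] by simp
    qed (simp add: minus_nn_def)
    then show ?thesis using False by (simp add: minus_nn_def)
  qed
qed

lemma nn_less_iff: "a < b \<longleftrightarrow> a + 1 \<le> b" for a b :: nn
proof
  assume "a < b"
  then obtain d where "b = a + d" "d \<noteq> 0" by (metis less_le nn_le_iff add_0_right)
  then show "a + 1 \<le> b" using nn_base(7)[of d] by (auto simp: nn_le_iff ac_simps)
qed (metis add_strict_left_mono less_le_trans zero_less_one add.right_neutral)

lemma nn_nonneg [simp]: "0 \<le> (a::nn)" by (simp add: nn_le_iff)


text \<open>The ring of differences is formed for the sake of its fraction field: that is a linearly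
  ordered field, where \<open>linarith\<close> and \<open>field_simps\<close> can handle rationals
  with nonstandard numerators and denominators.\<close>

definition zrel :: "nn \<times> nn \<Rightarrow> nn \<times> nn \<Rightarrow> bool" where
  "zrel = (\<lambda>(a, b) (c, d). a + d = c + b)"

quotient_type zz = "nn \<times> nn" / zrel morphisms Rep_zz Abs_zz
proof (rule equivpI)
  show "reflp zrel" by (auto simp: reflp_def zrel_def)
  show "symp zrel" by (auto simp: symp_def zrel_def)
  show "transp zrel"
  proof (rule transpI)
    fix x y z :: "nn \<times> nn" assume "zrel x y" "zrel y z"
    moreover obtain a b c d e f where "x = (a, b)" "y = (c, d)" "z = (e, f)" by (metis surj_pair)
    ultimately have "a + d = c + b" "c + f = e + d" by (auto simp: zrel_def)
    then have "(a + f) + (c + d) = (e + b) + (c + d)" by (metis add.assoc add.commute)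
    then show "zrel x z" using \<open>x = _\<close> \<open>z = _\<close> by (simp add: zrel_def)
  qed
qed

instantiation zz :: comm_ring_1
begin

lift_definition zero_zz :: zz is "(0, 0)" .
lift_definition one_zz :: zz is "(1, 0)" .
lift_definition plus_zz :: "zz \<Rightarrow> zz \<Rightarrow> zz" is "\<lambda>(a, b) (c, d). (a + c, b + d)"
proof (clarsimp simp: zrel_def)
  fix a b c d a' b' c' d' :: nn
  assume "a + d = c + b" "a' + d' = c' + b'"
  then have "(a + d) + (a' + d') = (c + b) + (c' + b')" by simp
  then show "a + a' + (d + d') = c + c' + (b + b')" by (simp add: ac_simps)
qed
lift_definition uminus_zz :: "zz \<Rightarrow> zz" is "\<lambda>(a, b). (b, a)" by (auto simp: zrel_def ac_simps)
lift_definition minus_zz :: "zz \<Rightarrow> zz \<Rightarrow> zz" is "\<lambda>(a, b) (c, d). (a + d, b + c)"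
proof (clarsimp simp: zrel_def)
  fix a b c d a' b' c' d' :: nn
  assume "a + d = c + b" "a' + d' = c' + b'"
  then have "(a + d) + (c' + b') = (c + b) + (a' + d')" by simp
  then show "a + b' + (d + c') = c + d' + (b + a')" by (simp add: ac_simps)
qed
lift_definition times_zz :: "zz \<Rightarrow> zz \<Rightarrow> zz" is "\<lambda>(a, b) (c, d). (a * c + b * d, a * d + b * c)"
proof (clarsimp simp: zrel_def)
  fix a b c d a' b' c' d' :: nn
  assume 1: "a + d = c + b" and 2: "a' + d' = c' + b'"
  have "(a + d) * a' + (c + b) * b' + c * (a' + d') + d * (c' + b')
      = (c + b) * a' + (a + d) * b' + c * (c' + b') + d * (a' + d')"
    by (simp only: 1 2)
  then have "(a * a' + b * b' + (c * d' + d * c')) + (d * a' + c * b' + c * a' + d * b')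
      = (c * c' + d * d' + (a * b' + b * a')) + (d * a' + c * b' + c * a' + d * b')"
    by (simp only: distrib_left distrib_right ac_simps)
  then show "a * a' + b * b' + (c * d' + d * c') = c * c' + d * d' + (a * b' + b * a')"
    by (simp only: add_right_cancel)
qed

instance
  by standard (transfer; auto simp: zrel_def algebra_simps)+

end

lift_definition zd :: "nn \<Rightarrow> nn \<Rightarrow> zz" is Pair .

lemma zd_cases: obtains a b where "x = zd a b"
proof -
  obtain a b where "Rep_zz x = (a, b)" by (cases "Rep_zz x")
  then have "x = zd a b" using Quotient_abs_rep[OF Quotient_zz, of x] by (simp add: zd.abs_eq)
  then show thesis by (rule that)
qed

lemma zd_simps:
  "zd a b = zd c d \<longleftrightarrow> a + d = c + b" "0 = zd 0 0" "1 = zd 1 0" "zd a b + zd c d = zd (a + c) (b + d)"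
  "zd a b * zd c d = zd (a * c + b * d) (a * d + b * c)"
  by (transfer; simp add: zrel_def)+

instantiation zz :: linordered_idom
begin

lift_definition less_eq_zz :: "zz \<Rightarrow> zz \<Rightarrow> bool" is "\<lambda>(a, b) (c, d). a + d \<le> c + b"
proof (clarsimp simp: zrel_def)
  fix a b c d a' b' c' d' :: nn
  assume 1: "a + d = c + b" and 2: "a' + d' = c' + b'"
  have "a + b' \<le> a' + b \<longleftrightarrow> (a + b') + (d + d') \<le> (a' + b) + (d + d')"
    by (simp only: add_le_cancel_right)
  also have "(a + b') + (d + d') = (a + d) + (b' + d')" by (simp only: ac_simps)
  also have "\<dots> = (c + d') + (b + b')" unfolding 1 by (simp only: ac_simps)
  also have "(a' + b) + (d + d') = (a' + d') + (b + d)" by (simp only: ac_simps)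
  also have "\<dots> = (c' + d) + (b + b')" unfolding 2 by (simp only: ac_simps)
  finally show "a + b' \<le> a' + b \<longleftrightarrow> c + d' \<le> c' + d" by (simp only: add_le_cancel_right)
qed
definition less_zz :: "zz \<Rightarrow> zz \<Rightarrow> bool" where "less_zz x y \<longleftrightarrow> \<not> y \<le> x"
definition abs_zz :: "zz \<Rightarrow> zz" where "abs_zz x = (if x < 0 then - x else x)"
definition sgn_zz :: "zz \<Rightarrow> zz" where "sgn_zz x = (if x = 0 then 0 else if 0 < x then 1 else - 1)"

lemma zd_le: "zd a b \<le> zd c d \<longleftrightarrow> a + d \<le> c + b"
  by (simp add: zd.abs_eq less_eq_zz.abs_eq)

instance
proof
  fix x y z :: zz
  obtain a b c d e f where xyz: "x = zd a b" "y = zd c d" "z = zd e f" by (metis zd_cases)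
  show "x \<le> x" by (simp add: xyz zd_le)
  show "x \<le> z" if "x \<le> y" "y \<le> z"
  proof -
    have "(a + d) + (c + f) \<le> (c + b) + (e + d)"
      by (rule add_mono) (use that in \<open>simp_all add: xyz zd_le\<close>)
    then have "(a + f) + (c + d) \<le> (e + b) + (c + d)" by (simp only: ac_simps)
    then show ?thesis unfolding xyz zd_le by (rule add_le_imp_le_right)
  qed
  show "x = y" if "x \<le> y" "y \<le> x"
    using that unfolding xyz zd_le zd_simps by (rule antisym)
  show total: "x \<le> y \<or> y \<le> x" unfolding xyz zd_le by (rule linear)
  then show "x < y \<longleftrightarrow> x \<le> y \<and> \<not> y \<le> x" by (auto simp: less_zz_def)
  show "z + x \<le> z + y" if "x \<le> y"
  proof -
    have "(a + d) + (e + f) \<le> (c + b) + (e + f)" using that by (simp add: xyz zd_le)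
    then show ?thesis unfolding xyz zd_le zd_simps by (simp only: ac_simps)
  qed
  show "z * x < z * y" if "x < y" "0 < z"
  proof -
    have 1: "a + d < c + b" and 2: "f < e"
      using that unfolding xyz less_zz_def zd_simps(2) zd_le by (simp_all add: not_le)
    obtain u where u: "c + b = (a + d) + u" using 1 unfolding less_le nn_le_iff by blast
    obtain v where v: "e = f + v" using 2 unfolding less_le nn_le_iff by blast
    have "0 < u" "0 < v" using 1 2 u v by auto
    then have "0 < v * u" by simp
    have "e * c + f * d + (e * b + f * a) = e * (c + b) + f * (a + d)" by (simp add: algebra_simps)
    moreover have "e * a + f * b + (e * d + f * c) = e * (a + d) + f * (c + b)" by (simp add: algebra_simps)
    moreover have "e * (c + b) + f * (a + d) = (e * (a + d) + f * (c + b)) + v * u"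
      unfolding u v by (simp add: algebra_simps)
    ultimately have "\<not> e * c + f * d + (e * b + f * a) \<le> e * a + f * b + (e * d + f * c)"
      using \<open>0 < v * u\<close> by simp
    then show ?thesis unfolding xyz less_zz_def zd_simps zd_le by (simp add: ac_simps)
  qed
  show "\<bar>x\<bar> = (if x < 0 then - x else x)" by (rule abs_zz_def)
  show "sgn x = (if x = 0 then 0 else if 0 < x then 1 else - 1)" by (rule sgn_zz_def)
qed

end

type_synonym qq = "zz fract"

definition q :: "nn \<Rightarrow> qq" where "q a = Fract (zd a 0) 1"

lemma q_simps [simp]: "q 0 = 0" "q 1 = 1" "q (a + b) = q a + q b" "q (a * b) = q a * q b"
  "q a \<le> q b \<longleftrightarrow> a \<le> b" "q a < q b \<longleftrightarrow> a < b" "q a = q b \<longleftrightarrow> a = b"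
proof -
  show "q 0 = 0" "q 1 = 1"
    by (simp_all add: q_def Zero_fract_def One_fract_def flip: zd_simps(2,3))
  show "q (a + b) = q a + q b" "q (a * b) = q a * q b"
    by (simp_all add: q_def zd_simps(4,5))
  show le: "q a \<le> q b \<longleftrightarrow> a \<le> b" for a b by (simp add: q_def zd_le)
  show "q a < q b \<longleftrightarrow> a < b" "q a = q b \<longleftrightarrow> a = b"
    using le[of a b] le[of b a] by (auto simp: less_le_not_le)
qed

lemma q_nonneg [simp]: "0 \<le> q a"
  using q_simps(5)[of 0 a] by (simp del: q_simps(5))

lemma q_diff: "b \<le> a \<Longrightarrow> q (a - b) = q a - q b"
  by (metis add_diff_cancel_right' le_add_diff_inverse2 q_simps(3))

text \<open>The field is Archimedean relative to the numbers of the model: a nonzero denominator is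
  a difference of two distinct numbers, hence at least 1 in absolute value.\<close>

lemma qq_bound: "\<exists>n. x \<le> q n"
proof (cases x)
  case (Fract a b)
  obtain m n where a: "a = zd m n" using zd_cases .
  obtain k l where b: "b = zd k l" using zd_cases .
  have q: "Fract (zd i j) 1 = q i - q j" for i j
  proof -
    have "zd i 0 = zd i j + zd j 0" by (simp add: zd_simps add.commute)
    then show ?thesis by (simp add: q_def algebra_simps)
  qed
  have x: "x = (q m - q n) / (q k - q l)"
    using Fract by (simp add: a b flip: q)
  have "k \<noteq> l" using Fract by (auto simp: b zd_simps)
  then have "1 \<le> \<bar>q k - q l\<bar>"
  proof (cases "k < l")
    case True
    then have "q (k + 1) \<le> q l" by (simp only: q_simps(5) nn_less_iff)
    then show ?thesis by simp
  next
    case False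
    then have "l < k" using \<open>k \<noteq> l\<close> by simp
    then have "q (l + 1) \<le> q k" by (simp only: q_simps(5) nn_less_iff)
    then show ?thesis by simp
  qed
  then have "\<bar>x\<bar> \<le> \<bar>q m - q n\<bar>"
    unfolding x abs_divide using divide_left_mono[of 1 "\<bar>q k - q l\<bar>" "\<bar>q m - q n\<bar>"] \<open>k \<noteq> l\<close> by simp
  moreover have "\<bar>q m - q n\<bar> \<le> q (m + n)" using q_nonneg[of m] q_nonneg[of n] by (simp add: abs_le_iff)
  ultimately have "x \<le> q (m + n)" by linarith
  then show ?thesis by blast
qed

section \<open>Definable predicates\<close>

text \<open>Truth is coded by 0, so two truncated subtractions turn a definable \<open>F c\<close>
  into the characteristic function of \<open>F c = 0\<close>.\<close>

definition dpr :: "('c::ctx \<Rightarrow> bool) \<Rightarrow> bool" where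
  "dpr P \<longleftrightarrow> dfn (\<lambda>c. if P c then 0 else 1 :: nn)"

definition nrec :: "nn \<Rightarrow> nn \<Rightarrow> (nn \<Rightarrow> nn \<Rightarrow> nn) \<Rightarrow> nn" where
  "nrec n a F = recN $ n $ a $ (\<Lambda> m. \<Lambda> k. F m k)"

context gmodel
begin

lemma ops: "0 = zN" "1 = nS zN" "a + b = addN $ a $ b" "a * b = mulN $ a $ b" for a b :: nn
proof -
  have "genuine" using model by (auto simp: genuine_def)
  then show "0 = zN" "1 = nS zN" "a + b = addN $ a $ b" "a * b = mulN $ a $ b"
    by (simp_all add: zero_nn_def one_nn_def plus_nn_def times_nn_def nn_ops_def)
qed

lemma S_eq: "nS n = n + 1"
  by (simp add: ops add_eqs)

lemma sub_eq: "subN $ a $ b = a - b"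
proof (cases "b \<le> a")
  case True
  then obtain d where "a = d + b" by (metis nn_le_iff add.commute)
  then show ?thesis by (simp add: ops(3) add_sub flip: ops) (simp add: ops(3) add_sub)
next
  case False
  then have "a - b = 0" by (simp add: minus_nn_def)
  moreover have "subN $ a $ b = zN" using False sub_zero_iff by (metis linear nn_le_iff ops(3))
  ultimately show ?thesis by (simp add: ops(1))
qed

lemma dfn_arith [dfn_intros]:
  "dfn (\<lambda>_. 0::nn)" "dfn (\<lambda>_. 1::nn)"
  "dfn F \<Longrightarrow> dfn G \<Longrightarrow> dfn (\<lambda>c. F c + (G c :: nn))"
  "dfn F \<Longrightarrow> dfn G \<Longrightarrow> dfn (\<lambda>c. F c * (G c :: nn))"
  "dfn F \<Longrightarrow> dfn G \<Longrightarrow> dfn (\<lambda>c. F c - (G c :: nn))"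
  unfolding ops sub_eq[symmetric] by (intro dfn_intros; assumption)+

lemma nn_sub_0_iff: "a - b = 0 \<longleftrightarrow> a \<le> b" for a b :: nn
proof
  show "a \<le> b" if "a - b = 0" using le_add_diff_inverse2[of b a] that linear[of a b] by auto
  show "a - b = 0" if "a \<le> b" using that by (cases "a = b") (simp_all add: minus_nn_def)
qed

lemma nn_zero_or_pos: "a = 0 \<or> 1 \<le> a" for a :: nn
  using nn_less_iff[of 0 a] nn_nonneg[of a] by (auto simp: less_le)

lemma char_not: "1 - (if P then 0 else 1 :: nn) = (if \<not> P then 0 else 1)"
  by simp

lemma sg: "1 - (1 - a) = (if a = 0 then 0 else 1)" for a :: nn
proof (cases "a = 0")
  case False
  then have "1 - a = 0" using nn_zero_or_pos[of a] nn_sub_0_iff by blast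
  then show ?thesis using False by simp
qed simp

lemma dpr_zero: "dfn F \<Longrightarrow> dpr (\<lambda>c. F c = (0::nn))"
  unfolding dpr_def sg[symmetric] by (intro dfn_intros)

lemma dpr_intros [dfn_intros]:
  "dfn F \<Longrightarrow> dfn G \<Longrightarrow> dpr (\<lambda>c. F c \<le> (G c :: nn))"
  "dpr P \<Longrightarrow> dpr (\<lambda>c. \<not> P c)"
  "dpr P \<Longrightarrow> dpr Q \<Longrightarrow> dpr (\<lambda>c. P c \<and> Q c)"
proof -
  show "dfn F \<Longrightarrow> dfn G \<Longrightarrow> dpr (\<lambda>c. F c \<le> (G c :: nn))"
    unfolding nn_sub_0_iff[symmetric] by (intro dpr_zero dfn_intros)
  show "dpr P \<Longrightarrow> dpr (\<lambda>c. \<not> P c)"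
    unfolding dpr_def char_not[symmetric] by (intro dfn_intros)
  have *: "(if P then 0 else 1 :: nn) + (if Q then 0 else 1) = 0 \<longleftrightarrow> P \<and> Q" for P Q
    using zero_less_two[where 'a=nn] by (auto simp del: zero_less_two)
  show "dpr P \<Longrightarrow> dpr Q \<Longrightarrow> dpr (\<lambda>c. P c \<and> Q c)"
    unfolding *[symmetric] by (intro dpr_zero dfn_intros) (simp_all add: dpr_def)
qed

lemma dpr_more [dfn_intros]:
  "dpr P \<Longrightarrow> dpr Q \<Longrightarrow> dpr (\<lambda>c. P c \<or> Q c)"
  "dpr P \<Longrightarrow> dpr Q \<Longrightarrow> dpr (\<lambda>c. P c \<longrightarrow> Q c)"
  "dfn F \<Longrightarrow> dfn G \<Longrightarrow> dpr (\<lambda>c. F c = (G c :: nn))"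
  "dfn F \<Longrightarrow> dfn G \<Longrightarrow> dpr (\<lambda>c. F c < (G c :: nn))"
proof -
  have 1: "P \<or> Q \<longleftrightarrow> \<not> (\<not> P \<and> \<not> Q)" "(P \<longrightarrow> Q) \<longleftrightarrow> \<not> (P \<and> \<not> Q)" for P Q by auto
  show "dpr P \<Longrightarrow> dpr Q \<Longrightarrow> dpr (\<lambda>c. P c \<or> Q c)" "dpr P \<Longrightarrow> dpr Q \<Longrightarrow> dpr (\<lambda>c. P c \<longrightarrow> Q c)"
    unfolding 1 by (intro dfn_intros; assumption)+
  show "dfn F \<Longrightarrow> dfn G \<Longrightarrow> dpr (\<lambda>c. F c = (G c :: nn))"
    unfolding eq_iff by (intro dfn_intros)
  show "dfn F \<Longrightarrow> dfn G \<Longrightarrow> dpr (\<lambda>c. F c < (G c :: nn))"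
    unfolding not_le[symmetric] by (intro dfn_intros)
qed

lemma dfn_if [dfn_intros]:
  assumes "dpr P" "dfn F" "dfn G" shows "dfn (\<lambda>c. if P c then F c else (G c :: nn))"
proof -
  have "dfn (\<lambda>c. (1 - (if P c then 0 else 1)) * F c + (if P c then 0 else 1) * G c)"
    by (intro dfn_intros assms) (use assms in \<open>simp_all add: dpr_def\<close>)
  moreover have "(\<lambda>c. (1 - (if P c then 0 else 1)) * F c + (if P c then 0 else 1) * G c)
      = (\<lambda>c. if P c then F c else G c)" by auto
  ultimately show ?thesis by simp
qed

lemma dfn_nrec [dfn_intros]:
  assumes "dfn N" "dfn A" "dfn (\<lambda>d. F (fst (fst d)) (snd (fst d)) (snd d))"
  shows "dfn (\<lambda>c. nrec (N c) (A c) (F c))"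
  unfolding nrec_def by (intro dfn_intros assms)

lemma nrec:
  assumes "dfn (\<lambda>d. F (fst (fst d)) (snd (fst d)) (snd d))"
  shows "nrec 0 a (F c) = a" "nrec (n + 1) a (F c) = F c (nrec n a (F c)) n"
proof -
  have "(\<Lambda> m. \<Lambda> k. F c m k) $ m = (\<Lambda> k. F c m k)" for m
    by (rule beta[of "\<lambda>c m. \<Lambda> k. F c m k"]) (intro dfn_intros assms)
  moreover have "(\<Lambda> k. F c m k) $ k = F c m k" for m k
    using beta[of "\<lambda>d k. F (fst d) (snd d) k" "(c, m)" k] assms by simp
  ultimately show "nrec 0 a (F c) = a" "nrec (n + 1) a (F c) = F c (nrec n a (F c)) n"
    by (simp_all add: nrec_def rec_eqs ops(1) flip: S_eq)
qed

text \<open>A definable predicate is an equation for its characteristic function, so quantifier-free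
  induction applies to it.\<close>

lemma dpr_induct:
  fixes P :: "'c::ctx \<Rightarrow> nn \<Rightarrow> bool"
  assumes "dpr (\<lambda>d. P (fst d) (snd d))" "P c 0" "\<And>n. P c n \<Longrightarrow> P c (n + 1)"
  shows "P c n"
proof -
  have "(if P c n then 0 else 1) = (0::nn)"
  proof (rule induct_eq[of "\<lambda>c n. if P c n then 0 else 1" "\<lambda>_ _. 0"])
    show "dfn (\<lambda>d. if P (fst d) (snd d) then 0 else 1 :: nn)" using assms(1) by (simp add: dpr_def)
    show "dfn (\<lambda>d::'c \<times> nn. 0::nn)" by (intro dfn_intros)
    show "(if P c zN then 0 else 1) = (0::nn)" using assms(2) by (simp flip: ops(1))
    fix n assume "(if P c n then 0 else 1) = (0::nn)"
    then have "P c n" by (simp split: if_splits)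
    then show "(if P c (nS n) then 0 else 1) = (0::nn)" using assms(3) by (simp add: S_eq)
  qed
  then show ?thesis by (simp split: if_splits)
qed

lemma dfn_subst:
  assumes "dfn (\<lambda>d. F (fst d) (snd d))"
  shows "dfn X \<Longrightarrow> dfn (\<lambda>c. F c (X c))" "dfn X1 \<Longrightarrow> dfn (\<lambda>c. F (fst c) (X1 c))"
    "dfn X2 \<Longrightarrow> dfn (\<lambda>c. F (fst (fst c)) (X2 c))"
    "dfn X3 \<Longrightarrow> dfn (\<lambda>c. F (fst (fst (fst c))) (X3 c))"
proof -
  obtain G where G: "dfn G" and F: "\<And>c x. F c x = G c $ x" using dfn_curry[OF assms] by auto
  note G1 = dfn_weaken[OF G] note G2 = dfn_weaken[OF G1] note G3 = dfn_weaken[OF G2]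
  show "dfn X \<Longrightarrow> dfn (\<lambda>c. F c (X c))" unfolding F by (rule dfn_app[OF G])
  show "dfn X1 \<Longrightarrow> dfn (\<lambda>c. F (fst c) (X1 c))" unfolding F by (rule dfn_app[OF G1])
  show "dfn X2 \<Longrightarrow> dfn (\<lambda>c. F (fst (fst c)) (X2 c))" unfolding F by (rule dfn_app[OF G2])
  show "dfn X3 \<Longrightarrow> dfn (\<lambda>c. F (fst (fst (fst c))) (X3 c))" unfolding F by (rule dfn_app[OF G3])
qed

lemma dpr_subst:
  fixes P :: "'c::ctx \<Rightarrow> 'a::srt \<Rightarrow> bool"
  assumes "dpr (\<lambda>d. P (fst d) (snd d))"
  shows "dfn X \<Longrightarrow> dpr (\<lambda>c. P c (X c))" "dfn X1 \<Longrightarrow> dpr (\<lambda>c. P (fst c) (X1 c))"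
    "dfn X2 \<Longrightarrow> dpr (\<lambda>c. P (fst (fst c)) (X2 c))"
    "dfn X3 \<Longrightarrow> dpr (\<lambda>c. P (fst (fst (fst c))) (X3 c))"
  using dfn_subst[of "\<lambda>c x. if P c x then 0 else 1"] assms unfolding dpr_def by auto

lemma dpr_bex [dfn_intros]:
  fixes P :: "'c::ctx \<Rightarrow> nn \<Rightarrow> bool"
  assumes N: "dfn N" and P: "dpr (\<lambda>d. P (fst d) (snd d))"
  shows "dpr (\<lambda>c. \<exists>i<N c. P c i)"
proof -
  \<comment> \<open>Bounded search by recursion: the value starts at 1 and drops to 0 for good at
    the first hit.\<close>
  define B where "B c n = nrec n 1 (\<lambda>m k. if P c k then 0 else m)" for c n
  have step: "dfn (\<lambda>d. if P (fst (fst d)) (snd d) then 0 else snd (fst d) :: nn)"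
    by (intro dfn_intros dpr_subst(3)[OF P])
  have B: "B c 0 = 1" "B c (n + 1) = (if P c n then 0 else B c n)" for c n
    unfolding B_def using nrec[of "\<lambda>c m k. if P c k then 0 else m", OF step] by auto
  have "dfn (\<lambda>d. B (fst d) (snd d))"
    unfolding B_def by (intro dfn_intros dpr_subst(4)[OF P])
  note dB = dfn_subst[OF this]
  have 1: "B c n = 0" if i: "P c i" "i < n" for c i n
  proof -
    obtain d where d: "n = (i + 1) + d" using i(2) by (metis nn_less_iff nn_le_iff)
    have "B c (i + 1 + d) = 0"
      using dpr_induct[where P="\<lambda>c d. B (fst c) (snd c + 1 + d) = 0" and c="(c, i)" and n=d]
      by (simp add: B i dfn_intros dB flip: add.assoc)
    then show ?thesis by (simp add: d)
  qed
  have 2: "B c n = 1" if no: "\<forall>i<n. \<not> P c i" for c n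
  proof -
    \<comment> \<open>The bound \<open>n\<close> becomes a parameter of the induction on
      \<open>m\<close>; the assumption that there is no hit below \<open>n\<close> stays outside the
      predicate.\<close>
    have "n \<le> n \<longrightarrow> B c n = 1"
      using dpr_induct[where P="\<lambda>c m. m \<le> snd c \<longrightarrow> B (fst c) m = 1" and c="(c, n)" and n=n] no
      by (auto simp: B dfn_intros dB) (metis less_add_same_cancel1 less_le_trans zero_less_one less_imp_le)
    then show ?thesis by simp
  qed
  have "(\<exists>i<N c. P c i) \<longleftrightarrow> B c (N c) = 0" for c
    using 1 2 zero_neq_one by metis
  then show ?thesis by (simp add: dfn_intros dB N)
qed

lemma dpr_ball [dfn_intros]:
  fixes P :: "'c::ctx \<Rightarrow> nn \<Rightarrow> bool"
  assumes N: "dfn N" and P: "dpr (\<lambda>d. P (fst d) (snd d))"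
  shows "dpr (\<lambda>c. \<forall>i<N c. P c i)"
proof -
  have "dpr (\<lambda>c. \<not> (\<exists>i<N c. \<not> P c i))" by (intro dfn_intros N P)
  then show ?thesis by simp
qed

text \<open>Having no instance below \<open>m\<close> is a bounded statement, hence definable and
  accessible to induction.\<close>

lemma dpr_least:
  fixes P :: "'c::ctx \<Rightarrow> nn \<Rightarrow> bool"
  assumes P: "dpr (\<lambda>d. P (fst d) (snd d))" and "P c n"
  shows "\<exists>m. P c m \<and> (\<forall>k<m. \<not> P c k)"
proof (rule ccontr)
  assume no: "\<not> ?thesis"
  have "\<forall>k<m. \<not> P c k" for m
  proof (rule dpr_induct[where P="\<lambda>c m. \<forall>k<m. \<not> P c k"])
    show "dpr (\<lambda>d. \<forall>k<snd d. \<not> P (fst d) k)" by (intro dfn_intros dpr_subst[OF P])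
    fix m assume IH: "\<forall>k<m. \<not> P c k"
    then have "\<not> P c m" using no by blast
    then show "\<forall>k<m + 1. \<not> P c k" using IH
      by (metis add_le_cancel_right less_le nn_less_iff)
  qed (use nn_nonneg leD in blast)
  from this[of "n + 1"] show False using \<open>P c n\<close> by simp
qed


section \<open>Pairing and rational codes\<close>

abbreviation tri :: "nn \<Rightarrow> nn" where "tri n \<equiv> triN $ n"
abbreviation p2 :: "nn \<Rightarrow> nn" where "p2 n \<equiv> powN $ n"

lemma tri: "tri 0 = 0" "tri (n + 1) = tri n + (n + 1)"
  using tri_eqs S_eq by (simp_all add: ops(1)[symmetric] ops(3)[symmetric])

lemma p2: "p2 0 = 1" "p2 (n + 1) = p2 n + p2 n"
  using pow_eqs S_eq by (simp_all add: ops(1)[symmetric] ops(3)[symmetric])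

lemma tri_mono: "a \<le> b \<Longrightarrow> tri a \<le> tri b"
proof -
  have "tri a \<le> tri (a + d)" for d
    by (rule dpr_induct[where P="\<lambda>c d. tri (snd c) \<le> tri (snd c + d)" and c="((), a)", simplified];
        (intro dfn_intros)?) (simp_all add: tri add.assoc[symmetric] add_increasing2)
  then show "a \<le> b \<Longrightarrow> tri a \<le> tri b" by (auto simp: nn_le_iff)
qed

end

definition pr :: "nn \<Rightarrow> nn \<Rightarrow> nn" where "pr a b = triN $ (a + b) + b"
text \<open>The diagonal of Cantor's enumeration on which \<open>n\<close> lies, that is, the
  largest \<open>m\<close> whose triangular number is at most \<open>n\<close>. It grows by at most
  one per step, so a recursion can follow it.\<close>

definition wd :: "nn \<Rightarrow> nn" where
  "wd n = nrec n 0 (\<lambda>m k. if triN $ (m + 1) \<le> k + 1 then m + 1 else m)"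
definition d2 :: "nn \<Rightarrow> nn" where "d2 n = n - triN $ (wd n)"
definition d1 :: "nn \<Rightarrow> nn" where "d1 n = wd n - d2 n"

text \<open>The code \<open>pr (pr a b) c\<close> stands for the rational number \<open>(a - b) / (c + 1)\<close>.\<close>

definition rv :: "nn \<Rightarrow> qq" where "rv n = (q (d1 (d1 n)) - q (d2 (d1 n))) / (q (d2 n) + 1)"

text \<open>Elements of \<open>qq\<close> lie outside the model, so definability has to refer to a
  code. Codes are not unique and none is preferred.\<close>

definition dra :: "('c::ctx \<Rightarrow> qq) \<Rightarrow> bool" where
  "dra F \<longleftrightarrow> (\<exists>X. dfn X \<and> (\<forall>c. F c = rv (X c)))"

context gmodel
begin

lemma dfn_pr [dfn_intros]:
  "dfn F \<Longrightarrow> dfn G \<Longrightarrow> dfn (\<lambda>c. pr (F c) (G c))"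
  "dfn F \<Longrightarrow> dfn (\<lambda>c. wd (F c))" "dfn F \<Longrightarrow> dfn (\<lambda>c. d2 (F c))" "dfn F \<Longrightarrow> dfn (\<lambda>c. d1 (F c))"
  unfolding pr_def wd_def d1_def d2_def by (intro dfn_intros; assumption)+

lemma wd: "tri (wd n) \<le> n \<and> n < tri (wd n + 1)"
proof -
  let ?F = "\<lambda>(c::unit) m k. if tri (m + 1) \<le> k + 1 then m + 1 else m"
  have wd_eqs: "wd 0 = 0" "wd (n + 1) = (if tri (wd n + 1) \<le> n + 1 then wd n + 1 else wd n)" for n
    unfolding wd_def using nrec[where F="?F" and c="()"] by (simp_all add: dfn_intros)
  show ?thesis
  proof (rule dpr_induct[where P="\<lambda>(c::unit) n. tri (wd n) \<le> n \<and> n < tri (wd n + 1)"])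
    show "tri (wd 0) \<le> 0 \<and> 0 < tri (wd 0 + 1)" using tri(2)[of 0] by (simp add: wd_eqs tri(1))
    fix n assume IH: "tri (wd n) \<le> n \<and> n < tri (wd n + 1)"
    show "tri (wd (n + 1)) \<le> n + 1 \<and> n + 1 < tri (wd (n + 1) + 1)"
    proof (cases "tri (wd n + 1) \<le> n + 1")
      case True
      have "n + 1 \<le> tri (wd n + 1)" using IH by (simp add: nn_less_iff)
      also have "\<dots> < tri (wd n + 1 + 1)"
        using tri(2)[of "wd n + 1"] by (simp add: add_nonneg_pos)
      finally show ?thesis using True by (simp add: wd_eqs)
    next
      case False
      then show ?thesis using IH by (auto simp: wd_eqs intro: order_trans)
    qed
  qed (intro dfn_intros)
qed

lemma wd_unique: assumes "tri w \<le> n" "n < tri (w + 1)" shows "wd n = w"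
proof (rule antisym)
  show "wd n \<le> w" using wd[of n] assms tri_mono[of "w + 1" "wd n"]
    by (meson leD leI nn_less_iff order_trans not_le_imp_less)
  show "w \<le> wd n" using wd[of n] assms tri_mono[of "wd n + 1" w]
    by (meson leD leI nn_less_iff order_trans not_le_imp_less)
qed

lemma pr_d: "pr (d1 n) (d2 n) = n"
proof -
  have "n < tri (wd n) + (wd n + 1)" using wd[of n] by (simp add: tri)
  moreover obtain d where d: "n = tri (wd n) + d" using wd[of n] by (auto simp: nn_le_iff)
  ultimately have "d < wd n + 1" by (metis add_less_cancel_left)
  then have "d \<le> wd n" by (simp add: nn_less_iff)
  moreover have "d2 n = d" unfolding d2_def using d by (metis add_diff_cancel_left')
  ultimately have "d1 n + d2 n = wd n" by (simp add: d1_def)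
  then show ?thesis using d \<open>d2 n = d\<close> by (simp add: pr_def)
qed

lemma d_pr [simp]: "d1 (pr a b) = a" "d2 (pr a b) = b"
proof -
  have "tri (a + b) + b < tri (a + b) + (a + b + 1)"
    by (metis add_strict_left_mono add.commute add.left_commute less_add_one nn_le_iff le_less_trans add.assoc)
  then have "wd (pr a b) = a + b" by (intro wd_unique) (simp_all add: pr_def tri(2) nn_le_iff)
  then show "d1 (pr a b) = a" "d2 (pr a b) = b" by (simp_all add: d1_def d2_def pr_def)
qed

lemma rv_pr: "rv (pr (pr a b) c) = (q a - q b) / (q c + 1)"
  by (simp add: rv_def)

end

definition w :: "nn \<Rightarrow> qq" where "w n = 1 / q (powN $ n)"

context gmodel
begin

lemma p2_ge: "1 \<le> p2 n \<and> n < p2 n"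
proof (rule dpr_induct[where P="\<lambda>(c::unit) n. 1 \<le> p2 n \<and> n < p2 n"])
  fix n assume IH: "1 \<le> p2 n \<and> n < p2 n"
  then have "n + 1 < p2 n + p2 n" by (meson add_less_le_mono)
  moreover have "1 \<le> p2 n + p2 n" using IH by (meson add_increasing2 nn_nonneg)
  ultimately show "1 \<le> p2 (n + 1) \<and> n + 1 < p2 (n + 1)" by (simp add: p2)
qed (auto intro!: dfn_intros simp: p2)

lemma q_p2: "0 < q (p2 n)"
proof -
  have "0 < p2 n" using p2_ge[of n] less_le_trans[OF zero_less_one] by blast
  then show ?thesis using q_simps(6)[of 0 "p2 n"] by simp
qed

lemma w_pos [simp]: "0 < w n" "0 \<le> w n"
  using q_p2[of n] by (simp_all add: w_def)

lemma w_0 [simp]: "w 0 = 1" by (simp add: w_def p2)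

lemma w_S: "w (n + 1) = w n / 2"
  by (simp add: w_def p2)

lemma w_double: "2 * w (n + 1) = w n" by (simp add: w_S)

text \<open>The induction concerns powers of two among the numbers of the model; reciprocals are
  taken afterwards.\<close>

lemma w_add: "w (n + k) \<le> w n"
  by (rule dpr_induct[where P="\<lambda>c k. p2 (snd c) \<le> p2 (snd c + k)" and c="((), n)", simplified, THEN
        q_simps(5)[THEN iffD2], THEN frac_le[of 1 1, OF zero_le_one order_refl q_p2], folded w_def];
      (intro dfn_intros)?) (simp_all add: p2 add.assoc[symmetric] add_increasing2)

lemma w_mono: "n \<le> m \<Longrightarrow> w m \<le> w n"
  using w_add by (auto simp: nn_le_iff)

lemma w_arch: "0 < t \<Longrightarrow> \<exists>n. w n < t"
proof -
  assume t: "0 < t"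
  obtain n where n: "1 / t \<le> q n" using qq_bound by blast
  also have "q n < q (p2 n)" using p2_ge by simp
  finally have "1 / t < q (p2 n)" .
  then have "w n < t" using t q_p2[of n] by (simp add: w_def field_simps)
  then show ?thesis ..
qed

lemma q_S: "0 < q c + 1" using q_nonneg[of c] by linarith

lemma dra_dfn [dfn_intros]:
  "dfn X \<Longrightarrow> dra (\<lambda>c. rv (X c))" "dfn X \<Longrightarrow> dra (\<lambda>c. q (X c))" "dfn X \<Longrightarrow> dra (\<lambda>c. w (X c))"
  "dra (\<lambda>c. 0)" "dra (\<lambda>c. 1)"
proof -
  show "dfn X \<Longrightarrow> dra (\<lambda>c. rv (X c))" unfolding dra_def by blast
  show "dfn X \<Longrightarrow> dra (\<lambda>c. q (X c))" unfolding dra_def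
    by (rule exI[of _ "\<lambda>c. pr (pr (X c) 0) 0"]) (auto intro!: dfn_intros simp: rv_pr)
  show "dfn X \<Longrightarrow> dra (\<lambda>c. w (X c))" unfolding dra_def
    by (rule exI[of _ "\<lambda>c. pr (pr 1 0) (p2 (X c) - 1)"])
      (auto intro!: dfn_intros simp: rv_pr w_def q_diff p2_ge)
  show "dra (\<lambda>c. 0)" unfolding dra_def
    by (rule exI[of _ "\<lambda>c. pr (pr 0 0) 0"]) (auto intro!: dfn_intros simp: rv_pr)
  show "dra (\<lambda>c. 1)" unfolding dra_def
    by (rule exI[of _ "\<lambda>c. pr (pr 1 0) 0"]) (auto intro!: dfn_intros simp: rv_pr)
qed

lemma rv_expand: "\<exists>a b c. x = pr (pr a b) c \<and> rv x = (q a - q b) / (q c + 1)"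
  using pr_d rv_pr by metis

lemma dra_ops [dfn_intros]:
  assumes "dra F" "dra G"
  shows "dra (\<lambda>c. F c + G c)" "dra (\<lambda>c. F c - G c)" "dra (\<lambda>c. F c * G c)"
proof -
  obtain X Y where X: "dfn X" "\<And>c. F c = rv (X c)" and Y: "dfn Y" "\<And>c. G c = rv (Y c)"
    using assms unfolding dra_def by auto
  let ?a = "\<lambda>c. d1 (d1 (X c))" and ?b = "\<lambda>c. d2 (d1 (X c))" and ?c = "\<lambda>c. d2 (X c)"
  let ?a' = "\<lambda>c. d1 (d1 (Y c))" and ?b' = "\<lambda>c. d2 (d1 (Y c))" and ?c' = "\<lambda>c. d2 (Y c)"
  have n: "q (?c c) + 1 \<noteq> 0" "q (?c' c) + 1 \<noteq> 0" for c using q_S[of "?c c"] q_S[of "?c' c"] by auto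
  \<comment> \<open>A code stores its denominator minus one, and
    \<open>(c + 1) * (c' + 1) - 1\<close> is \<open>c * c' + c + c'\<close>.\<close>
  have d: "q (?c c * ?c' c + ?c c + ?c' c) + 1 = (q (?c c) + 1) * (q (?c' c) + 1)" for c
    by (simp add: algebra_simps)
  show "dra (\<lambda>c. F c + G c)" unfolding dra_def
    by (rule exI[of _ "\<lambda>c. pr (pr (?a c * (?c' c + 1) + ?a' c * (?c c + 1)) (?b c * (?c' c + 1) + ?b' c * (?c c + 1)))
          (?c c * ?c' c + ?c c + ?c' c)"])
      (use n in \<open>auto intro!: dfn_intros X Y simp: rv_pr d X(2) Y(2) simp del: q_simps(3,4), simp add: rv_def field_simps\<close>)
  show "dra (\<lambda>c. F c - G c)" unfolding dra_def
    by (rule exI[of _ "\<lambda>c. pr (pr (?a c * (?c' c + 1) + ?b' c * (?c c + 1)) (?b c * (?c' c + 1) + ?a' c * (?c c + 1)))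
          (?c c * ?c' c + ?c c + ?c' c)"])
      (use n in \<open>auto intro!: dfn_intros X Y simp: rv_pr d X(2) Y(2) simp del: q_simps(3,4), simp add: rv_def field_simps\<close>)
  show "dra (\<lambda>c. F c * G c)" unfolding dra_def
    by (rule exI[of _ "\<lambda>c. pr (pr (?a c * ?a' c + ?b c * ?b' c) (?a c * ?b' c + ?b c * ?a' c))
          (?c c * ?c' c + ?c c + ?c' c)"])
      (use n in \<open>auto intro!: dfn_intros X Y simp: rv_pr d X(2) Y(2) simp del: q_simps(3,4), simp add: rv_def field_simps\<close>)
qed

lemma dra_if [dfn_intros]:
  assumes "dpr P" "dra F" "dra G" shows "dra (\<lambda>c. if P c then F c else G c)"
proof -
  obtain X Y where X: "dfn X" "\<And>c. F c = rv (X c)" and Y: "dfn Y" "\<And>c. G c = rv (Y c)"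
    using assms(2,3) unfolding dra_def by auto
  show ?thesis unfolding dra_def
    by (rule exI[of _ "\<lambda>c. if P c then X c else Y c"]) (auto intro!: dfn_intros assms X Y simp: X(2) Y(2))
qed

lemma dpr_dra [dfn_intros]:
  fixes F G :: "'c::ctx \<Rightarrow> qq"
  assumes "dra F" "dra G"
  shows "dpr (\<lambda>c. F c \<le> G c)" "dpr (\<lambda>c. F c < G c)" "dpr (\<lambda>c. F c = G c)"
proof -
  have le: "dpr (\<lambda>c. F c \<le> G c)" if FG: "dra F" "dra G" for F G :: "'c::ctx \<Rightarrow> qq"
  proof -
    obtain X where X: "dfn X" "\<And>c. F c - G c = rv (X c)" using dra_ops(2)[OF FG] unfolding dra_def by auto
    have "F c \<le> G c \<longleftrightarrow> d1 (d1 (X c)) \<le> d2 (d1 (X c))" for c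
    proof -
      have "F c \<le> G c \<longleftrightarrow> rv (X c) \<le> 0" by (simp flip: X(2))
      then show ?thesis using q_S[of "d2 (X c)"] by (simp add: rv_def divide_le_0_iff)
    qed
    then show ?thesis using X by (simp add: dfn_intros)
  qed
  show "dpr (\<lambda>c. F c \<le> G c)" by (rule le[OF assms])
  have "dpr (\<lambda>c. \<not> G c \<le> F c)" by (intro dfn_intros le assms)
  then show "dpr (\<lambda>c. F c < G c)" by (simp add: not_le)
  have "dpr (\<lambda>c. F c \<le> G c \<and> G c \<le> F c)" by (intro dfn_intros le assms)
  then show "dpr (\<lambda>c. F c = G c)" by (simp add: eq_iff)
qed

end


section \<open>The meaning of the formulas on real numbers\<close>

definition isr :: "(nn \<leadsto> nn) \<Rightarrow> bool" where
  "isr x \<longleftrightarrow> (\<forall>n i. \<bar>rv (x $ n) - rv (x $ (n + i))\<bar> < w n)"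

definition req :: "(nn \<leadsto> nn) \<Rightarrow> (nn \<leadsto> nn) \<Rightarrow> bool" where
  "req x y \<longleftrightarrow> (\<forall>n. \<bar>rv (x $ n) - rv (y $ n)\<bar> \<le> w n)"

definition rle :: "(nn \<leadsto> nn) \<Rightarrow> (nn \<leadsto> nn) \<Rightarrow> bool" where
  "rle x y \<longleftrightarrow> (\<forall>n. rv (x $ n) \<le> rv (y $ n) + 2 * w n)"

definition rdist :: "(nn \<leadsto> nn) \<Rightarrow> (nn \<leadsto> nn) \<Rightarrow> nn \<Rightarrow> bool" where
  "rdist x y k \<longleftrightarrow> (\<exists>n. \<bar>rv (x $ n) - rv (y $ n)\<bar> + 2 * w n < w k)"

definition iu :: "(nn \<leadsto> nn) \<Rightarrow> bool" where
  "iu x \<longleftrightarrow> isr x \<and> (\<forall>n. 0 \<le> rv (x $ n) + 2 * w n \<and> rv (x $ n) \<le> 1 + 2 * w n)"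

definition cu :: "((nn \<leadsto> nn) \<leadsto> nn \<leadsto> nn) \<Rightarrow> bool" where
  "cu f \<longleftrightarrow> (\<forall>x. iu x \<longrightarrow> isr (f $ x)) \<and> (\<forall>x y. iu x \<longrightarrow> iu y \<longrightarrow> req x y \<longrightarrow> req (f $ x) (f $ y)) \<and>
     (\<forall>x. iu x \<longrightarrow> (\<forall>k. \<exists>N. \<forall>y. iu y \<longrightarrow> rdist x y N \<longrightarrow> rdist (f $ x) (f $ y) k))"

context gmodel
begin

lemma slt_iff: "slt GM (rp a) (rp b) \<longleftrightarrow> a < b" for a b :: nn
  unfolding slt_def nn_less_iff nn_sub_0_iff[symmetric] sub_eq[symmetric] S_eq[symmetric] by (simp add: sem ops(1))

lemma sat_leq: "sat GM (leq s t) e \<longleftrightarrow> seq GM (sap GM (sap GM (rp subN) (val GM e s)) (val GM e t)) (rp zN)"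
  by (simp add: leq_def monus_def val_closed sem)

lemma sdom_eqs: "sdom GM N0 = range (rp :: nn \<Rightarrow> tm)" "sdom GM T1 = range (rp :: (nn \<leadsto> nn) \<Rightarrow> tm)"
  "sdom GM T2 = range (rp :: ((nn \<leadsto> nn) \<leadsto> nn) \<Rightarrow> tm)"
  "sdom GM (T1 \<Rrightarrow> T1) = range (rp :: ((nn \<leadsto> nn) \<leadsto> nn \<leadsto> nn) \<Rightarrow> tm)"
  "sdom GM ((T1 \<Rrightarrow> T1) \<Rrightarrow> T1) = range (rp :: (((nn \<leadsto> nn) \<leadsto> nn \<leadsto> nn) \<leadsto> nn \<leadsto> nn) \<Rightarrow> tm)"
  by (rule sdom_range; simp)+

lemma val_pair: "val GM e s = rp a \<Longrightarrow> val GM e t = rp b \<Longrightarrow> val GM e (pair s t) = rp (pr a b)"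
  by (simp add: pair_def add_def val_closed sem pr_def ops)

text \<open>The cleared inequality is the intended one multiplied by a positive common denominator:
  \<open>q R - q L = (y - x) * K\<close>.\<close>

lemma rat_cmp_core:
  fixes a b c a' b' c' u v n m :: nn
  defines "L \<equiv> (a * (c' + 1) + b' * (c + 1)) * (p2 n * p2 m) + u * ((c + 1) * (c' + 1) * p2 m)"
    and "R \<equiv> (a' * (c + 1) + b * (c' + 1)) * (p2 n * p2 m) + v * ((c + 1) * (c' + 1) * p2 n)"
    and "x \<equiv> rv (pr (pr a b) c) + q u * w n" and "y \<equiv> rv (pr (pr a' b') c') + q v * w m"
  shows "L \<le> R \<longleftrightarrow> x \<le> y" "L < R \<longleftrightarrow> x < y"
proof -
  let ?d = "q c + 1" and ?d' = "q c' + 1" and ?P = "q (p2 n)" and ?Q = "q (p2 m)"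
  have pos: "0 < ?d" "0 < ?d'" "0 < ?P" "0 < ?Q" using q_S q_p2 by auto
  define K where "K = ?d * ?d' * ?P * ?Q"
  have "0 < K" unfolding K_def using pos by simp
  have "(A' * d + B * d') * (P * Q) + V * (d * d' * P) - ((A * d' + B' * d) * (P * Q) + U * (d * d' * Q))
      = ((A' - B') / d' + V * (1 / Q) - ((A - B) / d + U * (1 / P))) * (d * d' * P * Q)"
    if "d \<noteq> 0" "d' \<noteq> 0" "P \<noteq> 0" "Q \<noteq> 0" for A B A' B' U V d d' P Q :: qq
    using that by (simp add: field_simps)
  from this[of ?d ?d' ?P ?Q "q a'" "q b" "q v" "q a" "q b'" "q u"]
  have "q R - q L = (y - x) * K"
    using pos by (simp add: K_def L_def R_def x_def y_def rv_pr w_def)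
  then have "0 \<le> q R - q L \<longleftrightarrow> 0 \<le> y - x" "0 < q R - q L \<longleftrightarrow> 0 < y - x"
    using \<open>0 < K\<close> by (auto simp: zero_le_mult_iff zero_less_mult_iff)
  then show "L \<le> R \<longleftrightarrow> x \<le> y" "L < R \<longleftrightarrow> x < y"
    using q_simps(5)[of L R] q_simps(6)[of L R] by (auto simp del: q_simps)
qed

lemmas opsf = ops(3,4)[symmetric] S_eq sub_eq ops(1)[symmetric]

lemma sat_ExN: "sat GM (Ex (i, N0) \<phi>) e \<longleftrightarrow> (\<exists>a::nn. sat GM \<phi> (e((i, N0) := rp a)))"
  by (simp add: sdom_eqs)

lemma sat_Conj: "sat M (Conj \<phi> \<psi>) e \<longleftrightarrow> sat M \<phi> e \<and> sat M \<psi> e"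
  by simp

text \<open>Every number decomposes as a code, and the comparison depends only on the rational that
  is coded; hence the existential quantifiers over the components do no harm.\<close>

lemma sat_rat_cmp:
  assumes "val GM e s = rp x" "val GM e u = rp u'" "val GM e n = rp n'"
    "val GM e t = rp y" "val GM e v = rp v'" "val GM e m = rp m'"
  shows "sat GM (rat_cmp leq s u n t v m) e \<longleftrightarrow> rv x + q u' * w n' \<le> rv y + q v' * w m'"
    "sat GM (rat_cmp less s u n t v m) e \<longleftrightarrow> rv x + q u' * w n' < rv y + q v' * w m'"
proof -
  let ?ts = "[s, u, n, t, v, m]"
  define k where "k = newvar ?ts"
  define E where "E a b c a' b' c' = e((k, N0) := rp a, (k + 1, N0) := rp b, (k + 2, N0) := rp c,
    (k + 3, N0) := rp a', (k + 4, N0) := rp b', (k + 5, N0) := rp (c'::nn))" for a b c a' b' c' :: nn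
  have E: "val GM (E a b c a' b' c') t' = val GM e t'" if "t' \<in> set ?ts" for t' a b c a' b' c'
    unfolding E_def k_def using that by (simp only: val_fresh val_fresh_0)
  have Es: "val GM (E a b c a' b' c') s = rp x" "val GM (E a b c a' b' c') u = rp u'"
    "val GM (E a b c a' b' c') n = rp n'" "val GM (E a b c a' b' c') t = rp y"
    "val GM (E a b c a' b' c') v = rp v'" "val GM (E a b c a' b' c') m = rp m'" for a b c a' b' c'
    using assms by (simp_all add: E)
  have Ev: "E a b c a' b' c' (k, N0) = rp a" "E a b c a' b' c' (Suc k, N0) = rp b"
    "E a b c a' b' c' (Suc (Suc k), N0) = rp c" "E a b c a' b' c' (k + 3, N0) = rp a'"
    "E a b c a' b' c' (k + 4, N0) = rp b'" "E a b c a' b' c' (k + 5, N0) = rp c'" for a b c a' b' c'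
    by (simp_all add: E_def)
  define L :: "nn \<Rightarrow> nn \<Rightarrow> nn \<Rightarrow> nn \<Rightarrow> nn \<Rightarrow> nn \<Rightarrow> nn" where "L a b c a' b' c' = (a * (c' + 1) + b' * (c + 1)) * (p2 n' * p2 m') + u' * ((c + 1) * (c' + 1) * p2 m')"
    for a b c a' b' c'
  define R :: "nn \<Rightarrow> nn \<Rightarrow> nn \<Rightarrow> nn \<Rightarrow> nn \<Rightarrow> nn \<Rightarrow> nn" where "R a b c a' b' c' = (a' * (c + 1) + b * (c' + 1)) * (p2 n' * p2 m') + v' * ((c + 1) * (c' + 1) * p2 n')"
    for a b c a' b' c'
  have "sat GM (rat_cmp leq s u n t v m) e \<longleftrightarrow>
    (\<exists>a b c a' b' c'. x = pr (pr a b) c \<and> y = pr (pr a' b') c' \<and> L a b c a' b' c' \<le> R a b c a' b' c')"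
    unfolding rat_cmp_def Let_def k_def[symmetric] sat_ExN sat_Conj E_def[symmetric]
    by (simp add: sat_leq pair_def add_def mult_def pow2_def val_closed sem opsf Es Ev pr_def L_def R_def nn_sub_0_iff
        del: sat.simps(4) add: sat.simps(1))
  also have "\<dots> \<longleftrightarrow> rv x + q u' * w n' \<le> rv y + q v' * w m'"
    using rv_expand[of x] rv_expand[of y] rat_cmp_core(1) unfolding L_def R_def by blast
  finally show "sat GM (rat_cmp leq s u n t v m) e \<longleftrightarrow> rv x + q u' * w n' \<le> rv y + q v' * w m'" .
  have "sat GM (rat_cmp less s u n t v m) e \<longleftrightarrow>
    (\<exists>a b c a' b' c'. x = pr (pr a b) c \<and> y = pr (pr a' b') c' \<and> L a b c a' b' c' < R a b c a' b' c')"
    unfolding rat_cmp_def Let_def k_def[symmetric] sat_ExN sat_Conj E_def[symmetric]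
    by (simp add: sat_less slt_iff pair_def add_def mult_def pow2_def val_closed sem opsf Es Ev pr_def L_def R_def)
  also have "\<dots> \<longleftrightarrow> rv x + q u' * w n' < rv y + q v' * w m'"
    using rv_expand[of x] rv_expand[of y] rat_cmp_core(2) unfolding L_def R_def by blast
  finally show "sat GM (rat_cmp less s u n t v m) e \<longleftrightarrow> rv x + q u' * w n' < rv y + q v' * w m'" .
qed

lemma q_2 [simp]: "q 2 = 2"
  using q_simps(3)[of 1 1] by simp

lemma num_vals: "val GM e zero = rp (0::nn)" "val GM e (num 1) = rp (1::nn)" "val GM e (num 2) = rp (2 :: nn)"
  by (simp_all add: numeral_2_eq_2 sem opsf)

lemma sat_AllN: "sat GM (All (i, N0) \<phi>) e \<longleftrightarrow> (\<forall>a::nn. sat GM \<phi> (e((i, N0) := rp a)))"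
  by (simp add: sdom_eqs)

lemma sat_is_real:
  assumes "val GM e x = rp f"
  shows "sat GM (is_real x) e \<longleftrightarrow> isr f"
proof -
  let ?k = "newvar [x]"
  have "sat GM (rat_dist_less (x \<cdot> var0 ?k) (x \<cdot> add (var0 ?k) (var0 (?k + 1))) (var0 ?k))
      (e((?k, N0) := rp n, (?k + 1, N0) := rp i)) \<longleftrightarrow> \<bar>rv (f $ n) - rv (f $ (n + i))\<bar> < w n" (is "sat GM _ ?e \<longleftrightarrow> _") for n i :: nn
  proof -
    have v: "val GM ?e (x \<cdot> var0 ?k) = rp (f $ n)" "val GM ?e (x \<cdot> add (var0 ?k) (var0 (?k + 1))) = rp (f $ (n + i))"
      "val GM ?e (var0 ?k) = rp n"
      using assms by (simp_all add: add_def val_closed sem opsf)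
    show ?thesis unfolding rat_dist_less_def sat_Conj
      using sat_rat_cmp(2)[OF v(1) num_vals(1) num_vals(1) v(2) num_vals(2) v(3)]
        sat_rat_cmp(2)[OF v(2) num_vals(1) num_vals(1) v(1) num_vals(2) v(3)] by auto
  qed
  then show ?thesis unfolding is_real_def Let_def sat_AllN isr_def by blast
qed

lemma sat_real_eq:
  assumes "val GM e x = rp f" "val GM e y = rp g"
  shows "sat GM (real_eq x y) e \<longleftrightarrow> req f g"
proof -
  let ?k = "newvar [x, y]"
  have "sat GM (rat_dist_leq (x \<cdot> var0 ?k) (y \<cdot> var0 ?k) (var0 ?k)) (e((?k, N0) := rp n)) \<longleftrightarrow>
      \<bar>rv (f $ n) - rv (g $ n)\<bar> \<le> w n" (is "sat GM _ ?e \<longleftrightarrow> _") for n :: nn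
  proof -
    have v: "val GM ?e (x \<cdot> var0 ?k) = rp (f $ n)" "val GM ?e (y \<cdot> var0 ?k) = rp (g $ n)" "val GM ?e (var0 ?k) = rp n"
      using assms by (simp_all add: sem)
    show ?thesis unfolding rat_dist_leq_def sat_Conj
      using sat_rat_cmp(1)[OF v(1) num_vals(1) num_vals(1) v(2) num_vals(2) v(3)]
        sat_rat_cmp(1)[OF v(2) num_vals(1) num_vals(1) v(1) num_vals(2) v(3)] by auto
  qed
  then show ?thesis unfolding real_eq_def Let_def sat_AllN req_def by blast
qed

lemma sat_real_leq:
  assumes "val GM e x = rp f" "val GM e y = rp g"
  shows "sat GM (real_leq x y) e \<longleftrightarrow> rle f g"
proof -
  let ?k = "newvar [x, y]"
  have "sat GM (rat_cmp leq (x \<cdot> var0 ?k) zero zero (y \<cdot> var0 ?k) (num 2) (var0 ?k)) (e((?k, N0) := rp n)) \<longleftrightarrow>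
      rv (f $ n) \<le> rv (g $ n) + 2 * w n" (is "sat GM _ ?e \<longleftrightarrow> _") for n :: nn
  proof -
    have v: "val GM ?e (x \<cdot> var0 ?k) = rp (f $ n)" "val GM ?e (y \<cdot> var0 ?k) = rp (g $ n)" "val GM ?e (var0 ?k) = rp n"
      using assms by (simp_all add: sem)
    show ?thesis using sat_rat_cmp(1)[OF v(1) num_vals(1) num_vals(1) v(2) num_vals(3) v(3)] by simp
  qed
  then show ?thesis unfolding real_leq_def Let_def sat_AllN rle_def by blast
qed

lemma sat_real_dist_less:
  assumes "val GM e x = rp f" "val GM e y = rp g" "val GM e t = rp k"
  shows "sat GM (real_dist_less x y t) e \<longleftrightarrow> rdist f g k"
proof -
  let ?k = "newvar [x, y, t]"
  have "sat GM (Conj (rat_cmp less (x \<cdot> var0 ?k) (num 2) (var0 ?k) (y \<cdot> var0 ?k) (num 1) t)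
        (rat_cmp less (y \<cdot> var0 ?k) (num 2) (var0 ?k) (x \<cdot> var0 ?k) (num 1) t)) (e((?k, N0) := rp n)) \<longleftrightarrow>
      \<bar>rv (f $ n) - rv (g $ n)\<bar> + 2 * w n < w k" (is "sat GM _ ?e \<longleftrightarrow> _") for n :: nn
  proof -
    have v: "val GM ?e (x \<cdot> var0 ?k) = rp (f $ n)" "val GM ?e (y \<cdot> var0 ?k) = rp (g $ n)" "val GM ?e (var0 ?k) = rp n"
      "val GM ?e t = rp k"
      using assms by (simp_all add: sem)
    show ?thesis unfolding sat_Conj
      using sat_rat_cmp(2)[OF v(1) num_vals(3) v(3) v(2) num_vals(2) v(4)]
        sat_rat_cmp(2)[OF v(2) num_vals(3) v(3) v(1) num_vals(2) v(4)] by auto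
  qed
  then show ?thesis unfolding real_dist_less_def Let_def sat_ExN rdist_def by blast
qed

lemma val_fresh_Suc_Suc:
  "t \<in> set ts \<Longrightarrow> val M (e((Suc (Suc (newvar ts)), \<sigma>) := u)) t = val M e t"
  using val_fresh[of t ts M e 2] by simp

lemma val_real_of_rat:
  assumes "val GM e t = rp a"
  shows "val GM e (real_of_rat t) = rp (comb_K $ a :: nn \<leadsto> nn)"
proof -
  have "scon GM (KC N0 N0) = rp (comb_K :: nn \<leadsto> nn \<leadsto> nn)"
    using con_const(1)[OF comb_K_def[where 'a=nn and 'b=nn]] by simp
  then show ?thesis using assms by (simp add: real_of_rat_def rp_app)
qed

lemma rv_01: "rv (pr (pr 0 0) 0) = 0" "rv (pr (pr 1 0) 0) = 1"
  by (simp_all add: rv_pr)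

lemma sat_in_unit:
  assumes "val GM e x = rp f"
  shows "sat GM (in_unit x) e \<longleftrightarrow> iu f"
proof -
  have v: "val GM e real_zero = rp (comb_K $ (pr (pr 0 0) 0) :: nn \<leadsto> nn)"
    "val GM e real_one = rp (comb_K $ (pr (pr 1 0) 0) :: nn \<leadsto> nn)"
    unfolding real_zero_def real_one_def by (intro val_real_of_rat val_pair num_vals)+
  show ?thesis
    unfolding in_unit_def sat_Conj sat_is_real[OF assms] sat_real_leq[OF v(1) assms] sat_real_leq[OF assms v(2)]
    by (auto simp: rle_def iu_def rv_01)
qed

lemma sat_AllR: "sat GM (All (i, T1) \<phi>) e \<longleftrightarrow> (\<forall>a::nn \<leadsto> nn. sat GM \<phi> (e((i, T1) := rp a)))"
  by (simp add: sdom_eqs)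

lemma sat_Imp: "sat M (Imp \<phi> \<psi>) e \<longleftrightarrow> (sat M \<phi> e \<longrightarrow> sat M \<psi> e)"
  by simp

lemma sat_continuous_unit:
  assumes F: "val GM e t = rp F"
  shows "sat GM (continuous_unit t) e \<longleftrightarrow> cu F"
proof -
  let ?j = "newvar [t]"
  let ?x = "(?j, T1)" and ?y = "(?j + 1, T1)" and ?k = "(?j + 2, N0)" and ?N = "(?j + 3, N0)"
  have 0: "sat GM (in_unit (Var ?x)) (e(?x := rp x)) \<longleftrightarrow> iu x" for x :: "nn \<leadsto> nn"
    by (rule sat_in_unit) simp
  have 1: "sat GM (Imp (in_unit (Var ?x)) (is_real (t \<cdot> Var ?x))) (e(?x := rp x)) \<longleftrightarrow> (iu x \<longrightarrow> isr (F $ x))" for x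
  proof -
    have "sat GM (is_real (t \<cdot> Var ?x)) (e(?x := rp x)) \<longleftrightarrow> isr (F $ x)"
      by (rule sat_is_real) (use F in \<open>simp add: sem\<close>)
    then show ?thesis unfolding sat_Imp 0 by blast
  qed
  have 2: "sat GM (Imp (in_unit (Var ?y)) (Imp (real_eq (Var ?x) (Var ?y)) (real_eq (t \<cdot> Var ?x) (t \<cdot> Var ?y))))
      (e(?x := rp x, ?y := rp y)) \<longleftrightarrow> (iu y \<longrightarrow> req x y \<longrightarrow> req (F $ x) (F $ y))" for x y
  proof -
    let ?e = "e(?x := rp x, ?y := rp y)"
    have "sat GM (in_unit (Var ?y)) ?e \<longleftrightarrow> iu y" by (rule sat_in_unit) simp
    moreover have "sat GM (real_eq (Var ?x) (Var ?y)) ?e \<longleftrightarrow> req x y" by (rule sat_real_eq) simp_all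
    moreover have "sat GM (real_eq (t \<cdot> Var ?x) (t \<cdot> Var ?y)) ?e \<longleftrightarrow> req (F $ x) (F $ y)"
      by (rule sat_real_eq) (use F in \<open>simp_all add: sem\<close>)
    ultimately show ?thesis unfolding sat_Imp by blast
  qed
  have 3: "sat GM (Imp (in_unit (Var ?y)) (Imp (real_dist_less (Var ?x) (Var ?y) (Var ?N))
        (real_dist_less (t \<cdot> Var ?x) (t \<cdot> Var ?y) (Var ?k))))
      (e(?x := rp x, ?k := rp k, ?N := rp N, ?y := rp y)) \<longleftrightarrow>
      (iu y \<longrightarrow> rdist x y N \<longrightarrow> rdist (F $ x) (F $ y) k)" for x y and k N :: nn
  proof -
    let ?e = "e(?x := rp x, ?k := rp k, ?N := rp N, ?y := rp y)"
    have "sat GM (in_unit (Var ?y)) ?e \<longleftrightarrow> iu y" by (rule sat_in_unit) simp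
    moreover have "sat GM (real_dist_less (Var ?x) (Var ?y) (Var ?N)) ?e \<longleftrightarrow> rdist x y N"
      by (rule sat_real_dist_less) simp_all
    moreover have "sat GM (real_dist_less (t \<cdot> Var ?x) (t \<cdot> Var ?y) (Var ?k)) ?e \<longleftrightarrow> rdist (F $ x) (F $ y) k"
      by (rule sat_real_dist_less) (use F in \<open>simp_all add: sem val_fresh_Suc_Suc\<close>)
    ultimately show ?thesis unfolding sat_Imp by blast
  qed
  show ?thesis
    unfolding continuous_unit_def Let_def sat_Conj sat_AllR cu_def 1
    unfolding sat_Imp[of _ "in_unit (Var ?x)"] sat_AllR sat_AllN sat_ExN 0 2 3 by blast
qed

section \<open>The meaning of the principles\<close>

lemma sat_AllSt:
  "srt TYPE('a::srt) = \<sigma> \<Longrightarrow> sat GM (AllSt (i, \<sigma>) \<phi>) e \<longleftrightarrow> (\<forall>a::'a. std a \<longrightarrow> sat GM \<phi> (e((i, \<sigma>) := rp a)))"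
  by (simp add: sdom_range[where 'a='a] std_def)

lemma sat_ExSt:
  "srt TYPE('a::srt) = \<sigma> \<Longrightarrow> sat GM (ExSt (i, \<sigma>) \<phi>) e \<longleftrightarrow> (\<exists>a::'a. std a \<and> sat GM \<phi> (e((i, \<sigma>) := rp a)))"
  by (simp add: sdom_range[where 'a='a] std_def)

lemma sat_All:
  "srt TYPE('a::srt) = \<sigma> \<Longrightarrow> sat GM (All (i, \<sigma>) \<phi>) e \<longleftrightarrow> (\<forall>a::'a. sat GM \<phi> (e((i, \<sigma>) := rp a)))"
  by (simp add: sdom_range[where 'a='a])

lemma sat_Ex:
  "srt TYPE('a::srt) = \<sigma> \<Longrightarrow> sat GM (Ex (i, \<sigma>) \<phi>) e \<longleftrightarrow> (\<exists>a::'a. sat GM \<phi> (e((i, \<sigma>) := rp a)))"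
  by (simp add: sdom_range[where 'a='a])

lemma sat_exists2: "sat GM exists2 e \<longleftrightarrow> (\<exists>\<phi>::(nn \<leadsto> nn) \<leadsto> nn. \<forall>g. (\<exists>x. g $ x = 0) \<longleftrightarrow> \<phi> $ g = 0)"
  unfolding exists2_def Let_def
  by (subst sat_Ex[where 'a="(nn \<leadsto> nn) \<leadsto> nn"], simp, subst sat_All[where 'a="nn \<leadsto> nn"], simp)
    (simp add: sdom_eqs sem opsf iff_conv_conj_imp)

lemma sat_TRANS:
  "sat GM Pi01_TRANS e \<longleftrightarrow> (\<forall>f::nn \<leadsto> nn. std f \<longrightarrow> (\<forall>n. std n \<longrightarrow> f $ n = 0) \<longrightarrow> (\<forall>n. f $ n = 0))"
  unfolding Pi01_TRANS_def Let_def
  by (subst sat_AllSt[where 'a="nn \<leadsto> nn"], simp) (simp add: sdom_eqs sem opsf std_def)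

end

definition max_at :: "((nn \<leadsto> nn) \<leadsto> nn \<leadsto> nn) \<Rightarrow> (nn \<leadsto> nn) \<Rightarrow> bool" where
  "max_at f x \<longleftrightarrow> iu x \<and> (\<forall>y. iu y \<longrightarrow> rle (f $ y) (f $ x))"

context gmodel
begin

lemma sat_max:
  assumes "val GM e t = rp f" "val GM e u = rp x" "(i, T1) \<notin> tvars t \<union> tvars u"
  shows "sat GM (Conj (in_unit u) (All (i, T1) (Imp (in_unit (Var (i, T1))) (real_leq (t \<cdot> Var (i, T1)) (t \<cdot> u))))) e
    \<longleftrightarrow> max_at f x"
proof -
  have v: "val GM (e((i, T1) := rp y)) t = rp f" "val GM (e((i, T1) := rp y)) u = rp x" for y :: "nn \<leadsto> nn"
    unfolding assms(1,2)[symmetric] by (rule val_cong; use assms(3) in auto)+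
  have "sat GM (Imp (in_unit (Var (i, T1))) (real_leq (t \<cdot> Var (i, T1)) (t \<cdot> u))) (e((i, T1) := rp y)) \<longleftrightarrow>
      (iu y \<longrightarrow> rle (f $ y) (f $ x))" for y
  proof -
    let ?e = "e((i, T1) := rp y)"
    have "sat GM (in_unit (Var (i, T1))) ?e \<longleftrightarrow> iu y" by (rule sat_in_unit) simp
    moreover have "sat GM (real_leq (t \<cdot> Var (i, T1)) (t \<cdot> u)) ?e \<longleftrightarrow> rle (f $ y) (f $ x)"
      by (rule sat_real_leq) (use v[of y] in \<open>simp_all add: sem\<close>)
    ultimately show ?thesis unfolding sat_Imp by blast
  qed
  then show ?thesis unfolding sat_Conj sat_AllR max_at_def sat_in_unit[OF assms(2)] by blast
qed

lemma sat_WEIMAX: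
  "sat GM WEIMAX_star e \<longleftrightarrow> (\<forall>f. std f \<longrightarrow> cu f \<longrightarrow> (\<exists>x. std x \<and> max_at f x))"
proof -
  let ?f = "(0, T1 \<Rrightarrow> T1)" and ?x = "(1, T1)"
  have 1: "sat GM (continuous_unit (Var ?f)) (e(?f := rp f)) \<longleftrightarrow> cu f" for f
    by (rule sat_continuous_unit) simp
  have 2: "sat GM (Conj (in_unit (Var ?x)) (All (2, T1) (Imp (in_unit (Var (2, T1)))
      (real_leq (Var ?f \<cdot> Var (2, T1)) (Var ?f \<cdot> Var ?x))))) (e(?f := rp f, ?x := rp x)) \<longleftrightarrow> max_at f x" for f x
    by (rule sat_max) auto
  have 3: "sat GM (AllSt ?f \<phi>) e \<longleftrightarrow> (\<forall>a::(nn \<leadsto> nn) \<leadsto> nn \<leadsto> nn. std a \<longrightarrow> sat GM \<phi> (e(?f := rp a)))"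
    "sat GM (ExSt ?x \<phi>) e' \<longleftrightarrow> (\<exists>a::nn \<leadsto> nn. std a \<and> sat GM \<phi> (e'(?x := rp a)))" for \<phi> e'
    by (rule sat_AllSt sat_ExSt; simp)+
  show ?thesis unfolding WEIMAX_star_def Let_def 3(1) unfolding sat_Imp[of _ "continuous_unit _"] 1 3(2) 2 ..
qed

lemma sat_UWEIMAX:
  "sat GM UWEIMAX e \<longleftrightarrow> (\<exists>\<Phi>. \<forall>f. cu f \<longrightarrow> max_at f (\<Phi> $ f))"
proof -
  let ?P = "(0, (T1 \<Rrightarrow> T1) \<Rrightarrow> T1)" and ?f = "(1, T1 \<Rrightarrow> T1)"
  have 1: "sat GM (continuous_unit (Var ?f)) (e(?P := rp \<Phi>, ?f := rp f)) \<longleftrightarrow> cu f"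
    for \<Phi> :: "((nn \<leadsto> nn) \<leadsto> nn \<leadsto> nn) \<leadsto> nn \<leadsto> nn" and f
    by (rule sat_continuous_unit) simp
  have 2: "sat GM (Conj (in_unit (Var ?P \<cdot> Var ?f)) (All (2, T1) (Imp (in_unit (Var (2, T1)))
      (real_leq (Var ?f \<cdot> Var (2, T1)) (Var ?f \<cdot> (Var ?P \<cdot> Var ?f)))))) (e(?P := rp \<Phi>, ?f := rp f)) \<longleftrightarrow> max_at f (\<Phi> $ f)"
    for \<Phi> f
    by (rule sat_max) (auto simp: rp_app)
  have 3: "sat GM (Ex ?P \<phi>) e \<longleftrightarrow>
      (\<exists>a::((nn \<leadsto> nn) \<leadsto> nn \<leadsto> nn) \<leadsto> nn \<leadsto> nn. sat GM \<phi> (e(?P := rp a)))"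
    "sat GM (All ?f \<phi>) e' \<longleftrightarrow> (\<forall>a::(nn \<leadsto> nn) \<leadsto> nn \<leadsto> nn. sat GM \<phi> (e'(?f := rp a)))" for \<phi> e'
    by (rule sat_Ex sat_All; simp)+
  show ?thesis unfolding UWEIMAX_def Let_def 3(1) unfolding 3(2) unfolding sat_Imp[of _ "continuous_unit _"] 1 2 ..
qed

end

section \<open>Syntactic properties of the formulas on real numbers\<close>

lemma wff_leq [simp]: "wft C s \<Longrightarrow> wft C t \<Longrightarrow> ty_of s = N0 \<Longrightarrow> ty_of t = N0 \<Longrightarrow> wff C (leq s t)"
  by (simp add: leq_def wft_monus)

lemma internal_order [simp]: "internal (leq s t)" "internal (less s t)"
  by (simp_all add: leq_def less_def)

lemma fv_order [simp]: "fv (leq s t) = tvars s \<union> tvars t" "fv (less s t) = tvars s \<union> tvars t"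
  by (simp_all add: leq_def less_def monus_def)

lemma wft_num [simp]: "wft C (num n)" "ty_of (num n) = N0" "tvars (num n) = {}"
  by (induction n) auto

lemma rat_cmp_syntax:
  assumes "R = leq \<or> R = less"
  shows "internal (rat_cmp R s u n t v m)"
    "fv (rat_cmp R s u n t v m) \<subseteq> tvars s \<union> tvars u \<union> tvars n \<union> tvars t \<union> tvars v \<union> tvars m"
    "(\<forall>x\<in>{s, u, n, t, v, m}. wft C x \<and> ty_of x = N0) \<Longrightarrow> wff C (rat_cmp R s u n t v m)"
  using assms by (auto simp: rat_cmp_def Let_def pair_def add_def mult_def pow2_def)

lemmas real_defs = is_real_def real_eq_def real_leq_def real_dist_less_def in_unit_def continuous_unit_def
  rat_dist_less_def rat_dist_leq_def Let_def

lemma internal_real [simp]: "internal (is_real x)" "internal (real_eq x y)" "internal (real_leq x y)"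
  "internal (real_dist_less x y t)" "internal (in_unit x)" "internal (continuous_unit f)"
  by (simp_all add: real_defs rat_cmp_syntax(1))

lemma wft_real_consts [simp]: "wft C real_zero" "wft C real_one" "ty_of real_zero = T1" "ty_of real_one = T1"
  "tvars real_zero = {}" "tvars real_one = {}"
  by (auto simp: real_zero_def real_one_def real_of_rat_def pair_def add_def)

lemma wff_real [simp]:
  assumes "wft C x" "wft C y" "ty_of x = T1" "ty_of y = T1"
  shows "wff C (is_real x)" "wff C (real_eq x y)" "wff C (real_leq x y)"
    "wft C t \<Longrightarrow> ty_of t = N0 \<Longrightarrow> wff C (real_dist_less x y t)"
    and wff_in_unit: "wff C (in_unit x)"
proof -
  have leq: "wff C (real_leq x y)" if "wft C x" "wft C y" "ty_of x = T1" "ty_of y = T1" for x y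
    using that by (simp add: real_leq_def Let_def rat_cmp_syntax(3))
  show "wff C (real_leq x y)" by (rule leq[OF assms])
  show real: "wff C (is_real x)" using assms
    by (auto simp add: is_real_def rat_dist_less_def Let_def add_def intro!: rat_cmp_syntax(3))
  show "wff C (real_eq x y)" using assms
    by (auto simp add: real_eq_def rat_dist_leq_def Let_def intro!: rat_cmp_syntax(3))
  show "wft C t \<Longrightarrow> ty_of t = N0 \<Longrightarrow> wff C (real_dist_less x y t)" using assms
    by (auto simp add: real_dist_less_def Let_def numeral_2_eq_2 intro!: rat_cmp_syntax(3))
  show "wff C (in_unit x)" using assms real leq[of real_zero x] leq[of x real_one] by (simp add: in_unit_def)
qed

lemma wff_continuous [simp]: "wft C f \<Longrightarrow> ty_of f = T1 \<Rrightarrow> T1 \<Longrightarrow> wff C (continuous_unit f)"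
  by (simp add: continuous_unit_def Let_def wff_in_unit[where y="Var (0, T1)"] wff_real(1)[where y="Var (0, T1)"] wff_real)

lemma fv_rat: "fv (rat_cmp leq s u n t v m) \<subseteq> tvars s \<union> tvars u \<union> tvars n \<union> tvars t \<union> tvars v \<union> tvars m"
  "fv (rat_cmp less s u n t v m) \<subseteq> tvars s \<union> tvars u \<union> tvars n \<union> tvars t \<union> tvars v \<union> tvars m"
  by (rule rat_cmp_syntax(2); simp)+

lemma fv_real: "fv (is_real x) \<subseteq> tvars x" "fv (real_eq x y) \<subseteq> tvars x \<union> tvars y"
  "fv (real_leq x y) \<subseteq> tvars x \<union> tvars y" "fv (real_dist_less x y t) \<subseteq> tvars x \<union> tvars y \<union> tvars t"
proof -
  show "fv (is_real x) \<subseteq> tvars x"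
    using fv_rat(2)[THEN subsetD] by (fastforce simp: is_real_def rat_dist_less_def Let_def add_def)
  show "fv (real_eq x y) \<subseteq> tvars x \<union> tvars y"
    using fv_rat(1)[THEN subsetD] by (fastforce simp: real_eq_def rat_dist_leq_def Let_def)
  show "fv (real_leq x y) \<subseteq> tvars x \<union> tvars y"
    using fv_rat(1)[THEN subsetD] by (fastforce simp: real_leq_def Let_def)
  show "fv (real_dist_less x y t) \<subseteq> tvars x \<union> tvars y \<union> tvars t"
    using fv_rat(2)[THEN subsetD] by (fastforce simp: real_dist_less_def Let_def)
qed

lemma fv_in_unit: "fv (in_unit x) \<subseteq> tvars x"
  using fv_real(1)[of x] fv_real(3)[of real_zero x] fv_real(3)[of x real_one] by (auto simp: in_unit_def)

lemma fv_continuous: "fv (continuous_unit f) \<subseteq> tvars f"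
proof -
  note s = fv_real[THEN subsetD] fv_in_unit[THEN subsetD]
  show ?thesis by (auto simp: continuous_unit_def Let_def dest!: s)
qed


section \<open>The equivalences in the model\<close>

context gmodel
begin

lemma HAC:
  fixes P :: "'a::srt \<Rightarrow> 'b::srt \<Rightarrow> bool"
  assumes "internal \<phi>" "wff (dom D) \<phi>" "srt TYPE('a) = \<sigma>" "srt TYPE('b) = \<tau>" "(i, \<sigma>) \<noteq> (j, \<tau>)"
    "(l, \<sigma> \<Rrightarrow> Seq \<tau>) \<notin> fv \<phi>" "typed_env GM e"
    and P: "\<And>x y. sat GM \<phi> (e((i, \<sigma>) := rp x, (j, \<tau>) := rp y)) \<longleftrightarrow> P x y"
    and ex: "\<And>x. std x \<Longrightarrow> \<exists>y. std y \<and> P x y"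
  shows "\<exists>F :: 'a \<leadsto> 'b sq. std F \<and> (\<forall>x. std x \<longrightarrow> (\<exists>k < lenS $ (F $ x). P x (projS $ (F $ x) $ k)))"
proof -
  let ?F = "(l, \<sigma> \<Rrightarrow> Seq \<tau>)" and ?x = "(i, \<sigma>)" and ?y = "(j, \<tau>)"
  \<comment> \<open>The type of the function variable is strictly larger than both others, so the
    variables differ whatever their names are.\<close>
  have F: "?F \<noteq> ?x" "?F \<noteq> ?y"
  proof -
    have "size \<sigma> < size (\<sigma> \<Rrightarrow> Seq \<tau>)" "size \<tau> < size (\<sigma> \<Rrightarrow> Seq \<tau>)" by simp_all
    then show "?F \<noteq> ?x" "?F \<noteq> ?y" by (metis less_irrefl prod.inject)+
  qed
  have "sat GM (Imp (AllSt ?x (ExSt ?y \<phi>))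
      (ExSt ?F (AllSt ?x (Ex ?y (Conj (elem \<tau> (Var ?y) (Var ?F \<cdot> Var ?x)) \<phi>))))) e"
    using HAC_int[of \<phi> D ?F ?x ?y] assms by (intro ax) auto
  moreover have "sat GM (AllSt ?x (ExSt ?y \<phi>)) e"
    unfolding sat_AllSt[OF assms(3)] sat_ExSt[OF assms(4)] P using ex by blast
  ultimately have "sat GM (ExSt ?F (AllSt ?x (Ex ?y (Conj (elem \<tau> (Var ?y) (Var ?F \<cdot> Var ?x)) \<phi>)))) e"
    unfolding sat_Imp by blast
  moreover have s: "srt TYPE('a \<leadsto> 'b sq) = \<sigma> \<Rrightarrow> Seq \<tau>" using assms by simp
  ultimately obtain F :: "'a \<leadsto> 'b sq" where "std F" and
    *: "sat GM (AllSt ?x (Ex ?y (Conj (elem \<tau> (Var ?y) (Var ?F \<cdot> Var ?x)) \<phi>))) (e(?F := rp F))"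
    unfolding sat_ExSt[OF s] by blast
  have "\<exists>k < lenS $ (F $ x). P x (projS $ (F $ x) $ k)" if x: "std x" for x
  proof -
    obtain y :: 'b where y: "sat GM (elem \<tau> (Var ?y) (Var ?F \<cdot> Var ?x)) (e(?F := rp F, ?x := rp x, ?y := rp y))"
      "sat GM \<phi> (e(?F := rp F, ?x := rp x, ?y := rp y))"
      using * x unfolding sat_AllSt[OF assms(3)] sat_Ex[OF assms(4)] sat_Conj by blast
    have "sat GM \<phi> (e(?x := rp x, ?y := rp y))"
      using y(2) assms(6) by (subst sat_cong[where e'="e(?F := rp F, ?x := rp x, ?y := rp y)"]) auto
    then have "P x y" using P by simp
    moreover have "\<exists>k < lenS $ (F $ x). y = projS $ (F $ x) $ k"
    proof -
      have "\<exists>k::nn. k < lenS $ (F $ x) \<and> EQ GM \<tau> (rp y) (rp (projS $ (F $ x) $ k))"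
        using y(1) F assms(5) rp_consts(10,11)[where 'a='b] assms(4) by (auto simp: sdom_eqs sem slt_iff)
      moreover have "rp z \<in> sdom GM \<tau>" for z :: 'b using rp_sdom[of z] assms(4) by simp
      ultimately show ?thesis using EQ_iff by auto
    qed
    ultimately show ?thesis by blast
  qed
  then show ?thesis using \<open>std F\<close> by blast
qed

text \<open>\<open>PF_TP\<close> for the negated formula: a nonempty class defined internally
  without parameters has a standard member.\<close>

lemma transfer:
  fixes P :: "'a::srt \<Rightarrow> bool"
  assumes "internal \<phi>" "wff (dom D) \<phi>" "fv \<phi> \<subseteq> {(i, \<sigma>)}" "srt TYPE('a) = \<sigma>" "typed_env GM e"
    and P: "\<And>x. sat GM \<phi> (e((i, \<sigma>) := rp x)) \<longleftrightarrow> P x"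
    and ex: "\<exists>x. P x"
  shows "\<exists>x. std x \<and> P x"
proof -
  have "sat GM (Imp (AllSt (i, \<sigma>) (Neg \<phi>)) (All (i, \<sigma>) (Neg \<phi>))) e"
    by (rule ax[OF PF_TP]) (use assms in auto)
  then show ?thesis
    unfolding sat_Imp[of _ "AllSt _ _"] unfolding sat_AllSt[OF assms(4)] unfolding sat_All[OF assms(4)]
    using ex by (simp add: P) blast
qed

abbreviation zeroR :: "nn \<leadsto> nn" where "zeroR \<equiv> comb_K $ 0"

lemma std_K_dfn [dfn_intros]: "dfn (\<lambda>_. comb_K :: 'a::srt \<leadsto> 'b::srt \<leadsto> 'a)"
  by (rule dfn_const[OF std_K])

definition E2 :: bool where "E2 \<longleftrightarrow> (\<exists>\<phi>::(nn \<leadsto> nn) \<leadsto> nn. \<forall>g. (\<exists>x. g $ x = 0) \<longleftrightarrow> \<phi> $ g = 0)"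

text \<open>
  The indicator of the first zero of a standard function is standard. Hence the first \<open>n\<close> at which \<open>Y\<close>
  fails to distinguish the indicator of \<open>n\<close> from zero would be the first zero of a standard function,
  at which \<open>Y\<close> does not fail.
\<close>

lemma E2_from_standard:
  assumes Y: "std (Y :: (nn \<leadsto> nn) \<leadsto> nn)" "Y $ zeroR = 0" "\<And>h n. std h \<Longrightarrow> h $ n \<noteq> 0 \<Longrightarrow> Y $ h \<noteq> 0"
  shows E2
proof -
  note dY = dfn_const[OF Y(1)]
  obtain ind :: "nn \<leadsto> nn \<leadsto> nn" where ind: "std ind" "\<And>n i. ind $ n $ i = (if i = n then 1 else 0)"
  proof -
    have "\<exists>f. std f \<and> (\<forall>(n::nn) i. f $ n $ i = (if i = n then 1 else 0 :: nn))" by (rule rep2, intro dfn_intros)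
    then show thesis using that by blast
  qed
  \<comment> \<open>\<open>fz $ a\<close> is the indicator of the first zero of \<open>a\<close>, or
    constantly 0 if there is none. Its definition uses bounded quantifiers only, so nothing has to
    be decided about the existence of a zero.\<close>
  obtain fz :: "(nn \<leadsto> nn) \<leadsto> nn \<leadsto> nn"
    where fz: "std fz" "\<And>a i. fz $ a $ i = (if a $ i = 0 \<and> (\<forall>j<i. \<not> a $ j = 0) then 1 else 0)"
  proof -
    have "\<exists>f. std f \<and> (\<forall>(a::nn \<leadsto> nn) i. f $ a $ i = (if a $ i = 0 \<and> (\<forall>j<i. \<not> a $ j = 0) then 1 else 0 :: nn))"
      by (rule rep2, intro dfn_intros)
    then show thesis using that by blast
  qed
  have fz_ind: "fz $ a = ind $ n" if "a $ n = 0" "\<forall>j<n. \<not> a $ j = 0" for a n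
    using that by (intro ext) (auto simp: fz ind, meson linorder_neqE)
  have fz_zero: "fz $ a = zeroR" if "\<forall>n. a $ n \<noteq> 0" for a
    using that by (intro ext) (auto simp: fz)
  have least: "\<exists>m. a $ m = 0 \<and> (\<forall>j<m. \<not> a $ j = 0)" if "a $ n = 0" for a :: "nn \<leadsto> nn" and n
    using dpr_least[of "\<lambda>c n. snd c $ n = 0" "((), a)" n] that by (simp add: dfn_intros)
  show E2
  proof (cases "\<forall>n. Y $ (ind $ n) \<noteq> 0")
    case True
    \<comment> \<open>The values are swapped: in (exists^2) the value 0 announces a zero, whereas
      \<open>Y\<close> is nonzero at the indicators.\<close>
    obtain \<phi> :: "(nn \<leadsto> nn) \<leadsto> nn" where \<phi>: "\<And>a. \<phi> $ a = (if Y $ (fz $ a) = 0 then 1 else 0)"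
    proof -
      have "\<exists>f. std f \<and> (\<forall>a. f $ a = (if Y $ (fz $ a) = 0 then 1 else 0 :: nn))"
        by (rule rep1, intro dfn_intros dY dfn_const[OF fz(1)])
      then show thesis using that by blast
    qed
    have "(\<exists>x. g $ x = 0) \<longleftrightarrow> \<phi> $ g = 0" for g
    proof (cases "\<exists>x. g $ x = 0")
      case ex: True
      then obtain m where "fz $ g = ind $ m" using least fz_ind by blast
      then show ?thesis using ex True by (simp add: \<phi>)
    next
      case False
      then have "fz $ g = zeroR" by (intro fz_zero) simp
      then show ?thesis using False Y(2) by (simp add: \<phi>)
    qed
    then show ?thesis by (auto simp: E2_def)
  next
    case False
    obtain \<beta> :: "nn \<leadsto> nn" where \<beta>: "std \<beta>" "\<And>n. \<beta> $ n = Y $ (ind $ n)"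
    proof -
      have "\<exists>f. std f \<and> (\<forall>n. f $ n = Y $ (ind $ n))"
        by (rule rep1, intro dfn_intros dY dfn_const[OF ind(1)])
      then show thesis using that by blast
    qed
    obtain n where "\<beta> $ n = 0" using False \<beta>(2) by auto
    then obtain N where N: "\<beta> $ N = 0" "\<forall>j<N. \<not> \<beta> $ j = 0" using least by blast
    \<comment> \<open>Nothing is known about the standardness of \<open>N\<close> itself; but its
      indicator is \<open>fz $ \<beta>\<close>, which is standard because \<open>fz\<close> and
      \<open>\<beta>\<close> are.\<close>
    have "Y $ (fz $ \<beta>) \<noteq> 0"
      using Y(3)[of "fz $ \<beta>" N] std_app[OF fz(1) \<beta>(1)] fz_ind[OF N] by (simp add: ind)
    then show ?thesis using fz_ind[OF N] N(1) \<beta>(2) by simp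
  qed
qed

definition TRANS :: bool where
  "TRANS \<longleftrightarrow> (\<forall>f::nn \<leadsto> nn. std f \<longrightarrow> (\<forall>n. std n \<longrightarrow> f $ n = 0) \<longrightarrow> (\<forall>n. f $ n = 0))"

text \<open>Transfer gives each standard sequence that is not identically zero a standard nonzero
  place. \<open>HAC_int\<close> lists candidates for such a place, and inspecting the list separates
  the zero sequence from these sequences.\<close>

lemma TRANS_imp_E2: assumes TRANS shows E2
proof -
  let ?f = "(0, T1)" and ?n = "(1, N0)"
  let ?\<phi> = "Imp (Eq (Var ?f \<cdot> Var ?n) zero) (All (2, N0) (Eq (Var ?f \<cdot> Var (2, N0)) zero))"
  obtain e where e: "typed_env GM e" using env_ex ..
  have "\<exists>F :: (nn \<leadsto> nn) \<leadsto> nn sq. std F \<and> (\<forall>x. std x \<longrightarrow>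
      (\<exists>k < lenS $ (F $ x). x $ (projS $ (F $ x) $ k) = 0 \<longrightarrow> (\<forall>n. x $ n = 0)))"
  proof (rule HAC[where \<phi>="?\<phi>" and i=0 and \<sigma>=T1 and j=1 and \<tau>=N0 and l=3 and e=e])
    show "sat GM ?\<phi> (e((0, T1) := rp x, (1, N0) := rp y)) \<longleftrightarrow> (x $ y = 0 \<longrightarrow> (\<forall>n. x $ n = 0))"
      for x :: "nn \<leadsto> nn" and y by (simp add: sdom_eqs sem opsf)
    \<comment> \<open>If \<open>x\<close> vanishes everywhere, the standard number 0 serves as a
      default.\<close>
    show "\<exists>y. std y \<and> (x $ y = 0 \<longrightarrow> (\<forall>n. x $ n = 0))" if "std x" for x :: "nn \<leadsto> nn"
      using assms that std_consts(1) unfolding TRANS_def by metis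
  qed (use e in auto)
  then obtain F :: "(nn \<leadsto> nn) \<leadsto> nn sq" where F: "std F"
    "\<And>x. std x \<Longrightarrow> \<exists>k < lenS $ (F $ x). x $ (projS $ (F $ x) $ k) = 0 \<longrightarrow> (\<forall>n. x $ n = 0)" by blast
  obtain Y :: "(nn \<leadsto> nn) \<leadsto> nn" where Y: "std Y"
    "\<And>h. Y $ h = (if \<exists>k < lenS $ (F $ h). \<not> h $ (projS $ (F $ h) $ k) = 0 then 1 else 0)"
  proof -
    have "\<exists>f. std f \<and> (\<forall>h. f $ h = (if \<exists>k < lenS $ (F $ h). \<not> h $ (projS $ (F $ h) $ k) = 0 then 1 else 0 :: nn))"
      by (rule rep1, intro dfn_intros dfn_const[OF F(1)])
    then show thesis using that by blast
  qed
  show ?thesis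
  proof (rule E2_from_standard[OF Y(1)])
    show "Y $ zeroR = 0" by (simp add: Y)
    show "Y $ h \<noteq> 0" if "std h" "h $ n \<noteq> 0" for h n using F(2)[OF that(1)] that(2) by (auto simp: Y)
  qed
qed

text \<open>Feferman's search operator: it returns a zero, where the functional of (exists^2) only
  reports that one exists.\<close>

definition is_mu :: "((nn \<leadsto> nn) \<leadsto> nn) \<Rightarrow> bool" where
  "is_mu \<mu> \<longleftrightarrow> (\<forall>g n. g $ n = 0 \<longrightarrow> g $ (\<mu> $ g) = 0)"

text \<open>With a functional \<open>\<phi>\<close> of (exists^2) as parameter, the formula
  \<open>\<phi> g = 0 \<longrightarrow> g n = 0\<close> is quantifier-free, so choice applies to it.
  The operator obtained need not be standard, but its defining property has no parameters, and
  \<open>transfer\<close> supplies a standard one.\<close>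

lemma E2_imp_mu: assumes E2 shows "\<exists>\<mu>. std \<mu> \<and> is_mu \<mu>"
proof -
  obtain e where e: "typed_env GM e" using env_ex ..
  obtain \<phi> :: "(nn \<leadsto> nn) \<leadsto> nn" where \<phi>: "\<And>g. (\<exists>x. g $ x = 0) \<longleftrightarrow> \<phi> $ g = 0" using assms unfolding E2_def by blast
  let ?g = "(1, T1)" and ?n = "(2, N0)" and ?F = "(3, T2)" and ?p = "(0, T2)"
  let ?\<psi> = "Imp (Eq (Var ?p \<cdot> Var ?g) zero) (Eq (Var ?g \<cdot> Var ?n) zero)"
  have 1: "sat GM (Imp (All ?g (Ex ?n ?\<psi>)) (Ex ?F (All ?g (subst ?n (Var ?F \<cdot> Var ?g) ?\<psi>)))) (e(?p := rp \<phi>))"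
    by (rule ax[OF base[OF qf_ac]]) (use e in \<open>auto simp: typed_env_upd\<close>)
  have 2: "sat GM (All ?g (Ex ?n ?\<psi>)) (e(?p := rp \<phi>))" using \<phi> by (auto simp: sdom_eqs sem opsf)
  have "sat GM (Ex ?F (All ?g (subst ?n (Var ?F \<cdot> Var ?g) ?\<psi>))) (e(?p := rp \<phi>))"
    using 1 2 unfolding sat_Imp by blast
  then obtain \<mu> :: "(nn \<leadsto> nn) \<leadsto> nn" where "\<And>g. \<phi> $ g = 0 \<longrightarrow> g $ (\<mu> $ g) = 0"
    by (auto simp: sdom_eqs sem opsf)
  then have ex: "\<exists>\<mu>. is_mu \<mu>" unfolding is_mu_def using \<phi> by blast
  let ?\<chi> = "All ?g (All ?n (Imp (Eq (Var ?g \<cdot> Var ?n) zero) (Eq (Var ?g \<cdot> (Var ?p \<cdot> Var ?g)) zero)))"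
  show ?thesis
    by (rule transfer[where \<phi>="?\<chi>" and i=0 and \<sigma>=T2, OF _ _ _ _ e _ ex])
      (auto simp: sdom_eqs sem opsf is_mu_def)
qed

text \<open>A standard search operator, applied to the standard function that is 0 where
  \<open>f\<close> is not, returns a standard counterexample.\<close>

lemma E2_imp_TRANS: assumes E2 shows TRANS
  unfolding TRANS_def
proof (intro allI impI, rule ccontr)
  fix f :: "nn \<leadsto> nn" and n
  assume f: "std f" "\<forall>n. std n \<longrightarrow> f $ n = 0" "f $ n \<noteq> 0"
  obtain \<mu> where \<mu>: "std \<mu>" "is_mu \<mu>" using E2_imp_mu[OF assms] by blast
  obtain g :: "nn \<leadsto> nn" where g: "std g" "\<And>n. g $ n = (if f $ n = 0 then 1 else 0)"
  proof -
    have "\<exists>h. std h \<and> (\<forall>n. h $ n = (if f $ n = 0 then 1 else 0 :: nn))"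
      by (rule rep1, intro dfn_intros dfn_const[OF f(1)])
    then show thesis using that by blast
  qed
  have "g $ n = 0" using f by (simp add: g)
  then have "g $ (\<mu> $ g) = 0" using \<mu>(2) by (auto simp: is_mu_def)
  moreover have "f $ (\<mu> $ g) = 0" using f(2) std_app[OF \<mu>(1) g(1)] by blast
  ultimately show False by (simp add: g)
qed

end

section \<open>Approximate comparison of reals\<close>

text \<open>The relation x <= y + \<open>\<epsilon>\<close> between reals, which becomes
  \<open>rle\<close> for slack 0. Its only quantifier ranges over numbers, so a search operator
  decides it.\<close>

definition lew :: "(nn \<leadsto> nn) \<Rightarrow> (nn \<leadsto> nn) \<Rightarrow> qq \<Rightarrow> bool" where
  "lew x y \<epsilon> \<longleftrightarrow> (\<forall>n. rv (x $ n) \<le> rv (y $ n) + \<epsilon> + 2 * w n)"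

context gmodel
begin

lemma isr_near: assumes "isr x" "n \<le> m" shows "rv (x $ n) < rv (x $ m) + w n" "rv (x $ m) < rv (x $ n) + w n"
proof -
  obtain d where "m = n + d" using assms(2) by (auto simp: nn_le_iff)
  then have "\<bar>rv (x $ n) - rv (x $ m)\<bar> < w n" using assms(1) by (auto simp: isr_def)
  then show "rv (x $ n) < rv (x $ m) + w n" "rv (x $ m) < rv (x $ n) + w n" by linarith+
qed

text \<open>The \<open>w n\<close> fall below every positive element of \<open>qq\<close>,
  nonstandard ones included.\<close>

lemma le_w4: assumes "\<And>n. a \<le> b + 4 * w n" shows "a \<le> b"
proof (rule ccontr)
  assume "\<not> a \<le> b"
  then obtain n where "w n < (a - b) / 4" using w_arch[of "(a - b) / 4"] by auto
  then show False using assms[of n] by (simp add: field_simps)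
qed

text \<open>A gap of \<open>2 * w n\<close> at one stage absorbs the errors of both approximations
  at all later stages; at an earlier stage \<open>m\<close> the allowance \<open>2 * w m\<close>
  does.\<close>

lemma lew_from_gap:
  assumes "isr x" "isr y" "rv (x $ n) + 2 * w n \<le> rv (y $ n) + \<epsilon>"
  shows "lew x y \<epsilon>"
  unfolding lew_def
proof
  fix m
  show "rv (x $ m) \<le> rv (y $ m) + \<epsilon> + 2 * w m"
  proof (cases "n \<le> m")
    case True
    then show ?thesis using isr_near(2)[OF assms(1) True] isr_near(1)[OF assms(2) True] assms(3) w_pos(1)[of m]
      by linarith
  next
    case False
    then have "m \<le> n" by simp
    then show ?thesis using isr_near(1)[OF assms(1) \<open>m \<le> n\<close>] isr_near(2)[OF assms(2) \<open>m \<le> n\<close>] assms(3) w_pos(1)[of n]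
      by linarith
  qed
qed

lemma lew_total: assumes "isr x" "isr y" "\<not> lew x y \<epsilon>" "0 \<le> \<epsilon>" shows "lew y x 0"
proof -
  obtain n where "rv (y $ n) + \<epsilon> + 2 * w n < rv (x $ n)" using assms(3) by (auto simp: lew_def not_le)
  then show ?thesis using assms by (intro lew_from_gap[of _ _ n]) linarith+
qed

text \<open>The comparison through \<open>y\<close> takes place at the late stage
  \<open>m + n\<close>, where its error is at most \<open>4 * w n\<close>; \<open>le_w4\<close> then
  removes this error.\<close>

lemma lew_trans:
  assumes "isr x" "isr z" "lew x y \<epsilon>" "lew y z \<delta>"
  shows "lew x z (\<epsilon> + \<delta>)"
  unfolding lew_def
proof
  fix m
  show "rv (x $ m) \<le> rv (z $ m) + (\<epsilon> + \<delta>) + 2 * w m"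
  proof (rule le_w4)
    fix n
    have "m \<le> m + n" by (simp add: nn_le_iff)
    then have "rv (x $ m) < rv (x $ (m + n)) + w m" "rv (z $ (m + n)) < rv (z $ m) + w m"
      using isr_near assms by blast+
    moreover have "rv (x $ (m + n)) \<le> rv (y $ (m + n)) + \<epsilon> + 2 * w (m + n)"
      "rv (y $ (m + n)) \<le> rv (z $ (m + n)) + \<delta> + 2 * w (m + n)" using assms by (auto simp: lew_def)
    moreover have "w (m + n) \<le> w n" using w_add[of n m] by (simp add: add.commute)
    ultimately show "rv (x $ m) \<le> rv (z $ m) + (\<epsilon> + \<delta>) + 2 * w m + 4 * w n" by linarith
  qed
qed

lemma lew_refl: "0 \<le> \<epsilon> \<Longrightarrow> lew x x \<epsilon>"
  by (simp add: lew_def)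

lemma lew_mono: "lew x y \<epsilon> \<Longrightarrow> \<epsilon> \<le> \<delta> \<Longrightarrow> lew x y \<delta>"
  unfolding lew_def by (meson add_left_mono add_right_mono order_trans)

lemma rdist_lew: assumes "isr x" "isr y" "rdist x y k" shows "lew x y (w k)" "lew y x (w k)"
proof -
  obtain n where n: "\<bar>rv (x $ n) - rv (y $ n)\<bar> + 2 * w n < w k" using assms(3) by (auto simp: rdist_def)
  show "lew x y (w k)" by (rule lew_from_gap[OF assms(1,2), of n]) (use n in linarith)
  show "lew y x (w k)" by (rule lew_from_gap[OF assms(2,1), of n]) (use n in linarith)
qed

lemma lew_rle: assumes "\<And>k. lew x y (3 * w k)" shows "rle x y"
  unfolding rle_def
proof
  fix n
  show "rv (x $ n) \<le> rv (y $ n) + 2 * w n"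
  proof (rule le_w4)
    fix k
    show "rv (x $ n) \<le> rv (y $ n) + 2 * w n + 4 * w k"
      using assms[of k, unfolded lew_def, rule_format, of n] w_pos(1)[of k] by linarith
  qed
qed

lemma iu_const: "0 \<le> rv p \<Longrightarrow> rv p \<le> 1 \<Longrightarrow> iu (comb_K $ p)"
  unfolding iu_def isr_def using w_pos by (auto simp: add_nonneg_nonneg add_increasing2)


section \<open>Arithmetical comprehension gives maxima\<close>

text \<open>A standard search operator closes definability under unbounded number quantifiers: the
  predicate is tested at the one place that \<open>\<mu>\<close> returns for its characteristic
  function.\<close>

lemma dpr_ex:
  fixes P :: "'c::ctx \<Rightarrow> nn \<Rightarrow> bool"
  assumes \<mu>: "std \<mu>" "is_mu \<mu>" and P: "dpr (\<lambda>d. P (fst d) (snd d))"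
  shows "dpr (\<lambda>c. \<exists>n. P c n)" "dpr (\<lambda>c. \<forall>n. P c n)"
proof -
  have *: "dpr (\<lambda>c. \<exists>n. P c n)" if P: "dpr (\<lambda>d. P (fst d) (snd d))" for P :: "'c \<Rightarrow> nn \<Rightarrow> bool"
  proof -
    define \<chi> where "\<chi> c = (\<Lambda> n. (if P c n then 0 else 1 :: nn))" for c
    have d: "dfn (\<lambda>d. if P (fst d) (snd d) then 0 else 1 :: nn)" using P by (simp add: dpr_def)
    have \<chi>: "\<chi> c $ n = (if P c n then 0 else 1)" for c n
      unfolding \<chi>_def by (rule beta[of "\<lambda>c n. if P c n then 0 else 1"], rule d)
    have "(\<exists>n. P c n) \<longleftrightarrow> \<chi> c $ (\<mu> $ (\<chi> c)) = 0" for c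
      using \<mu>(2) \<chi>[of c] unfolding is_mu_def by (metis zero_neq_one)
    moreover have "dfn \<chi>" unfolding \<chi>_def[abs_def] using dfn_LAM[of "\<lambda>c n. if P c n then 0 else 1 :: nn", OF d] .
    then have "dpr (\<lambda>c. \<chi> c $ (\<mu> $ (\<chi> c)) = 0)" by (intro dfn_intros dfn_const[OF \<mu>(1)])
    ultimately show ?thesis by simp
  qed
  show "dpr (\<lambda>c. \<exists>n. P c n)" by (rule *[OF P])
  have "dpr (\<lambda>c. \<not> (\<exists>n. \<not> P c n))" by (intro dfn_intros * P)
  then show "dpr (\<lambda>c. \<forall>n. P c n)" by simp
qed

lemma dra_weaken: "dra F \<Longrightarrow> dra (\<lambda>c. F (fst c))"
proof -
  assume "dra F"
  then obtain X where "dfn X" "\<And>c. F c = rv (X c)" unfolding dra_def by auto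
  then show ?thesis unfolding dra_def using dfn_weaken[of X] by auto
qed

lemma two_w: "2 * w n = w n + w n" by simp

end

definition seg :: "nn \<Rightarrow> nn \<Rightarrow> nn \<Rightarrow> bool" where
  "seg n a p \<longleftrightarrow> q a * w n \<le> rv p \<and> rv p \<le> (q a + 1) * w n"

text \<open>Compares the supremum over \<open>A\<close> with the supremum over \<open>B\<close>
  without forming either. Points are codes of rationals, so that a search operator can decide the
  relation.\<close>

definition dominated :: "((nn \<leadsto> nn) \<leadsto> nn \<leadsto> nn) \<Rightarrow> (nn \<Rightarrow> bool) \<Rightarrow> (nn \<Rightarrow> bool) \<Rightarrow> bool" where
  "dominated f A B \<longleftrightarrow> (\<forall>p. A p \<longrightarrow> (\<forall>k. \<exists>p'. B p' \<and> lew (f $ (comb_K $ p)) (f $ (comb_K $ p')) (w k)))"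

text \<open>Numerators are recorded instead of endpoints, which keeps the recursion within type 0:
  halving a segment turns \<open>a\<close> into \<open>a + a\<close> or
  \<open>a + a + 1\<close>.\<close>

definition left_end :: "((nn \<leadsto> nn) \<leadsto> nn \<leadsto> nn) \<Rightarrow> nn \<Rightarrow> nn" where
  "left_end f n = nrec n 0 (\<lambda>a m.
     if dominated f (seg (m + 1) (a + a + 1)) (seg (m + 1) (a + a)) then a + a else a + a + 1)"

context gmodel
begin

lemma dfn_seg [dfn_intros]: "dfn N \<Longrightarrow> dfn A \<Longrightarrow> dfn P \<Longrightarrow> dpr (\<lambda>c. seg (N c) (A c) (P c))"
  unfolding seg_def by (intro dfn_intros)

context
  fixes \<mu> assumes \<mu>: "std \<mu>" "is_mu \<mu>"
begin

lemma dpr_lew: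
  assumes X: "dfn X" and Y: "dfn Y" and E: "dra E"
  shows "dpr (\<lambda>c. lew (X c) (Y c) (E c))"
  unfolding lew_def two_w
  by (intro dpr_ex[OF \<mu>] dfn_intros dfn_weaken[OF X] dfn_weaken[OF Y] dra_weaken[OF E])

lemma dpr_dominated:
  assumes f: "dfn f" and A: "dpr (\<lambda>d. A (fst d) (snd d))" and B: "dpr (\<lambda>d. B (fst d) (snd d))"
  shows "dpr (\<lambda>c. dominated (f c) (A c) (B c))"
  unfolding dominated_def
  by (intro dpr_ex[OF \<mu>] dfn_intros dpr_lew A dpr_subst(4)[OF B] dfn_weaken[OF dfn_weaken[OF dfn_weaken[OF f]]])

lemma dfn_left_end:
  assumes f: "dfn f" and N: "dfn N"
  shows "dfn (\<lambda>c. left_end (f c) (N c))"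
  unfolding left_end_def
  by (intro dfn_intros N dpr_dominated dfn_weaken[OF dfn_weaken[OF f]])

lemma left_end:
  "left_end f 0 = 0"
  "left_end f (n + 1) = (let a = left_end f n in
     if dominated f (seg (n + 1) (a + a + 1)) (seg (n + 1) (a + a)) then a + a else a + a + 1)"
proof -
  let ?F = "\<lambda>c a m. if dominated (snd c) (seg (m + 1) (a + a + 1)) (seg (m + 1) (a + a)) then a + a else a + a + 1"
  have "dfn (\<lambda>d. ?F (fst (fst d) :: unit \<times> _) (snd (fst d)) (snd d))"
    by (intro dfn_intros dpr_dominated)
  note * = nrec[where F="?F" and c="((), f)", OF this]
  show "left_end f 0 = 0" "left_end f (n + 1) = (let a = left_end f n in
     if dominated f (seg (n + 1) (a + a + 1)) (seg (n + 1) (a + a)) then a + a else a + a + 1)"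
    unfolding left_end_def Let_def using *(1)[of 0] *(2)[of n 0] by simp_all
qed

definition le :: "((nn \<leadsto> nn) \<leadsto> nn \<leadsto> nn) \<Rightarrow> nn \<Rightarrow> qq" where "le f n = q (left_end f n) * w n"

lemma le_0: "le f 0 = 0" by (simp add: le_def left_end)

lemma le_S: "le f n \<le> le f (n + 1)" "le f (n + 1) + w (n + 1) \<le> le f n + w n"
proof -
  let ?a = "left_end f n"
  define v where "v = w (n + 1)"
  obtain b where b: "left_end f (n + 1) = b" "b = ?a + ?a \<or> b = ?a + ?a + 1" by (simp add: left_end Let_def)
  have "0 < v" "le f n = q ?a * (v + v)" "le f (n + 1) = q b * v" "w n = v + v"
    using w_double[of n] by (simp_all only: v_def w_pos le_def b(1) two_w)
  then show "le f n \<le> le f (n + 1)" "le f (n + 1) + w (n + 1) \<le> le f n + w n"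
    using b(2) unfolding v_def[symmetric] by (auto simp: algebra_simps)
qed

lemma dra_le: "dfn f \<Longrightarrow> dfn N \<Longrightarrow> dra (\<lambda>c. le (f c) (N c))"
  unfolding le_def by (intro dfn_intros dfn_left_end)

lemma le_nested: "le f n \<le> le f (n + d) \<and> le f (n + d) + w (n + d) \<le> le f n + w n"
proof (rule dpr_induct[where P="\<lambda>c d. le (snd (fst c)) (snd c) \<le> le (snd (fst c)) (snd c + d) \<and>
      le (snd (fst c)) (snd c + d) + w (snd c + d) \<le> le (snd (fst c)) (snd c) + w (snd c)" and c="(((), f), n)", simplified])
  fix d assume "le f n \<le> le f (n + d) \<and> le f (n + d) + w (n + d) \<le> le f n + w n"
  then show "le f n \<le> le f (n + (d + 1)) \<and> le f (n + (d + 1)) + w (n + (d + 1)) \<le> le f n + w n"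
    using le_S[of f "n + d"] by (auto simp flip: add.assoc)
qed (intro dfn_intros dra_le)

lemma le_range: "0 \<le> le f n" "le f n + w n \<le> 1"
  using le_nested[of f 0 n] by (simp_all add: le_0)

lemma seg_le: "seg n (left_end f n) p \<longleftrightarrow> le f n \<le> rv p \<and> rv p \<le> le f n + w n"
  by (simp add: seg_def le_def algebra_simps)

text \<open>The invariant of the bisection; it is definable from \<open>\<mu>\<close>, so induction
  in the model applies. If the left half does not dominate the right one, some right point exceeds
  all left points, and so the right half dominates the left one.\<close>

lemma max_dominates:
  assumes f: "cu f"
  shows "dominated f (\<lambda>p. 0 \<le> rv p \<and> rv p \<le> 1) (seg n (left_end f n))"
proof (rule dpr_induct[where P="\<lambda>c n. dominated (snd c) (\<lambda>p. 0 \<le> rv p \<and> rv p \<le> 1) (seg n (left_end (snd c) n))" and c="((), f)", simplified])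
  show "dpr (\<lambda>d. dominated (snd (fst d)) (\<lambda>p. 0 \<le> rv p \<and> rv p \<le> 1) (seg (snd d) (left_end (snd (fst d)) (snd d))))"
    by (intro dpr_dominated dfn_intros dfn_left_end)
  show "dominated f (\<lambda>p. 0 \<le> rv p \<and> rv p \<le> 1) (seg 0 (left_end f 0))"
    unfolding dominated_def seg_le le_0 using lew_refl[OF w_pos(2)] by auto
  fix n
  assume IH: "dominated f (\<lambda>p. 0 \<le> rv p \<and> rv p \<le> 1) (seg n (left_end f n))"
  let ?a = "left_end f n"
  let ?L = "seg (n + 1) (?a + ?a)" and ?R = "seg (n + 1) (?a + ?a + 1)" and ?c = "\<lambda>p. f $ (comb_K $ p)"
  define v where "v = w (n + 1)"
  have v: "0 < v" "w n = v + v" using w_double[of n] by (simp_all only: v_def w_pos two_w)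
  have split: "?L p \<or> ?R p" if "seg n ?a p" for p
    using that unfolding seg_def v(2) v_def[symmetric] by (auto simp: algebra_simps)
  have range: "0 \<le> rv p \<and> rv p \<le> 1" if "?L p \<or> ?R p" for p
  proof -
    have "le f n \<le> rv p \<and> rv p \<le> le f n + w n" using that v(1) unfolding seg_def le_def v(2) v_def[symmetric] by (auto simp: algebra_simps)
    then show ?thesis using le_range[of f n] by linarith
  qed
  have isr: "isr (?c p)" if "0 \<le> rv p \<and> rv p \<le> 1" for p
    using f iu_const that by (auto simp: cu_def)
  \<comment> \<open>Two comparisons with slack \<open>w (k + 1)\<close> add up to one with slack
    \<open>w k\<close>.\<close>
  have trans: "lew (?c p) (?c r) (w k)"
    if "lew (?c p) (?c p') (w (k + 1))" "lew (?c p') (?c r) (w (k + 1))"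
      "0 \<le> rv p \<and> rv p \<le> 1" "0 \<le> rv r \<and> rv r \<le> 1" for p p' r k
    using lew_trans[OF isr isr that(1,2)] that(3,4) by (simp add: w_S)
  show "dominated f (\<lambda>p. 0 \<le> rv p \<and> rv p \<le> 1) (seg (n + 1) (left_end f (n + 1)))"
    unfolding dominated_def
  proof (intro allI impI)
    fix p k assume p: "0 \<le> rv p \<and> rv p \<le> 1"
    obtain p' where p': "seg n ?a p'" "lew (?c p) (?c p') (w (k + 1))"
      using IH p unfolding dominated_def by blast
    show "\<exists>r. seg (n + 1) (left_end f (n + 1)) r \<and> lew (?c p) (?c r) (w k)"
    proof (cases "dominated f ?R ?L")
      case True
      then have e: "left_end f (n + 1) = ?a + ?a" by (simp add: left_end Let_def)
      have "\<exists>r. ?L r \<and> lew (?c p') (?c r) (w (k + 1))"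
        using split[OF p'(1)] True lew_refl[OF w_pos(2)] unfolding dominated_def by blast
      then show ?thesis unfolding e using trans[OF p'(2)] p range by blast
    next
      case False
      then have e: "left_end f (n + 1) = ?a + ?a + 1" by (simp add: left_end Let_def)
      \<comment> \<open>The value at \<open>s\<close> exceeds every value on the left half by more
        than \<open>w j\<close>; thus \<open>s\<close> can replace any point of the left
        half.\<close>
      obtain s j where s: "?R s" "\<forall>r. ?L r \<longrightarrow> \<not> lew (?c s) (?c r) (w j)"
        using False unfolding dominated_def by blast
      have "\<exists>r. ?R r \<and> lew (?c p') (?c r) (w (k + 1))"
      proof (cases "?R p'")
        case True
        then show ?thesis using lew_refl[OF w_pos(2)] by blast
      next
        case False
        then have "?L p'" using split[OF p'(1)] by blast
        then have "lew (?c p') (?c s) 0"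
          using s lew_total[OF isr isr _ w_pos(2)] range by blast
        then show ?thesis using s(1) lew_mono w_pos(2) by blast
      qed
      then show ?thesis unfolding e using trans[OF p'(2)] p range by blast
    qed
  qed
qed

text \<open>The left ends already converge at the required rate. A value at \<open>y\<close> is
  compared with the value at the limit through a rational near \<open>y\<close> and a rational of a
  small kept segment; each of the three passages costs \<open>w k\<close>.\<close>

lemma mu_imp_max: "\<exists>\<Phi>. \<forall>f. cu f \<longrightarrow> max_at f (\<Phi> $ f)"
proof -
  have "\<exists>\<Phi>. std \<Phi> \<and> (\<forall>f n. \<Phi> $ f $ n = pr (pr (left_end f n) 0) (p2 n - 1))"
    by (rule rep2, intro dfn_intros dfn_left_end)
  then obtain \<Phi> where \<Phi>: "\<And>f n. \<Phi> $ f $ n = pr (pr (left_end f n) 0) (p2 n - 1)" by blast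
  have rv: "rv (\<Phi> $ f $ n) = le f n" for f n
    using p2_ge[of n] by (simp add: \<Phi> rv_pr q_diff le_def w_def)
  have "max_at f (\<Phi> $ f)" if f: "cu f" for f
    unfolding max_at_def
  proof (intro conjI allI impI)
    let ?x = "\<Phi> $ f"
    have "\<bar>le f n - le f (n + i)\<bar> < w n" for n i
      using le_nested[of f n i] w_pos(1)[of "n + i"] by linarith
    then show x: "iu ?x"
      unfolding iu_def isr_def rv using le_range[of f] w_pos(1) by (auto intro: add_nonneg_nonneg less_imp_le)
        (metis (no_types, opaque_lifting) add_increasing2 add_le_cancel_left le_add_same_cancel1 less_imp_le mult_nonneg_nonneg order_trans w_pos(2) zero_le_numeral)
    fix y assume y: "iu y"
    have isr: "isr (f $ z)" if "iu z" for z using f that by (simp add: cu_def)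
    show "rle (f $ y) (f $ ?x)"
    proof (rule lew_rle)
      fix k
      obtain N where N: "\<And>z. iu z \<Longrightarrow> rdist y z N \<Longrightarrow> rdist (f $ y) (f $ z) k"
        using f y unfolding cu_def by blast
      \<comment> \<open>Clamping costs at most \<open>2 * w ?n\<close> and \<open>rdist\<close> adds
        as much again; together this is at most \<open>w N / 2\<close>.\<close>
      let ?n = "N + 1 + 1 + 1" and ?r = "rv (y $ (N + 1 + 1 + 1))"
      have wn: "w ?n = w N / 8" by (simp add: w_S)
      obtain p where p: "0 \<le> rv p" "rv p \<le> 1" "\<bar>?r - rv p\<bar> \<le> 2 * w ?n"
      proof -
        \<comment> \<open>An approximation to \<open>y\<close> may leave the unit interval by up to
          \<open>2 * w ?n\<close>, so the rational point is clamped to the interval.\<close>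
        have b: "0 \<le> ?r + 2 * w ?n" "?r \<le> 1 + 2 * w ?n" using y unfolding iu_def by blast+
        consider "?r < 0" | "0 \<le> ?r" "?r \<le> 1" | "1 < ?r" by linarith
        then show thesis
        proof cases
          case 1 then show thesis using b that[of "pr (pr 0 0) 0"] rv_01 by auto
        next
          case 2 then show thesis using that[of "y $ ?n"] w_pos(1)[of ?n] by auto
        next
          case 3 then show thesis using b that[of "pr (pr 1 0) 0"] rv_01 by auto
        qed
      qed
      have "rdist y (comb_K $ p) N"
        unfolding rdist_def comb_K by (rule exI[of _ ?n]) (use p(3) w_pos(1)[of N] wn in linarith)
      then have 1: "lew (f $ y) (f $ (comb_K $ p)) (w k)"
        using rdist_lew(1)[OF isr isr N] y iu_const p by blast
      obtain M where M: "\<And>z. iu z \<Longrightarrow> rdist ?x z M \<Longrightarrow> rdist (f $ ?x) (f $ z) k"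
        using f x unfolding cu_def by blast
      let ?m = "M + 1 + 1"
      have wm: "w ?m = w M / 4" by (simp add: w_S)
      obtain p' where p': "seg ?m (left_end f ?m) p'" "lew (f $ (comb_K $ p)) (f $ (comb_K $ p')) (w k)"
        using max_dominates[OF f, of ?m] p unfolding dominated_def by blast
      then have s: "le f ?m \<le> rv p'" "rv p' \<le> le f ?m + w ?m" by (simp_all add: seg_le)
      then have r: "0 \<le> rv p'" "rv p' \<le> 1" using le_range[of f ?m] by linarith+
      have "rdist ?x (comb_K $ p') M"
        unfolding rdist_def comb_K rv by (rule exI[of _ ?m]) (use s w_pos(1)[of M] wm in linarith)
      then have 2: "lew (f $ (comb_K $ p')) (f $ ?x) (w k)"
        using rdist_lew(2)[OF isr isr M] x iu_const r by blast
      have "lew (f $ y) (f $ ?x) ((w k + w k) + w k)"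
        by (rule lew_trans[OF isr[OF y] isr[OF x] lew_trans[OF isr[OF y] isr 1 p'(2)] 2]) (use iu_const r in blast)
      then show "lew (f $ y) (f $ ?x) (3 * w k)" by (simp add: algebra_simps)
    qed
  qed
  then show ?thesis by blast
qed

end

end

section \<open>From maxima back to arithmetical comprehension\<close>

text \<open>The matrix common to both maximum principles, with continuity as a premise. It is
  internal, as \<open>HAC_int\<close> and \<open>PF_TP\<close> require.\<close>

definition max_fm :: "tm \<Rightarrow> tm \<Rightarrow> fm" where
  "max_fm f x = Imp (continuous_unit f)
     (Conj (in_unit x) (All (2, T1) (Imp (in_unit (Var (2, T1))) (real_leq (f \<cdot> Var (2, T1)) (f \<cdot> x)))))"

lemma max_fm_syntax:
  assumes "wft C f" "wft C x" "ty_of f = T1 \<Rrightarrow> T1" "ty_of x = T1"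
  shows "internal (max_fm f x)" "wff C (max_fm f x)"
    and fv_max_fm: "fv (max_fm f x) \<subseteq> tvars f \<union> tvars x"
proof -
  show "internal (max_fm f x)" by (simp add: max_fm_def)
  show "wff C (max_fm f x)" using assms by (simp add: max_fm_def wff_in_unit[where y=x] wff_in_unit[where y="Var (2, T1)"] wff_real(3))
  show "fv (max_fm f x) \<subseteq> tvars f \<union> tvars x"
    using fv_continuous[of f] fv_in_unit[of x] fv_in_unit[of "Var (2, T1)"] fv_real(3)[of "f \<cdot> Var (2, T1)" "f \<cdot> x"]
    by (auto simp: max_fm_def)
qed

lemma WEIMAX_fm: "WEIMAX_star = (let f = (0, T1 \<Rrightarrow> T1); x = (1, T1) in
    AllSt f (Imp (continuous_unit (Var f)) (ExSt x (Conj (in_unit (Var x))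
      (All (2, T1) (Imp (in_unit (Var (2, T1))) (real_leq (Var f \<cdot> Var (2, T1)) (Var f \<cdot> Var x))))))))"
  by (simp add: WEIMAX_star_def Let_def)

lemma UWEIMAX_fm: "UWEIMAX = Ex (0, (T1 \<Rrightarrow> T1) \<Rrightarrow> T1) (All (1, T1 \<Rrightarrow> T1)
    (max_fm (Var (1, T1 \<Rrightarrow> T1)) (Var (0, (T1 \<Rrightarrow> T1) \<Rrightarrow> T1) \<cdot> Var (1, T1 \<Rrightarrow> T1))))"
  by (simp add: UWEIMAX_def max_fm_def Let_def)

lemma principles_syntax:
  assumes "\<phi> \<in> {Pi01_TRANS, WEIMAX_star, UWEIMAX, exists2}"
  shows "wff C \<phi> \<and> fv \<phi> = {}"
proof -
  let ?f = "(0, T1 \<Rrightarrow> T1) :: var" and ?x = "(1, T1) :: var"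
  have "wff C WEIMAX_star \<and> fv WEIMAX_star = {}"
    using max_fm_syntax[of C "Var ?f" "Var ?x"] fv_in_unit[of "Var ?x"] fv_in_unit[of "Var (2, T1)"]
      fv_real(3)[of "Var ?f \<cdot> Var (2, T1)" "Var ?f \<cdot> Var ?x"] fv_continuous[of "Var ?f"]
    unfolding WEIMAX_fm Let_def by (auto simp: max_fm_def)
  moreover have "wff C UWEIMAX \<and> fv UWEIMAX = {}"
    using max_fm_syntax[of C "Var (1, T1 \<Rrightarrow> T1)" "Var (0, (T1 \<Rrightarrow> T1) \<Rrightarrow> T1) \<cdot> Var (1, T1 \<Rrightarrow> T1)"]
    unfolding UWEIMAX_fm by auto
  moreover have "wff C Pi01_TRANS \<and> fv Pi01_TRANS = {}" by (auto simp: Pi01_TRANS_def Let_def)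
  moreover have "wff C exists2 \<and> fv exists2 = {}" by (auto simp: exists2_def Let_def)
  ultimately show ?thesis using assms by blast
qed

definition WMAX :: bool where
  "WMAX \<longleftrightarrow> (\<forall>f. std f \<longrightarrow> cu f \<longrightarrow> (\<exists>x. std x \<and> max_at f x))"

definition UMAX :: bool where
  "UMAX \<longleftrightarrow> (\<exists>\<Phi>. \<forall>f. cu f \<longrightarrow> max_at f (\<Phi> $ f))"

context gmodel
begin

lemma sat_max_fm:
  assumes "val GM e t = rp f" "val GM e u = rp x" "(2, T1) \<notin> tvars t \<union> tvars u"
  shows "sat GM (max_fm t u) e \<longleftrightarrow> (cu f \<longrightarrow> max_at f x)"
  unfolding max_fm_def sat_Imp[of _ "continuous_unit _"] sat_continuous_unit[OF assms(1)] sat_max[OF assms] ..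

text \<open>The property of selecting maxima is internal and free of parameters, so a standard
  selector exists; its values at standard arguments are standard.\<close>

lemma UMAX_imp_WMAX: assumes UMAX shows WMAX
proof -
  let ?P = "(0, (T1 \<Rrightarrow> T1) \<Rrightarrow> T1) :: var" and ?f = "(1, T1 \<Rrightarrow> T1) :: var"
  let ?\<phi> = "All ?f (max_fm (Var ?f) (Var ?P \<cdot> Var ?f))"
  obtain e where e: "typed_env GM e" using env_ex ..
  note s = max_fm_syntax[of "dom D" "Var ?f" "Var ?P \<cdot> Var ?f"]
  have "\<exists>\<Phi>. std \<Phi> \<and> (\<forall>f. cu f \<longrightarrow> max_at f (\<Phi> $ f))"
  proof (rule transfer[where \<phi>="?\<phi>" and i=0 and \<sigma>="(T1 \<Rrightarrow> T1) \<Rrightarrow> T1", OF _ _ _ _ e])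
    show "internal ?\<phi>" "wff (dom D) ?\<phi>" "fv ?\<phi> \<subseteq> {?P}" using s by auto
    have "sat GM (max_fm (Var ?f) (Var ?P \<cdot> Var ?f)) (e(?P := rp \<Phi>, ?f := rp f)) \<longleftrightarrow> (cu f \<longrightarrow> max_at f (\<Phi> $ f))"
      for \<Phi> :: "((nn \<leadsto> nn) \<leadsto> nn \<leadsto> nn) \<leadsto> nn \<leadsto> nn" and f
      by (rule sat_max_fm) (auto simp: rp_app)
    then show "sat GM ?\<phi> (e(?P := rp \<Phi>)) \<longleftrightarrow> (\<forall>f. cu f \<longrightarrow> max_at f (\<Phi> $ f))"
      for \<Phi> :: "((nn \<leadsto> nn) \<leadsto> nn \<leadsto> nn) \<leadsto> nn \<leadsto> nn"
      by (subst sat_All[where 'a="(nn \<leadsto> nn) \<leadsto> nn \<leadsto> nn"]) simp_all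
  qed (use assms in \<open>auto simp: UMAX_def\<close>)
  then show ?thesis unfolding WMAX_def using std_app by blast
qed

lemma WMAX_HAC:
  assumes WMAX
  shows "\<exists>\<Phi>. std \<Phi> \<and> (\<forall>f. std f \<longrightarrow> cu f \<longrightarrow> (\<exists>k < lenS $ (\<Phi> $ f). max_at f (projS $ (\<Phi> $ f) $ k)))"
proof -
  let ?f = "(0, T1 \<Rrightarrow> T1) :: var" and ?x = "(1, T1) :: var"
  obtain e where e: "typed_env GM e" using env_ex ..
  note s = max_fm_syntax[of "dom D" "Var ?f" "Var ?x"]
  have "\<exists>F. std F \<and> (\<forall>f::(nn \<leadsto> nn) \<leadsto> nn \<leadsto> nn. std f \<longrightarrow>
      (\<exists>k < lenS $ (F $ f). cu f \<longrightarrow> max_at f (projS $ (F $ f) $ k)))"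
  proof (rule HAC[where \<phi>="max_fm (Var ?f) (Var ?x)" and i=0 and j=1 and l=3 and \<sigma>="T1 \<Rrightarrow> T1" and \<tau>=T1 and e=e])
    show "(3, (T1 \<Rrightarrow> T1) \<Rrightarrow> Seq T1) \<notin> fv (max_fm (Var ?f) (Var ?x))"
      using s(3) by auto
    show "sat GM (max_fm (Var ?f) (Var ?x)) (e(?f := rp f, ?x := rp x)) \<longleftrightarrow> (cu f \<longrightarrow> max_at f x)" for f x
      by (rule sat_max_fm) auto
    \<comment> \<open>At an \<open>f\<close> that is not continuous, a constant standard sequence
      serves as a default.\<close>
    show "\<exists>x. std x \<and> (cu f \<longrightarrow> max_at f x)" if "std f" for f
      using assms that std_app[OF std_K std_consts(1)] unfolding WMAX_def by blast
  qed (use s e in auto)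
  then show ?thesis by blast
qed

text \<open>
  Base four digits 0 and 3 are chosen so that the \<open>j\<close>-th digit moves the point away from the \<open>j\<close>-th entry.
\<close>

lemma avoid_list:
  fixes s :: "(nn \<leadsto> nn) sq"
  assumes s: "std s"
  defines "K \<equiv> lenS $ s"
  shows "\<exists>r. std r \<and> 0 \<le> rv r \<and> rv r \<le> 1 \<and>
    (\<forall>j<K. w (K + K + 1) < \<bar>rv (projS $ s $ j $ (K + K + 1)) - rv r\<bar>)"
proof -
  have K: "std K" unfolding K_def using s std_app std_consts by blast
  \<comment> \<open>One approximation of each entry is enough, taken at the stage at which the final
    test will read it.\<close>
  define y where "y j = rv (projS $ s $ j $ (K + K + 1))" for j
  \<comment> \<open>\<open>A j\<close> is a numerator over \<open>4^j\<close>. If the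
    \<open>j\<close>-th entry reaches the midpoint of the current segment, the lowest quarter is
    kept, otherwise the highest. The recursion runs inside the model because \<open>K\<close> is one
    of its numbers.\<close>
  define A where "A n = nrec n 0 (\<lambda>a j. if q a * w (j + j) + w (j + j + 1) \<le> y j then a + a + a + a else a + a + a + a + 1 + 1 + 1)" for n
  have dy: "dfn J \<Longrightarrow> dra (\<lambda>c. y (J c))" for J :: "'c::ctx \<Rightarrow> nn"
    unfolding y_def by (intro dfn_intros dfn_const[OF s] dfn_const[OF K])
  have dA: "dfn N \<Longrightarrow> dfn (\<lambda>c. A (N c))" for N :: "'c::ctx \<Rightarrow> nn"
    unfolding A_def by (intro dfn_intros dy)
  let ?F = "\<lambda>(c::unit) a j. if q a * w (j + j) + w (j + j + 1) \<le> y j then a + a + a + a else a + a + a + a + 1 + 1 + 1"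
  have "dfn (\<lambda>d. ?F (fst (fst d)) (snd (fst d)) (snd d))" by (intro dfn_intros dy)
  note A = nrec[where F="?F" and c="()", OF this, folded A_def]
  define a where "a j = q (A j) * w (j + j)" for j
  define v where "v j = w (j + j)" for j
  have v: "0 < v j" "v (j + 1) = v j / 4" "w (j + j + 1) = v j / 2" for j
  proof -
    have "(j + 1) + (j + 1) = (j + j) + 1 + 1" by (simp only: ac_simps)
    then show "v (j + 1) = v j / 4" by (simp only: v_def w_S)
    show "0 < v j" "w (j + j + 1) = v j / 2" by (simp_all only: v_def w_S w_pos)
  qed
  have step: "a (j + 1) = (if a j + v j / 2 \<le> y j then a j else a j + 3 * v j / 4)" for j
  proof -
    have 1: "A (j + 1) = (if a j + v j / 2 \<le> y j then A j + A j + A j + A j else A j + A j + A j + A j + 1 + 1 + 1)"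
      using A(2)[of j 0] v(3)[of j] by (simp only: A_def a_def v_def)
    have 2: "a (j + 1) = q (A (j + 1)) * (v j / 4)" unfolding v(2)[symmetric] by (simp only: a_def v_def)
    have 3: "a j = q (A j) * v j" by (simp only: a_def v_def)
    show ?thesis
    proof (cases "a j + v j / 2 \<le> y j")
      case True
      then have "q (A (j + 1)) = 4 * q (A j)" unfolding 1 by simp
      then show ?thesis using True unfolding 2 3 by simp
    next
      case False
      then have "q (A (j + 1)) = 4 * q (A j) + 3" unfolding 1 by simp
      then show ?thesis using False unfolding 2 3 by (simp add: field_simps)
    qed
  qed
  have nested: "a j \<le> a (j + d) \<and> a (j + d) + v (j + d) \<le> a j + v j" for j d
  proof (rule dpr_induct[where P="\<lambda>c d. a (snd c) \<le> a (snd c + d) \<and> a (snd c + d) + v (snd c + d) \<le> a (snd c) + v (snd c)" and c="((), j)", simplified])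
    show "dpr (\<lambda>d. a (snd (fst d)) \<le> a (snd (fst d) + snd d) \<and>
        a (snd (fst d) + snd d) + v (snd (fst d) + snd d) \<le> a (snd (fst d)) + v (snd (fst d)))"
      unfolding a_def v_def by (intro dfn_intros dA)
    fix d assume "a j \<le> a (j + d) \<and> a (j + d) + v (j + d) \<le> a j + v j"
    moreover have "a (j + d) \<le> a (j + d + 1) \<and> a (j + d + 1) + v (j + d + 1) \<le> a (j + d) + v (j + d)"
      using v(1)[of "j + d"] unfolding step v(2) by (auto simp: field_simps)
    ultimately show "a j \<le> a (j + (d + 1)) \<and> a (j + (d + 1)) + v (j + (d + 1)) \<le> a j + v j"
      by (auto simp only: add.assoc[symmetric] intro: order_trans)
  qed
  define r where "r = pr (pr (A K) 0) (p2 (K + K) - 1)"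
  have rv: "rv r = a K" using p2_ge[of "K + K"] by (simp add: r_def rv_pr q_diff a_def w_def)
  have "std r" unfolding r_def by (rule rep0, intro dfn_intros dA dfn_const[OF K])
  moreover have "0 \<le> a K" "a K \<le> 1"
  proof -
    have "a 0 = 0" "v 0 = 1" using A(1)[of 0] by (simp_all add: a_def v_def A_def)
    then show "0 \<le> a K" "a K \<le> 1" using nested[of 0 K] v(1)[of K] by auto
  qed
  \<comment> \<open>The distance is at least \<open>v j / 4\<close>, which is at least
    \<open>v K\<close>, twice the amount demanded.\<close>
  moreover have "w (K + K + 1) < \<bar>y j - a K\<bar>" if jK: "j < K" for j
  proof -
    obtain d where d: "K = j + 1 + d" using jK by (metis nn_less_iff nn_le_iff)
    have n: "a (j + 1) \<le> a K" "a K + v K \<le> a (j + 1) + v j / 4"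
      using nested[of "j + 1" d] v(2)[of j] by (simp_all flip: d)
    have "v K \<le> v j / 4" using n by linarith
    then show ?thesis using n step[of j] v(1)[of j] v(1)[of K] v(3)[of K] by (auto split: if_splits)
  qed
  ultimately have "std r \<and> 0 \<le> rv r \<and> rv r \<le> 1 \<and> (\<forall>j<K. w (K + K + 1) < \<bar>y j - rv r\<bar>)"
    unfolding rv by blast
  then show ?thesis unfolding y_def by blast
qed

section \<open>The height of a bump, determined by the first nonzero place of a sequence\<close>

lemma nn_not_less_0 [simp]: "\<not> a < (0::nn)"
  by (simp add: not_less)

text \<open>\<open>mz h n\<close> is the smaller one of \<open>n\<close> and the first argument at which \<open>h\<close> is not zero.\<close>

definition mz :: "(nn \<leadsto> nn) \<Rightarrow> nn \<Rightarrow> nn" where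
  "mz h n = nrec n 0 (\<lambda>m k. if m = k \<and> h $ k = 0 then m + 1 else m)"

lemma dfn_mz [dfn_intros]: "dfn h \<Longrightarrow> dfn N \<Longrightarrow> dfn (\<lambda>c. mz (h c) (N c))"
  unfolding mz_def by (intro dfn_intros dfn_weaken[of h, THEN dfn_weaken])

lemma mz_eqs: "mz h 0 = 0" "mz h (n + 1) = (if mz h n = n \<and> h $ n = 0 then mz h n + 1 else mz h n)"
proof -
  let ?F = "\<lambda>c (m::nn) k. if m = k \<and> snd c $ k = (0::nn) then m + 1 else m"
  have "dfn (\<lambda>d. ?F (fst (fst d) :: unit \<times> _) (snd (fst d)) (snd d))" by (intro dfn_intros)
  note * = nrec[where F="?F" and c="((), h)", OF this]
  show "mz h 0 = 0" "mz h (n + 1) = (if mz h n = n \<and> h $ n = 0 then mz h n + 1 else mz h n)"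
    unfolding mz_def using *(1)[of 0] *(2)[of n 0] by simp_all
qed

lemma mz_le: "mz h n \<le> n"
  by (rule dpr_induct[where P="\<lambda>c n. mz (snd c) n \<le> n" and c="((), h)", simplified];
      (intro dfn_intros)?) (auto simp: mz_eqs intro: order_trans)

lemma mz_zero: "\<forall>n. h $ n = 0 \<Longrightarrow> mz h n = n"
  by (rule dpr_induct[where P="\<lambda>c n. mz (snd c) n = n" and c="((), h)", simplified];
      (intro dfn_intros)?) (auto simp: mz_eqs)

lemma mz_full: "mz h n = n \<longrightarrow> (\<forall>i<n. h $ i = 0)"
proof (rule dpr_induct[where P="\<lambda>c n. mz (snd c) n = n \<longrightarrow> (\<forall>i<n. snd c $ i = 0)" and c="((), h)", unfolded snd_conv])
  show "dpr (\<lambda>d. mz (snd (fst d)) (snd d) = snd d \<longrightarrow> (\<forall>i<snd d. snd (fst d) $ i = 0))" by (intro dfn_intros)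
  show "mz h 0 = 0 \<longrightarrow> (\<forall>i<0. h $ i = 0)" by simp
  fix n assume IH: "mz h n = n \<longrightarrow> (\<forall>i<n. h $ i = 0)"
  show "mz h (n + 1) = n + 1 \<longrightarrow> (\<forall>i<n + 1. h $ i = 0)"
  proof (intro impI allI)
    fix i assume 1: "mz h (n + 1) = n + 1" "i < n + 1"
    have "mz h n \<noteq> n + 1" using mz_le[of h n] by (metis less_add_one not_le)
    then have "mz h n = n" "h $ n = 0" using 1(1) by (auto simp: mz_eqs split: if_splits)
    moreover have "i \<le> n" using 1(2) by (simp add: nn_less_iff)
    ultimately show "h $ i = 0" using IH by (cases "i = n") auto
  qed
qed

text \<open>Once the value has fallen behind its argument it cannot catch up, as the recursion adds
  one only while the two agree.\<close>

lemma mz_stable: "mz h n < n \<Longrightarrow> mz h (n + d) = mz h n"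
proof -
  assume n: "mz h n < n"
  have "mz h n < n \<longrightarrow> mz h (n + d) = mz h n"
  proof (rule dpr_induct[where P="\<lambda>c d. mz (snd (fst c)) (snd c) < snd c \<longrightarrow> mz (snd (fst c)) (snd c + d) = mz (snd (fst c)) (snd c)"
        and c="(((), h), n)", simplified])
    fix d assume "mz h n < n \<longrightarrow> mz h (n + d) = mz h n"
    moreover have "n \<le> n + d" by (simp add: nn_le_iff)
    ultimately show "mz h n < n \<longrightarrow> mz h (n + (d + 1)) = mz h n"
      by (auto simp: mz_eqs simp flip: add.assoc)
  qed (intro dfn_intros)
  then show ?thesis using n by simp
qed

lemma mz_lower: "mz h n = n \<Longrightarrow> n \<le> mz h (n + d)"
proof -
  assume n: "mz h n = n"
  have "mz h n \<le> mz h (n + d)"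
    by (rule dpr_induct[where P="\<lambda>c d. mz (snd (fst c)) (snd c) \<le> mz (snd (fst c)) (snd c + d)" and c="(((), h), n)", simplified];
        (intro dfn_intros)?) (auto simp: mz_eqs simp flip: add.assoc intro: order_trans)
  then show ?thesis using n by simp
qed

text \<open>The \<open>n\<close>-th approximation to a height that is positive exactly when
  \<open>h\<close> has a nonzero value. It is computed from the values of \<open>h\<close> below
  \<open>n\<close>, without deciding which case holds.\<close>

definition ev :: "(nn \<leadsto> nn) \<Rightarrow> nn \<Rightarrow> qq" where "ev h n = (if mz h n = n then 0 else w (mz h n))"

lemma dra_ev [dfn_intros]: "dfn h \<Longrightarrow> dfn N \<Longrightarrow> dra (\<lambda>c. ev (h c) (N c))"
  unfolding ev_def by (intro dfn_intros)

text \<open>While only zeros have been seen, every later height is at most \<open>w n\<close>; after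
  a nonzero value the height stays fixed.\<close>

lemma ev_near: "\<bar>ev h n - ev h (n + d)\<bar> \<le> w n"
proof (cases "mz h n = n")
  case True
  then have "w (mz h (n + d)) \<le> w n" using mz_lower w_mono by blast
  then show ?thesis using True by (simp add: ev_def)
next
  case False
  then have l: "mz h n < n" using mz_le[of h n] by simp
  moreover have "n \<le> n + d" by (simp add: nn_le_iff)
  ultimately have "ev h (n + d) = ev h n" using mz_stable[OF l, of d] by (auto simp: ev_def)
  then show ?thesis by simp
qed

lemma ev_pos: "h $ i \<noteq> 0 \<Longrightarrow> \<exists>e>0. \<forall>n. i < n \<longrightarrow> ev h n = e"
proof -
  assume h: "h $ i \<noteq> 0"
  have l: "mz h n < n" if "i < n" for n using mz_full[of h n] mz_le[of h n] that h by force
  have "ev h n = w (mz h (i + 1))" if i: "i < n" for n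
  proof -
    obtain d where "n = i + 1 + d" using i by (metis nn_less_iff nn_le_iff)
    moreover have "mz h n \<noteq> n" using l[OF \<open>i < n\<close>] by simp
    ultimately show ?thesis using mz_stable[OF l[of "i + 1"], of d] by (simp add: ev_def)
  qed
  then show ?thesis using w_pos(1) by blast
qed

text \<open>\<open>Y\<close> inspects the list attached to the bump of \<open>h\<close>. If
  \<open>h\<close> is standard and has a nonzero value, some listed point is a maximum of the bump
  and hence lies at \<open>r\<close>. The bump of the zero sequence is \<open>Z\<close> itself, and
  \<open>r\<close> was chosen away from the list of \<open>Z\<close>.\<close>

lemma WMAX_imp_E2: assumes WMAX shows E2
proof -
  obtain \<Phi> where \<Phi>: "std \<Phi>"
    "\<And>f. std f \<Longrightarrow> cu f \<Longrightarrow> \<exists>k < lenS $ (\<Phi> $ f). max_at f (projS $ (\<Phi> $ f) $ k)"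
    using WMAX_HAC[OF assms] by blast
  let ?z = "pr (pr 0 0) 0"
  define Z :: "(nn \<leadsto> nn) \<leadsto> nn \<leadsto> nn" where "Z = comb_K $ (comb_K $ ?z)"
  have Z: "std Z" unfolding Z_def by (rule rep0, intro dfn_intros)
  define K where "K = lenS $ (\<Phi> $ Z)"
  define M where "M = K + K + 1"
  have "std (\<Phi> $ Z)" by (intro std_app \<Phi>(1) Z)
  then obtain r where r: "std r" "0 \<le> rv r" "rv r \<le> 1"
    "\<And>j. j < K \<Longrightarrow> w M < \<bar>rv (projS $ (\<Phi> $ Z) $ j $ M) - rv r\<bar>"
    using avoid_list[of "\<Phi> $ Z"] unfolding M_def K_def by blast
  have "std K" unfolding K_def by (intro std_app std_consts \<Phi>(1) Z)
  then have M: "std M" unfolding M_def by (intro rep0 dfn_intros dfn_const[OF \<open>std K\<close>])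
  \<comment> \<open>The absolute value is spelled out because the \<open>dra\<close> rules cover
    case distinctions but not \<open>abs\<close>. The shift by three stages makes room for the added
    errors of the height and of \<open>x\<close>.\<close>
  define g where "g h x n = ev h (n + 1 + 1 + 1) -
      (if rv (x $ (n + 1 + 1 + 1)) < rv r then rv r - rv (x $ (n + 1 + 1 + 1)) else rv (x $ (n + 1 + 1 + 1)) - rv r)"
    for h x :: "nn \<leadsto> nn" and n
  have g: "g h x n = ev h (n + 1 + 1 + 1) - \<bar>rv (x $ (n + 1 + 1 + 1)) - rv r\<bar>" for h x n
    by (simp add: g_def)
  have dg: "dra (\<lambda>c::((unit \<times> (nn \<leadsto> nn)) \<times> (nn \<leadsto> nn)) \<times> nn. g (snd (fst (fst c))) (snd (fst c)) (snd c))"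
    unfolding g_def by (intro dfn_intros dfn_const[OF r(1)])
  then obtain X where X: "dfn X"
    "\<And>c::((unit \<times> (nn \<leadsto> nn)) \<times> (nn \<leadsto> nn)) \<times> nn. g (snd (fst (fst c))) (snd (fst c)) (snd c) = rv (X c)"
    unfolding dra_def by blast
  have "(\<lambda>c. X ((((), snd (fst (fst c))), snd (fst c)), snd c)) = X" by (simp add: fun_eq_iff)
  then have dX: "dfn (\<lambda>c::((unit \<times> (nn \<leadsto> nn)) \<times> (nn \<leadsto> nn)) \<times> nn. X ((((), snd (fst (fst c))), snd (fst c)), snd c))"
    using X(1) by simp
  \<comment> \<open>Nonpositive values are all given the one code \<open>?z\<close>. Functionals of
    the model are identical only if their codes agree, so this makes \<open>G $ zeroR\<close> and
    \<open>Z\<close> the same element, with the same list under \<open>\<Phi>\<close>.\<close>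
  have "\<exists>G. std G \<and> (\<forall>h x n. G $ h $ x $ n = (if g h x n \<le> 0 then ?z else X ((((), h), x), n)))"
    by (rule rep3, intro dfn_intros dg dX)
  then obtain G where G: "std G" "\<And>h x n. G $ h $ x $ n = (if g h x n \<le> 0 then ?z else X ((((), h), x), n))"
    by blast
  have rvG: "rv (G $ h $ x $ n) = max 0 (g h x n)" for h x n
    using X(2)[of "((((), h), x), n)"] by (simp add: G(2) rv_01 max_def)
  have w3: "w (n + 1 + 1 + 1) = w n / 8" for n by (simp add: w_S)
  have max_diff: "\<bar>max 0 s - max 0 t\<bar> \<le> \<bar>s - t\<bar>" for s t :: qq by (simp add: max_def abs_if)
  have cont: "cu (G $ h)" for h
    unfolding cu_def
  proof (intro conjI allI impI)
    fix x assume "iu x"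
    then have x: "isr x" by (simp add: iu_def)
    show "isr (G $ h $ x)" unfolding isr_def
    proof (intro allI)
      fix n i :: nn
      let ?n = "n + 1 + 1 + 1"
      have s: "n + i + 1 + 1 + 1 = ?n + i" by (simp only: ac_simps)
      have "\<bar>g h x n - g h x (n + i)\<bar> \<le> w ?n + w ?n"
        using ev_near[of h ?n i] x[unfolded isr_def, rule_format, of ?n i] unfolding g s by linarith
      then show "\<bar>rv (G $ h $ x $ n) - rv (G $ h $ x $ (n + i))\<bar> < w n"
        using max_diff[of "g h x n" "g h x (n + i)"] w_pos(1)[of n] w3[of n] unfolding rvG by linarith
    qed
  next
    fix x y assume "req x y"
    show "req (G $ h $ x) (G $ h $ y)" unfolding req_def
    proof (intro allI)
      fix n :: nn
      let ?n = "n + 1 + 1 + 1"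
      have "\<bar>rv (x $ ?n) - rv (y $ ?n)\<bar> \<le> w ?n" using \<open>req x y\<close> unfolding req_def by blast
      then have "\<bar>g h x n - g h y n\<bar> \<le> w ?n" unfolding g by linarith
      then show "\<bar>rv (G $ h $ x $ n) - rv (G $ h $ y $ n)\<bar> \<le> w n"
        using max_diff[of "g h x n" "g h y n"] w_pos(1)[of n] w3[of n] unfolding rvG by linarith
    qed
  next
    fix x and k :: nn assume "iu x"
    then have x: "isr x" by (simp add: iu_def)
    show "\<exists>N. \<forall>y. iu y \<longrightarrow> rdist x y N \<longrightarrow> rdist (G $ h $ x) (G $ h $ y) k"
    \<comment> \<open>The bump is 1-Lipschitz; half of the tolerance is kept for the error of the
      late stage at which the values are compared.\<close>
    proof (rule exI[of _ "k + 1"], intro allI impI)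
      fix y assume "iu y" "rdist x y (k + 1)"
      then obtain n where y: "isr y" and n: "\<bar>rv (x $ n) - rv (y $ n)\<bar> + 2 * w n < w (k + 1)"
        by (auto simp: iu_def rdist_def)
      let ?m = "n + (k + 1 + 1)"
      let ?n = "?m + 1 + 1 + 1"
      have "n \<le> ?n" unfolding nn_le_iff by (rule exI[of _ "k + 1 + 1 + 1 + 1 + 1"]) (simp only: ac_simps)
      then have "\<bar>rv (x $ ?n) - rv (y $ ?n)\<bar> < w (k + 1)"
        using n isr_near[OF x, of n ?n] isr_near[OF y, of n ?n] by linarith
      then have "\<bar>g h x ?m - g h y ?m\<bar> < w (k + 1)" unfolding g by linarith
      moreover have "w ?m \<le> w (k + 1 + 1)" using w_add[of "k + 1 + 1" n] by (simp only: ac_simps)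
      moreover have "w (k + 1) = w k / 2" "w (k + 1 + 1) = w k / 4" by (simp_all add: w_S)
      ultimately have "\<bar>max 0 (g h x ?m) - max 0 (g h y ?m)\<bar> + 2 * w ?m < w k"
        using max_diff[of "g h x ?m" "g h y ?m"] by linarith
      then show "rdist (G $ h $ x) (G $ h $ y) k" unfolding rdist_def rvG by blast
    qed
  qed
  have near: "\<bar>rv (x $ M) - rv r\<bar> \<le> w M" if hi: "h $ i \<noteq> 0" and mx: "max_at (G $ h) x" for h i x
  proof (rule le_w4)
    fix j :: nn
    obtain e where e: "0 < e" "\<And>n. i < n \<Longrightarrow> ev h n = e" using ev_pos[of h i] hi by blast
    \<comment> \<open>This excludes the clipped part: where the bump is 0, its value falls short of
      the height \<open>e\<close> by more than \<open>2 * w l\<close>.\<close>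
    obtain l where l: "w l < e / 2" using w_arch[of "e / 2"] e by auto
    let ?m = "i + M + j + l"
    let ?n = "?m + 1 + 1 + 1"
    have "?n = i + 1 + (M + j + l + 1 + 1)" "?n = M + (i + j + l + 1 + 1 + 1)" "?m = j + (i + M + l)" "?m = l + (i + M + j)"
      by (simp_all only: ac_simps)
    then have le: "i + 1 \<le> ?n" "M \<le> ?n" "j \<le> ?m" "l \<le> ?m" unfolding nn_le_iff by blast+
    have "ev h ?n = e" using e(2) le(1) nn_less_iff by blast
    moreover have "rle (G $ h $ (comb_K $ r)) (G $ h $ x)" and x: "isr x"
      using mx iu_const[OF r(2,3)] unfolding max_at_def iu_def by blast+
    then have "rv (G $ h $ (comb_K $ r) $ ?m) \<le> rv (G $ h $ x $ ?m) + 2 * w ?m" unfolding rle_def by blast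
    ultimately have "max 0 e \<le> max 0 (e - \<bar>rv (x $ ?n) - rv r\<bar>) + 2 * w ?m" unfolding rvG g by simp
    moreover have "w ?m \<le> w l" "w ?m \<le> w j" using le w_mono by blast+
    ultimately have "\<bar>rv (x $ ?n) - rv r\<bar> \<le> 2 * w j" using e(1) l by (auto simp: max_def split: if_splits)
    then show "\<bar>rv (x $ M) - rv r\<bar> \<le> w M + 4 * w j"
      using isr_near[OF x le(2)] w_pos(1)[of j] by linarith
  qed
  have "\<exists>Y. std Y \<and> (\<forall>h. Y $ h = (if \<exists>k < lenS $ (\<Phi> $ (G $ h)).
      rv (projS $ (\<Phi> $ (G $ h)) $ k $ M) - rv r \<le> w M \<and> rv r - rv (projS $ (\<Phi> $ (G $ h)) $ k $ M) \<le> w M then 1 else 0 :: nn))"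
    by (rule rep1, intro dfn_intros dfn_const[OF \<Phi>(1)] dfn_const[OF G(1)] dfn_const[OF M] dfn_const[OF r(1)])
  then obtain Y where Y: "std Y" "\<And>h. Y $ h = (if \<exists>k < lenS $ (\<Phi> $ (G $ h)).
      rv (projS $ (\<Phi> $ (G $ h)) $ k $ M) - rv r \<le> w M \<and> rv r - rv (projS $ (\<Phi> $ (G $ h)) $ k $ M) \<le> w M then 1 else 0 :: nn)"
    by blast
  show E2
  proof (rule E2_from_standard[OF Y(1)])
    have "G $ zeroR = Z"
    proof (intro ext)
      fix x n
      have "g zeroR x n \<le> 0" using mz_zero[of zeroR] by (simp add: g ev_def)
      then show "G $ zeroR $ x $ n = Z $ x $ n" by (simp add: G(2) Z_def)
    qed
    then have eq: "\<Phi> $ (G $ zeroR) = \<Phi> $ Z" by simp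
    have "\<not> (rv (projS $ (\<Phi> $ Z) $ k $ M) - rv r \<le> w M \<and> rv r - rv (projS $ (\<Phi> $ Z) $ k $ M) \<le> w M)" if k: "k < K" for k
      using r(4)[OF k] by linarith
    then show "Y $ zeroR = 0" unfolding Y(2) eq K_def[symmetric] by auto
    show "Y $ h \<noteq> 0" if h: "std h" "h $ n \<noteq> 0" for h n
    proof -
      obtain k where k: "k < lenS $ (\<Phi> $ (G $ h))" "max_at (G $ h) (projS $ (\<Phi> $ (G $ h)) $ k)"
        using \<Phi>(2)[OF std_app[OF G(1) h(1)] cont] by blast
      then show ?thesis using near[OF h(2) k(2)] unfolding Y(2) by (auto simp: abs_le_iff)
    qed
  qed
qed

text \<open>Four implications besides \<open>TRANS_imp_E2\<close> suffice: back from
  \<open>E2\<close> to \<open>TRANS\<close>, and the cycle from \<open>E2\<close> through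
  \<open>UMAX\<close> and \<open>WMAX\<close> to \<open>E2\<close>.\<close>

lemma equivalences_GM: "equivalences GM"
proof -
  have "E2 \<Longrightarrow> UMAX" unfolding UMAX_def using E2_imp_mu mu_imp_max by blast
  then have "TRANS = WMAX" "WMAX = UMAX" "UMAX = E2"
    using TRANS_imp_E2 E2_imp_TRANS UMAX_imp_WMAX WMAX_imp_E2 by blast+
  then show ?thesis
    unfolding equivalences_def sat_TRANS sat_WEIMAX sat_UWEIMAX sat_exists2
    unfolding TRANS_def WMAX_def UMAX_def E2_def by simp
qed

end

text \<open>An unprovable equivalence has a counter-model, so the choice of \<open>GM\<close> would
  have succeeded, against \<open>equivalences_GM\<close>. The specification for which
  \<open>GM\<close> is a model may differ from the given \<open>D\<close>, which is why it is a
  parameter of the locale \<open>gmodel\<close>.\<close>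

lemma provable_if_equivalences:
  assumes \<phi>: "\<phi> \<in> {Pi01_TRANS, WEIMAX_star, UWEIMAX, exists2}" and \<psi>: "\<psi> \<in> {Pi01_TRANS, WEIMAX_star, UWEIMAX, exists2}"
    and eq: "\<And>M e. equivalences M \<Longrightarrow> typed_env M e \<Longrightarrow> sat M \<phi> e = sat M \<psi> e"
  shows "RCA0_Omega_proves D (Iff \<phi> \<psi>)"
proof (rule ccontr)
  assume "\<not> ?thesis"
  moreover have "wff (dom D) (Iff \<phi> \<psi>)" "fv (Iff \<phi> \<psi>) = {}"
    using principles_syntax[OF \<phi>, of "dom D"] principles_syntax[OF \<psi>, of "dom D"] by auto
  ultimately obtain M :: "tm strc" where M: "omega_model D M" "\<And>e. typed_env M e \<Longrightarrow> \<not> sat M (Iff \<phi> \<psi>) e"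
    using model_existence by blast
  have "sdom M \<sigma> \<noteq> {}" for \<sigma> using M(1) by (simp add: omega_model_def typed_strc_def)
  then have "typed_env M (\<lambda>x. SOME u. u \<in> sdom M (snd x))" by (simp add: typed_env_def some_in_eq)
  then have "\<not> equivalences M" using M(2) eq by fastforce
  then have "\<exists>M. \<exists>D. omega_model D M \<and> \<not> equivalences M" using M(1) by blast
  then have "\<exists>D. omega_model D GM \<and> \<not> equivalences GM" unfolding GM_def by (rule someI_ex)
  then show False using gmodel.equivalences_GM gmodel.intro by blast
qed

theorem theorem3p13:
  fixes D :: specs
  assumes "admissible_specs D"
  shows "RCA0_Omega_proves D (Iff Pi01_TRANS WEIMAX_star)
       \<and> RCA0_Omega_proves D (Iff WEIMAX_star UWEIMAX)
       \<and> RCA0_Omega_proves D (Iff UWEIMAX exists2)"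
  by (intro conjI provable_if_equivalences) (auto simp: equivalences_def)

end
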